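(* Let $A$ be a hypo-Dirichlet algebra on a compact Hausdorff space $X$, let $\varphi$ be a multiplicative linear functional on $A$, and let $m$ be a representing measure for $\varphi$. Suppose that $m$ is a core measure for $\varphi$ and that $H^{2}(m)$ is a reproducing kernel Hilbert space. Then $H^{\infty}(m)$, acting on $H^{2}(m)$ by multiplication, is catalytic on $H^{2}(m)$; that is, every transitive subalgebra of $B(H^{2}(m))$ containing $\{T_h : h\in H^{\infty}(m)\}$ is dense in $B(H^{2}(m))$ in the strong operator topology.
   Context: A uniform algebra on a compact Hausdorff space $X$ is a uniformly closed subalgebra $A$ of $C(X)$ (continuous complex-valued functions) containing the constants and separating the points of $X$; $A^{-1}$ is the set of invertible elements of $A$ and $\mathrm{Re}\,A$ is the set of real parts of elements of $A$. $A$ is a hypo-Dirichlet algebra if there is a finite set $\{f_1,\dots,f_s\}\subset A^{-1}$ such that the real linear span of $\mathrm{Re}\,A$ and $\log|f_1|,\dots,\log|f_s|$ is uniformly dense in $\mathrm{Re}\,C(X)$. Let $M_A$ be the set of (nonzero) multiplicative linear functionals on $A$. A representing measure for $\varphi\in M_A$ is a positive measure $m$ on $X$ with $\varphi(f)=\int_X f\,dm$ for all $f\in A$; $\mathcal{M}(\varphi)$ is the convex set of all of them. A point $x$ of a convex subset $K$ of a real vector space $V$ is a core point of $K$ if whenever $y\in V$ satisfies $x+y\in K$, then $x-\epsilon y\in K$ for all sufficiently small $\epsilon>0$. The measure $m$ is a core measure for $\varphi$ if it is a core point of $\mathcal{M}(\varphi)$ (in the space of real measures on $X$). $H^{2}(m)$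 is the closure of $A$ in $L^{2}(m)$, and $H^{\infty}(m)$ is the weak-star closure of $A$ in $L^{\infty}(m)$. For $h\in H^{\infty}(m)$, $T_h\in B(H^{2}(m))$ is $T_hf=hf$. "$H^{2}(m)$ is a reproducing kernel Hilbert space" means: there is a set $\Omega\subset M_A$ such that for each $\lambda\in\Omega$ the functional $f\mapsto\lambda(f)$ on $A$ extends to a bounded linear functional on $H^{2}(m)$, written $f\mapsto f(\lambda)$, and an element $f\in H^{2}(m)$ with $f(\lambda)=0$ for all $\lambda\in\Omega$ is $0$. $B(\mathcal{H})$ is the algebra of bounded linear operators on a complex Hilbert space $\mathcal{H}$. A unital subalgebra of $B(\mathcal{H})$ is transitive if its only closed invariant subspaces are $\{0\}$ and $\mathcal{H}$. A set of operators is catalytic if every transitive subalgebra of $B(\mathcal{H})$ containing it is strongly dense in $B(\mathcal{H})$. *)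

theory Defs
  imports "HOL-Analysis.Analysis"
begin

text \<open>The compact Hausdorff space \<open>X\<close> is a type \<open>'a::t2_space\<close> with \<open>compact (UNIV :: 'a set)\<close>
  (assumed where it is needed); \<open>C(X)\<close> is the set of continuous functions \<open>'a \<Rightarrow> complex\<close>.\<close>

definition uniform_algebra :: "('a::t2_space \<Rightarrow> complex) set \<Rightarrow> bool" where
  "uniform_algebra A \<longleftrightarrow>
     (\<forall>f\<in>A. continuous_on UNIV f) \<and>
     (\<forall>c. (\<lambda>x. c) \<in> A) \<and>
     (\<forall>f\<in>A. \<forall>g\<in>A. (\<lambda>x. f x + g x) \<in> A) \<and>
     (\<forall>f\<in>A. \<forall>g\<in>A. (\<lambda>x. f x * g x) \<in> A) \<and>
     (\<forall>x y. x \<noteq> y \<longrightarrow> (\<exists>f\<in>A. f x \<noteq> f y)) \<and>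
     (\<forall>f. (\<forall>e>0. \<exists>g\<in>A. \<forall>x. cmod (f x - g x) < e) \<longrightarrow> f \<in> A)"

definition invertibles :: "('a \<Rightarrow> complex) set \<Rightarrow> ('a \<Rightarrow> complex) set" where
  "invertibles A = {f \<in> A. \<exists>g\<in>A. \<forall>x. f x * g x = 1}"

definition real_parts :: "('a \<Rightarrow> complex) set \<Rightarrow> ('a \<Rightarrow> real) set" where
  "real_parts A = (\<lambda>f x. Re (f x)) ` A"

definition real_linear_span :: "('a \<Rightarrow> real) set \<Rightarrow> ('a \<Rightarrow> real) set" where
  "real_linear_span S = {(\<lambda>x. \<Sum>s\<in>T. c s * s x) | T c. finite T \<and> T \<subseteq> S}"

definition hypo_Dirichlet :: "('a::t2_space \<Rightarrow> complex) set \<Rightarrow> bool" where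
  "hypo_Dirichlet A \<longleftrightarrow> uniform_algebra A \<and>
     (\<exists>F. finite F \<and> F \<subseteq> invertibles A \<and>
        (\<forall>u :: 'a \<Rightarrow> real. continuous_on UNIV u \<longrightarrow>
          (\<forall>e>0. \<exists>v \<in> real_linear_span (real_parts A \<union> (\<lambda>f x. ln (cmod (f x))) ` F).
             \<forall>x. \<bar>u x - v x\<bar> < e)))"

text \<open>Functionals on \<open>A\<close> are total functions whose values off \<open>A\<close> are irrelevant.\<close>

definition mult_functional :: "('a \<Rightarrow> complex) set \<Rightarrow> (('a \<Rightarrow> complex) \<Rightarrow> complex) \<Rightarrow> bool" where
  "mult_functional A \<phi> \<longleftrightarrow>
     (\<forall>f\<in>A. \<forall>g\<in>A. \<phi> (\<lambda>x. f x + g x) = \<phi> f + \<phi> g) \<and>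
     (\<forall>c. \<forall>f\<in>A. \<phi> (\<lambda>x. c * f x) = c * \<phi> f) \<and>
     (\<forall>f\<in>A. \<forall>g\<in>A. \<phi> (\<lambda>x. f x * g x) = \<phi> f * \<phi> g) \<and>
     (\<exists>f\<in>A. \<phi> f \<noteq> 0)"

text \<open>As usual for possibly non-metrizable \<open>X\<close>, a positive measure on \<open>X\<close> is a finite regular Borel
  measure. For a finite measure on a compact space, outer regularity follows from the inner regularity
  required here.\<close>

definition regular_borel_measure :: "'a::t2_space measure \<Rightarrow> bool" where
  "regular_borel_measure m \<longleftrightarrow> sets m = sets borel \<and> finite_measure m \<and>
     (\<forall>B\<in>sets borel. emeasure m B = (SUP K\<in>{K. compact K \<and> K \<subseteq> B}. emeasure m K))"

definition representing_measure ::
    "('a::t2_space \<Rightarrow> complex) set \<Rightarrow> (('a \<Rightarrow> complex) \<Rightarrow> complex) \<Rightarrow> 'a measure \<Rightarrow> bool" where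
  "representing_measure A \<phi> m \<longleftrightarrow> regular_borel_measure m \<and> (\<forall>f\<in>A. \<phi> f = integral\<^sup>L m f)"

text \<open>The real vector space of finite real-valued (signed) Borel measures, as countably additive set
  functions that vanish off the Borel sets. Regularity is not imposed: whether a point is a core point
  of a convex set depends only on that set and not on the ambient vector space.\<close>

typedef (overloaded) 'a real_measure =
  "{\<mu> :: 'a::topological_space set \<Rightarrow> real. (\<forall>B. B \<notin> sets borel \<longrightarrow> \<mu> B = 0) \<and>
     (\<forall>B :: nat \<Rightarrow> 'a set. range B \<subseteq> sets borel \<longrightarrow> disjoint_family B \<longrightarrow>
        (\<lambda>n. \<mu> (B n)) sums \<mu> (\<Union>n. B n))}"
  morphisms measure_value Abs_real_measure
  by (rule exI[of _ "\<lambda>_. 0"]) auto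

setup_lifting type_definition_real_measure

instantiation real_measure :: (topological_space) real_vector
begin

lift_definition zero_real_measure :: "'a real_measure" is "\<lambda>_. 0"
  by auto

lift_definition plus_real_measure :: "'a real_measure \<Rightarrow> 'a real_measure \<Rightarrow> 'a real_measure"
  is "\<lambda>\<mu> \<nu> B. \<mu> B + \<nu> B"
  by (auto intro!: sums_add)

lift_definition minus_real_measure :: "'a real_measure \<Rightarrow> 'a real_measure \<Rightarrow> 'a real_measure"
  is "\<lambda>\<mu> \<nu> B. \<mu> B - \<nu> B"
  by (auto intro!: sums_diff)

lift_definition uminus_real_measure :: "'a real_measure \<Rightarrow> 'a real_measure"
  is "\<lambda>\<mu> B. - \<mu> B"
  by (auto intro!: sums_minus)

lift_definition scaleR_real_measure :: "real \<Rightarrow> 'a real_measure \<Rightarrow> 'a real_measure"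
  is "\<lambda>c \<mu> B. c * \<mu> B"
  by (auto intro!: sums_mult)

instance
  by standard (transfer; auto simp: algebra_simps)+

end

definition real_measure_of :: "'a::topological_space measure \<Rightarrow> 'a real_measure" where
  "real_measure_of m = Abs_real_measure (measure m)"

lemma measure_value_real_measure_of:
  fixes m :: "'a::topological_space measure"
  assumes "sets m = sets borel" and "finite_measure m"
  shows "measure_value (real_measure_of m) = measure m"
  unfolding real_measure_of_def
proof (rule Abs_real_measure_inverse, safe)
  fix B :: "'a set" assume "B \<notin> sets borel"
  then show "measure m B = 0"
    using assms(1) by (simp add: measure_notin_sets)
next
  fix B :: "nat \<Rightarrow> 'a set" assume "range B \<subseteq> sets borel" "disjoint_family B"
  then show "(\<lambda>n. measure m (B n)) sums measure m (\<Union>n. B n)"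
    using finite_measure.finite_measure_UNION[OF assms(2)] assms(1) by simp
qed

definition core_point :: "'v::real_vector set \<Rightarrow> 'v \<Rightarrow> bool" where
  "core_point K x \<longleftrightarrow> x \<in> K \<and>
     (\<forall>y. x + y \<in> K \<longrightarrow> (\<forall>\<^sub>F \<epsilon> in at_right (0::real). x - \<epsilon> *\<^sub>R y \<in> K))"

definition core_measure ::
    "('a::t2_space \<Rightarrow> complex) set \<Rightarrow> (('a \<Rightarrow> complex) \<Rightarrow> complex) \<Rightarrow> 'a measure \<Rightarrow> bool" where
  "core_measure A \<phi> m \<longleftrightarrow>
     core_point (real_measure_of ` {m'. representing_measure A \<phi> m'}) (real_measure_of m)"

text \<open>The space \<open>H\<^sup>2(m)\<close> depends on \<open>m\<close> and so cannot be a type; a complex Hilbert space is given by a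
  carrier with operations. The inner product is linear in its first argument.\<close>

record 'v hilbert =
  vectors :: "'v set"
  hzero :: 'v
  hadd :: "'v \<Rightarrow> 'v \<Rightarrow> 'v"
  hscale :: "complex \<Rightarrow> 'v \<Rightarrow> 'v"
  hinner :: "'v \<Rightarrow> 'v \<Rightarrow> complex"

definition hnorm :: "'v hilbert \<Rightarrow> 'v \<Rightarrow> real" where
  "hnorm H x = sqrt (Re (hinner H x x))"

definition hdist :: "'v hilbert \<Rightarrow> 'v \<Rightarrow> 'v \<Rightarrow> real" where
  "hdist H x y = hnorm H (hadd H x (hscale H (-1) y))"

definition hclosure :: "'v hilbert \<Rightarrow> 'v set \<Rightarrow> 'v set" where
  "hclosure H S = {x \<in> vectors H. \<forall>e>0. \<exists>s\<in>S. hdist H x s < e}"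

definition closed_subspace :: "'v hilbert \<Rightarrow> 'v set \<Rightarrow> bool" where
  "closed_subspace H M \<longleftrightarrow> M \<subseteq> vectors H \<and> hzero H \<in> M \<and>
     (\<forall>x\<in>M. \<forall>y\<in>M. hadd H x y \<in> M) \<and> (\<forall>c. \<forall>x\<in>M. hscale H c x \<in> M) \<and>
     hclosure H M \<subseteq> M"

definition bounded_functional :: "'v hilbert \<Rightarrow> ('v \<Rightarrow> complex) \<Rightarrow> bool" where
  "bounded_functional H L \<longleftrightarrow>
     (\<forall>x\<in>vectors H. \<forall>y\<in>vectors H. L (hadd H x y) = L x + L y) \<and>
     (\<forall>c. \<forall>x\<in>vectors H. L (hscale H c x) = c * L x) \<and>
     (\<exists>C. \<forall>x\<in>vectors H. cmod (L x) \<le> C * hnorm H x)"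

text \<open>\<open>B(H)\<close>: operators are extensional functions on the carrier, so that equality of operators is
  equality in HOL.\<close>

definition bounded_ops :: "'v hilbert \<Rightarrow> ('v \<Rightarrow> 'v) set" where
  "bounded_ops H = {T \<in> vectors H \<rightarrow>\<^sub>E vectors H.
     (\<forall>x\<in>vectors H. \<forall>y\<in>vectors H. T (hadd H x y) = hadd H (T x) (T y)) \<and>
     (\<forall>c. \<forall>x\<in>vectors H. T (hscale H c x) = hscale H c (T x)) \<and>
     (\<exists>C. \<forall>x\<in>vectors H. hnorm H (T x) \<le> C * hnorm H x)}"

definition unital_subalgebra :: "'v hilbert \<Rightarrow> ('v \<Rightarrow> 'v) set \<Rightarrow> bool" where
  "unital_subalgebra H \<A> \<longleftrightarrow> \<A> \<subseteq> bounded_ops H \<and>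
     (\<lambda>x\<in>vectors H. x) \<in> \<A> \<and>
     (\<forall>S\<in>\<A>. \<forall>T\<in>\<A>. (\<lambda>x\<in>vectors H. hadd H (S x) (T x)) \<in> \<A>) \<and>
     (\<forall>c. \<forall>T\<in>\<A>. (\<lambda>x\<in>vectors H. hscale H c (T x)) \<in> \<A>) \<and>
     (\<forall>S\<in>\<A>. \<forall>T\<in>\<A>. compose (vectors H) S T \<in> \<A>)"

definition transitive_algebra :: "'v hilbert \<Rightarrow> ('v \<Rightarrow> 'v) set \<Rightarrow> bool" where
  "transitive_algebra H \<A> \<longleftrightarrow> unital_subalgebra H \<A> \<and>
     (\<forall>M. closed_subspace H M \<and> (\<forall>T\<in>\<A>. T ` M \<subseteq> M) \<longrightarrow> M = {hzero H} \<or> M = vectors H)"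

definition strongly_dense :: "'v hilbert \<Rightarrow> ('v \<Rightarrow> 'v) set \<Rightarrow> bool" where
  "strongly_dense H \<A> \<longleftrightarrow>
     (\<forall>T\<in>bounded_ops H. \<forall>F. finite F \<and> F \<subseteq> vectors H \<longrightarrow>
        (\<forall>e>0. \<exists>S\<in>\<A>. \<forall>x\<in>F. hdist H (S x) (T x) < e))"

definition catalytic :: "'v hilbert \<Rightarrow> ('v \<Rightarrow> 'v) set \<Rightarrow> bool" where
  "catalytic H \<S> \<longleftrightarrow> \<S> \<subseteq> bounded_ops H \<and>
     (\<forall>\<A>. transitive_algebra H \<A> \<and> \<S> \<subseteq> \<A> \<longrightarrow> strongly_dense H \<A>)"

text \<open>Elements of these spaces are almost-everywhere equivalence classes of measurable functions;
  operations on classes are computed on representatives.\<close>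

definition ae_class :: "'a measure \<Rightarrow> ('a \<Rightarrow> complex) \<Rightarrow> ('a \<Rightarrow> complex) set" where
  "ae_class m f = {g \<in> borel_measurable m. AE x in m. g x = f x}"

definition ae_rep :: "('a \<Rightarrow> complex) set \<Rightarrow> ('a \<Rightarrow> complex)" where
  "ae_rep F = (SOME f. f \<in> F)"

definition ae_lift2 :: "'a measure \<Rightarrow> (complex \<Rightarrow> complex \<Rightarrow> complex) \<Rightarrow>
    ('a \<Rightarrow> complex) set \<Rightarrow> ('a \<Rightarrow> complex) set \<Rightarrow> ('a \<Rightarrow> complex) set" where
  "ae_lift2 m b F G = ae_class m (\<lambda>x. b (ae_rep F x) (ae_rep G x))"

lemma ae_rep_ae_class:
  assumes "f \<in> borel_measurable m"
  shows "ae_rep (ae_class m f) \<in> borel_measurable m"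
    and "AE x in m. ae_rep (ae_class m f) x = f x"
proof -
  have "f \<in> ae_class m f"
    using assms by (simp add: ae_class_def)
  then have "ae_rep (ae_class m f) \<in> ae_class m f"
    unfolding ae_rep_def by (rule someI[of "\<lambda>g. g \<in> ae_class m f"])
  then show "ae_rep (ae_class m f) \<in> borel_measurable m"
    and "AE x in m. ae_rep (ae_class m f) x = f x"
    by (auto simp: ae_class_def)
qed

lemma ae_class_eqI:
  assumes "AE x in m. f x = g x"
  shows "ae_class m f = ae_class m g"
  unfolding ae_class_def using assms by (auto elim: AE_mp)

lemma ae_class_eq_iff:
  assumes "f \<in> borel_measurable m"
  shows "ae_class m f = ae_class m g \<longleftrightarrow> (AE x in m. f x = g x)"
proof
  assume "ae_class m f = ae_class m g"
  moreover have "f \<in> ae_class m f"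
    using assms by (simp add: ae_class_def)
  ultimately show "AE x in m. f x = g x"
    by (simp add: ae_class_def)
qed (rule ae_class_eqI)

lemma ae_lift2_ae_class:
  assumes "f \<in> borel_measurable m" and "g \<in> borel_measurable m"
  shows "ae_lift2 m b (ae_class m f) (ae_class m g) = ae_class m (\<lambda>x. b (f x) (g x))"
  unfolding ae_lift2_def
  using ae_rep_ae_class(2)[OF assms(1)] ae_rep_ae_class(2)[OF assms(2)]
  by (intro ae_class_eqI) (auto elim!: AE_mp)

definition L2 :: "'a measure \<Rightarrow> ('a \<Rightarrow> complex) set hilbert" where
  "L2 m = \<lparr> vectors = ae_class m ` {f \<in> borel_measurable m. integrable m (\<lambda>x. (cmod (f x))\<^sup>2)},
            hzero = ae_class m (\<lambda>x. 0),
            hadd = ae_lift2 m (+),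
            hscale = (\<lambda>c F. ae_class m (\<lambda>x. c * ae_rep F x)),
            hinner = (\<lambda>F G. \<integral>x. ae_rep F x * cnj (ae_rep G x) \<partial>m) \<rparr>"

lemma hscale_L2_ae_class:
  assumes "f \<in> borel_measurable m"
  shows "hscale (L2 m) c (ae_class m f) = ae_class m (\<lambda>x. c * f x)"
  using ae_rep_ae_class(2)[OF assms] unfolding L2_def
  by (auto intro!: ae_class_eqI elim!: AE_mp)

lemma hinner_L2_ae_class:
  assumes "f \<in> borel_measurable m" and "g \<in> borel_measurable m"
  shows "hinner (L2 m) (ae_class m f) (ae_class m g) = (\<integral>x. f x * cnj (g x) \<partial>m)"
proof -
  have cnj: "(\<lambda>x. cnj (u x)) \<in> borel_measurable m" if "u \<in> borel_measurable m" for u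
    using that by (rule borel_measurable_continuous_on[rotated]) (intro continuous_intros)
  have "(\<integral>x. ae_rep (ae_class m f) x * cnj (ae_rep (ae_class m g) x) \<partial>m) = (\<integral>x. f x * cnj (g x) \<partial>m)"
    using assms ae_rep_ae_class[OF assms(1)] ae_rep_ae_class[OF assms(2)]
    by (intro integral_cong_AE borel_measurable_times cnj) (auto elim!: AE_mp)
  then show ?thesis
    by (simp add: L2_def)
qed

definition H2 :: "('a \<Rightarrow> complex) set \<Rightarrow> 'a measure \<Rightarrow> ('a \<Rightarrow> complex) set hilbert" where
  "H2 A m = (L2 m) \<lparr> vectors := hclosure (L2 m) (ae_class m ` A) \<rparr>"

text \<open>The closure of \<open>A\<close> in \<open>L\<^sup>\<infinity>(m)\<close> for the weak-star topology that \<open>L\<^sup>\<infinity>(m)\<close> carries as the dual of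
  \<open>L\<^sup>1(m)\<close>: every basic weak-star neighbourhood of \<open>h\<close> meets \<open>A\<close>.\<close>

definition Hinf :: "('a \<Rightarrow> complex) set \<Rightarrow> 'a measure \<Rightarrow> ('a \<Rightarrow> complex) set set" where
  "Hinf A m = ae_class m ` {h \<in> borel_measurable m. (\<exists>C. AE x in m. cmod (h x) \<le> C) \<and>
     (\<forall>G. finite G \<and> (\<forall>g\<in>G. integrable m g) \<longrightarrow>
        (\<forall>e>0. \<exists>a\<in>A. \<forall>g\<in>G. cmod ((\<integral>x. h x * g x \<partial>m) - (\<integral>x. a x * g x \<partial>m)) < e))}"

definition mult_op :: "('a \<Rightarrow> complex) set \<Rightarrow> 'a measure \<Rightarrow> ('a \<Rightarrow> complex) set \<Rightarrow>
    ('a \<Rightarrow> complex) set \<Rightarrow> ('a \<Rightarrow> complex) set" where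
  "mult_op A m h = (\<lambda>F\<in>vectors (H2 A m). ae_lift2 m (*) h F)"

text \<open>\<open>ev \<psi>\<close> is the bounded extension \<open>f \<mapsto> f(\<psi>)\<close> to \<open>H\<^sup>2(m)\<close> of the functional \<open>\<psi>\<close> on \<open>A\<close>.\<close>

definition H2_reproducing_kernel :: "('a \<Rightarrow> complex) set \<Rightarrow> 'a measure \<Rightarrow> bool" where
  "H2_reproducing_kernel A m \<longleftrightarrow>
     (\<exists>\<Omega> ev. (\<forall>\<psi>\<in>\<Omega>. mult_functional A \<psi>) \<and>
        (\<forall>\<psi>\<in>\<Omega>. bounded_functional (H2 A m) (ev \<psi>) \<and> (\<forall>f\<in>A. ev \<psi> (ae_class m f) = \<psi> f)) \<and>
        (\<forall>F\<in>vectors (H2 A m). (\<forall>\<psi>\<in>\<Omega>. ev \<psi> F = 0) \<longrightarrow> F = hzero (H2 A m)))"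

end

theory Submission
  imports Defs
begin

text \<open>By Arveson's argument a transitive algebra is strongly dense as soon as every closed invariant
  subspace \<open>N\<close> of \<open>H\<^sup>I\<close> (\<open>I\<close> finite) that is a graph over one coordinate \<open>j\<close> is a graph of scalar
  multiples: induction on the support shows that a nonzero closed invariant subspace contains all
  vectors \<open>(d\<^sub>i w)\<^sub>i\<close> for some \<open>d \<noteq> 0\<close>, and these can be split off one coordinate at a time.

  For \<open>H\<^sup>2(m)\<close> take \<open>f, g \<in> N\<close> and a point \<open>\<psi>\<close> of the reproducing kernel structure, approximate
  \<open>f j\<close> and \<open>g j\<close> by \<open>p, q \<in> A\<close>, and consider \<open>k p g - k q f \<in> N\<close>. The hypo-Dirichlet property yields
  invertible \<open>k \<in> A\<close> with modulus comparable to \<open>1 / (1 + |p| + |q|)\<close>; as \<open>\<psi>\<close> is bounded on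
  \<open>H\<^sup>2(m)\<close>, \<open>k\<close> can be normalised by \<open>\<psi> k = 1\<close> with \<open>k p\<close> and \<open>k q\<close> bounded uniformly. These elements
  are bounded, their coordinate \<open>j\<close> tends to \<open>0\<close> and their coordinate \<open>i\<close> has value tending to
  \<open>W = f j(\<psi>) g i(\<psi>) - g j(\<psi>) f i(\<psi>)\<close> at \<open>\<psi>\<close>, so a weak limit in the graph \<open>N\<close> forces \<open>W = 0\<close>. Hence
  \<open>y i - c y j\<close> vanishes at \<open>\<psi>\<close> for all \<open>y \<in> N\<close>, where \<open>c = g i(\<psi>) / g j(\<psi>)\<close>, and transitivity makes it \<open>0\<close>.\<close>

section \<open>Hilbert spaces with a carrier\<close>

text \<open>The natural multipliers for refuting a nonzero \<open>W\<close> would be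
  \<open>f j\<close> and \<open>g j\<close> themselves. They are only square-integrable, and when
  \<open>p\<close> and \<open>q\<close> approach them in H^2 the sup norms of \<open>p\<close> and
  \<open>q\<close> may blow up; then the products need be neither bounded in H^2 nor small in
  coordinate \<open>j\<close>. The factor \<open>k\<close> cures both defects, and for this its
  modulus has to be right only up to a fixed factor. That slack is what makes the finitely many
  extra generators harmless: a real combination of the functions log |f| is in general not the
  log-modulus of an invertible element, an integer combination is, and rounding changes the function
  by a bounded amount.

  The weak limit is realised in norm: almost minimal elements of a decreasing sequence of convex
  sets converge. One point \<psi> at which \<open>g j\<close> does not vanish is enough to find the
  scalar \<open>c\<close>, because elements vanishing at a single point cannot be dense.\<close>

locale hilbert_space =
  fixes H :: "'v hilbert"
  assumes zero_mem [simp, intro]: "hzero H \<in> vectors H"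
    and add_mem [simp, intro]: "x \<in> vectors H \<Longrightarrow> y \<in> vectors H \<Longrightarrow> hadd H x y \<in> vectors H"
    and scale_mem [simp, intro]: "x \<in> vectors H \<Longrightarrow> hscale H c x \<in> vectors H"
    and inner_zero [simp]: "y \<in> vectors H \<Longrightarrow> hinner H (hzero H) y = 0"
    and inner_add [simp]: "x \<in> vectors H \<Longrightarrow> y \<in> vectors H \<Longrightarrow> z \<in> vectors H \<Longrightarrow>
      hinner H (hadd H x y) z = hinner H x z + hinner H y z"
    and inner_scale [simp]: "x \<in> vectors H \<Longrightarrow> y \<in> vectors H \<Longrightarrow>
      hinner H (hscale H c x) y = c * hinner H x y"
    and inner_commute: "x \<in> vectors H \<Longrightarrow> y \<in> vectors H \<Longrightarrow> hinner H x y = cnj (hinner H y x)"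
    and inner_ge_0: "x \<in> vectors H \<Longrightarrow> 0 \<le> Re (hinner H x x)"
    and vec_eqI: "x \<in> vectors H \<Longrightarrow> y \<in> vectors H \<Longrightarrow>
      (\<And>z. z \<in> vectors H \<Longrightarrow> hinner H x z = hinner H y z) \<Longrightarrow> x = y"
    and complete: "(\<And>n. s n \<in> vectors H) \<Longrightarrow>
      (\<And>e. 0 < e \<Longrightarrow> \<exists>N. \<forall>i\<ge>N. \<forall>j\<ge>N. hdist H (s i) (s j) < e) \<Longrightarrow>
      \<exists>l\<in>vectors H. (\<lambda>n::nat. hdist H (s n) l) \<longlonglongrightarrow> 0"
begin

abbreviation V where "V \<equiv> vectors H"

abbreviation diff (infixl "\<ominus>" 65) where "x \<ominus> y \<equiv> hadd H x (hscale H (-1) y)"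

section \<open>Inner product, norm and the Cauchy-Schwarz inequality\<close>

lemma inner_zero_right [simp]: "x \<in> V \<Longrightarrow> hinner H x (hzero H) = 0"
  by (subst inner_commute) auto

lemma inner_add_right [simp]:
  "x \<in> V \<Longrightarrow> y \<in> V \<Longrightarrow> z \<in> V \<Longrightarrow> hinner H z (hadd H x y) = hinner H z x + hinner H z y"
  using inner_commute[of z x] inner_commute[of z y] inner_commute[of z "hadd H x y"] by simp

lemma inner_scale_right [simp]:
  "x \<in> V \<Longrightarrow> y \<in> V \<Longrightarrow> hinner H y (hscale H c x) = cnj c * hinner H y x"
  using inner_commute[of y x] inner_commute[of y "hscale H c x"] by simp

lemma inner_self: "x \<in> V \<Longrightarrow> hinner H x x = of_real ((hnorm H x)\<^sup>2)"
  using inner_ge_0[of x] arg_cong[OF inner_commute[of x x], of Im] by (simp add: hnorm_def complex_eq_iff)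

lemma norm_sq: "x \<in> V \<Longrightarrow> (hnorm H x)\<^sup>2 = Re (hinner H x x)"
  using inner_ge_0[of x] by (simp add: hnorm_def)

lemma norm_ge_0 [simp]: "x \<in> V \<Longrightarrow> 0 \<le> hnorm H x"
  using inner_ge_0[of x] by (simp add: hnorm_def)

lemma norm_scale [simp]: "x \<in> V \<Longrightarrow> hnorm H (hscale H c x) = cmod c * hnorm H x"
proof -
  assume x: "x \<in> V"
  have "hinner H (hscale H c x) (hscale H c x) = (c * cnj c) * hinner H x x"
    using x by simp
  also have "\<dots> = of_real ((cmod c * hnorm H x)\<^sup>2)"
    unfolding complex_norm_square[symmetric] inner_self[OF x] by (simp add: power_mult_distrib)
  finally have "hnorm H (hscale H c x) = sqrt ((cmod c * hnorm H x)\<^sup>2)"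
    unfolding hnorm_def[of H "hscale H c x"] by (simp only: Re_complex_of_real)
  then show ?thesis
    using norm_ge_0[OF x] by simp
qed

text \<open>Taking the coefficient proportional to \<open>hinner H x y\<close> makes the cross term
  real, so that minimising over complex multiples of \<open>y\<close> becomes a question about a
  quadratic polynomial in the real \<open>t\<close>. Both Cauchy-Schwarz and the projection theorem
  use it.\<close>

lemma norm_sub_scaled:
  assumes "x \<in> V" "y \<in> V"
  shows "(hnorm H (x \<ominus> hscale H (of_real t * hinner H x y) y))\<^sup>2
    = (hnorm H x)\<^sup>2 - 2 * t * (cmod (hinner H x y))\<^sup>2
      + t\<^sup>2 * (cmod (hinner H x y))\<^sup>2 * (hnorm H y)\<^sup>2"
proof -
  have c: "hinner H y x = cnj (hinner H x y)"
    using assms inner_commute by blast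
  let ?z = "x \<ominus> hscale H (of_real t * hinner H x y) y" and ?w = "hinner H x y"
  have "hinner H ?z ?z = hinner H x x - 2 * of_real t * (?w * cnj ?w)
      + (of_real t)\<^sup>2 * (?w * cnj ?w) * hinner H y y"
    using assms by (simp add: c algebra_simps power2_eq_square)
  also have "\<dots> = of_real ((hnorm H x)\<^sup>2 - 2 * t * (cmod ?w)\<^sup>2 + t\<^sup>2 * (cmod ?w)\<^sup>2 * (hnorm H y)\<^sup>2)"
    using assms by (simp add: inner_self flip: complex_norm_square)
  finally show ?thesis
    using assms by (simp add: norm_sq)
qed

lemma Cauchy_Schwarz:
  assumes "x \<in> V" "y \<in> V"
  shows "cmod (hinner H x y) \<le> hnorm H x * hnorm H y"
proof -
  define a b d where "a = (hnorm H x)\<^sup>2" and "b = (cmod (hinner H x y))\<^sup>2" and "d = (hnorm H y)\<^sup>2"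
  have pos: "0 \<le> a - 2 * t * b + t\<^sup>2 * b * d" for t
    unfolding a_def b_def d_def norm_sub_scaled[OF assms, symmetric] by simp
  have "b \<le> a * d"
  proof (cases "d = 0")
    case True
    have "b \<le> 0"
    proof (rule ccontr)
      assume "\<not> b \<le> 0"
      \<comment> \<open>For \<open>d = 0\<close> the polynomial is linear in \<open>t\<close>, and
        at this \<open>t\<close> its value is -1.\<close>
      then show False using pos[of "(a + 1) / (2 * b)"] True by (simp add: field_simps)
    qed
    then show ?thesis using True by simp
  next
    case False
    then have "0 < d" by (simp add: d_def)
    then show ?thesis using pos[of "1 / d"] by (simp add: field_simps power2_eq_square)
  qed
  then have "(cmod (hinner H x y))\<^sup>2 \<le> (hnorm H x * hnorm H y)\<^sup>2"
    by (simp add: a_def b_def d_def power_mult_distrib)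
  then show ?thesis
    using assms by (simp add: power2_le_iff_abs_le abs_le_square_iff[symmetric])
qed

lemma norm_zero [simp]: "hnorm H (hzero H) = 0"
  by (simp add: hnorm_def)

text \<open>The locale does not assume definiteness, only that inner products separate vectors
  (\<open>vec_eqI\<close>); by Cauchy-Schwarz a vector of norm 0 has inner product 0 with every
  vector. The vector space laws are likewise no axioms: each identity is obtained by testing it
  against all inner products.\<close>

lemma norm_eq_0D:
  assumes "x \<in> V" "hnorm H x = 0" shows "x = hzero H"
proof (rule vec_eqI)
  fix z assume "z \<in> V"
  then show "hinner H x z = hinner H (hzero H) z"
    using Cauchy_Schwarz[OF assms(1), of z] assms(2) by simp
qed (use assms in auto)

lemma norm_add_le:
  assumes "x \<in> V" "y \<in> V"
  shows "hnorm H (hadd H x y) \<le> hnorm H x + hnorm H y"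
proof -
  have "(hnorm H (hadd H x y))\<^sup>2 = (hnorm H x)\<^sup>2 + (hnorm H y)\<^sup>2 + 2 * Re (hinner H x y)"
    using assms arg_cong[OF inner_commute[of x y], of Re] by (simp add: norm_sq)
  also have "\<dots> \<le> (hnorm H x + hnorm H y)\<^sup>2"
    using Cauchy_Schwarz[OF assms] complex_Re_le_cmod[of "hinner H x y"]
    by (simp add: power2_sum)
  finally show ?thesis
    using assms by (meson norm_ge_0 add_nonneg_nonneg power2_le_imp_le)
qed

lemma parallelogram:
  assumes "x \<in> V" "y \<in> V"
  shows "(hnorm H (x \<ominus> y))\<^sup>2 = 2 * (hnorm H x)\<^sup>2 + 2 * (hnorm H y)\<^sup>2 - 4 * (hnorm H (hscale H (1/2) (hadd H x y)))\<^sup>2"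
  using assms by (simp add: norm_sq field_simps del: norm_scale)

section \<open>The metric\<close>

lemma dist_ge_0 [simp]: "x \<in> V \<Longrightarrow> y \<in> V \<Longrightarrow> 0 \<le> hdist H x y"
  by (simp add: hdist_def)

lemma dist_self [simp]: "x \<in> V \<Longrightarrow> hdist H x x = 0"
  by (simp add: hdist_def hnorm_def)

lemma dist_commute: "x \<in> V \<Longrightarrow> y \<in> V \<Longrightarrow> hdist H x y = hdist H y x"
  by (simp add: hdist_def hnorm_def algebra_simps)

lemma dist_triangle:
  assumes "x \<in> V" "y \<in> V" "z \<in> V"
  shows "hdist H x z \<le> hdist H x y + hdist H y z"
proof -
  have "x \<ominus> z = hadd H (x \<ominus> y) (y \<ominus> z)"
    using assms by (intro vec_eqI) auto
  then show ?thesis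
    using assms norm_add_le[of "x \<ominus> y" "y \<ominus> z"] by (simp add: hdist_def)
qed

lemma dist_eq_0D: "x \<in> V \<Longrightarrow> y \<in> V \<Longrightarrow> hdist H x y = 0 \<Longrightarrow> x = y"
proof (rule vec_eqI)
  fix z assume *: "x \<in> V" "y \<in> V" "z \<in> V" "hdist H x y = 0"
  then have "x \<ominus> y = hzero H"
    by (intro norm_eq_0D) (auto simp: hdist_def)
  then have "hinner H (x \<ominus> y) z = 0"
    using * by simp
  then show "hinner H x z = hinner H y z"
    using * by simp
qed

lemma norm_le_dist:
  assumes "x \<in> V" "y \<in> V"
  shows "hnorm H x \<le> hnorm H y + hdist H x y"
proof -
  have "x = hadd H y (x \<ominus> y)"
    using assms by (intro vec_eqI) auto
  then show ?thesis
    using assms norm_add_le[of y "x \<ominus> y"] by (simp add: hdist_def)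
qed

lemma dist_add:
  assumes "x \<in> V" "y \<in> V" "x' \<in> V" "y' \<in> V"
  shows "hdist H (hadd H x y) (hadd H x' y') \<le> hdist H x x' + hdist H y y'"
proof -
  have "hadd H x y \<ominus> hadd H x' y' = hadd H (x \<ominus> x') (y \<ominus> y')"
    using assms by (intro vec_eqI) (auto simp: algebra_simps)
  then show ?thesis
    using assms norm_add_le[of "x \<ominus> x'" "y \<ominus> y'"] by (simp add: hdist_def)
qed

lemma dist_scale:
  assumes "x \<in> V" "y \<in> V"
  shows "hdist H (hscale H c x) (hscale H c y) = cmod c * hdist H x y"
proof -
  have "hscale H c x \<ominus> hscale H c y = hscale H c (x \<ominus> y)"
    using assms by (intro vec_eqI) (auto simp: algebra_simps)
  then show ?thesis
    using assms by (simp add: hdist_def)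
qed

section \<open>Closures and closed subspaces\<close>

lemma hclosureI: "x \<in> V \<Longrightarrow> (\<And>e. 0 < e \<Longrightarrow> \<exists>s\<in>S. hdist H x s < e) \<Longrightarrow> x \<in> hclosure H S"
  by (simp add: hclosure_def)

lemma hclosureD: "x \<in> hclosure H S \<Longrightarrow> 0 < e \<Longrightarrow> \<exists>s\<in>S. hdist H x s < e"
  by (simp add: hclosure_def)

lemma hclosure_subset_V: "hclosure H S \<subseteq> V"
  by (auto simp: hclosure_def)

lemma subset_hclosure: "S \<subseteq> V \<Longrightarrow> S \<subseteq> hclosure H S"
  by (force simp: hclosure_def)

lemma mem_hclosureI_limit:
  assumes "x \<in> V" "\<And>n::nat. s n \<in> S" "(\<lambda>n. hdist H (s n) x) \<longlonglongrightarrow> 0" "S \<subseteq> V"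
  shows "x \<in> hclosure H S"
proof (rule hclosureI)
  fix e :: real assume "0 < e"
  then obtain n where "norm (hdist H (s n) x - 0) < e"
    using LIMSEQ_D[OF assms(3), of e] by blast
  then have "hdist H (s n) x < e" by simp
  then show "\<exists>s\<in>S. hdist H x s < e"
    using assms by (metis dist_commute subsetD)
qed (fact assms)

lemma hclosure_idem:
  assumes "S \<subseteq> V" shows "hclosure H (hclosure H S) \<subseteq> hclosure H S"
proof
  fix x assume x: "x \<in> hclosure H (hclosure H S)"
  then have xV: "x \<in> V" by (auto simp: hclosure_def)
  show "x \<in> hclosure H S"
  proof (rule hclosureI[OF xV])
    fix e :: real assume e: "0 < e"
    then obtain y where y: "y \<in> hclosure H S" "hdist H x y < e / 2"
      using hclosureD[OF x, of "e/2"] by auto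
    then obtain s where s: "s \<in> S" "hdist H y s < e / 2"
      using hclosureD[OF y(1), of "e/2"] e by auto
    have "hdist H x s \<le> hdist H x y + hdist H y s"
      using xV y s assms hclosure_subset_V[of S] by (intro dist_triangle) auto
    with y s show "\<exists>s\<in>S. hdist H x s < e" by force
  qed
qed

lemma closed_subspace_hclosure:
  assumes S: "S \<subseteq> V" and "hzero H \<in> S"
    and add: "\<And>x y. x \<in> S \<Longrightarrow> y \<in> S \<Longrightarrow> hadd H x y \<in> S"
    and scale: "\<And>c x. x \<in> S \<Longrightarrow> hscale H c x \<in> S"
  shows "closed_subspace H (hclosure H S)"
  unfolding closed_subspace_def
proof (intro conjI ballI allI hclosure_subset_V hclosure_idem[OF S])
  show "hzero H \<in> hclosure H S"
    using subset_hclosure[OF S] assms(2) by auto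
next
  fix x y assume xy: "x \<in> hclosure H S" "y \<in> hclosure H S"
  then have V: "x \<in> V" "y \<in> V" by (auto simp: hclosure_def)
  show "hadd H x y \<in> hclosure H S"
  proof (rule hclosureI)
    fix e :: real assume "0 < e"
    then obtain s t where st: "s \<in> S" "t \<in> S" "hdist H x s < e/2" "hdist H y t < e/2"
      using xy hclosureD[of _ S "e/2"] by (meson half_gt_zero)
    then have "hdist H (hadd H x y) (hadd H s t) < e"
      using dist_add[of x y s t] V S by force
    then show "\<exists>s\<in>S. hdist H (hadd H x y) s < e"
      using add st by blast
  qed (use V in auto)
next
  fix c x assume x: "x \<in> hclosure H S"
  then have V: "x \<in> V" by (auto simp: hclosure_def)
  show "hscale H c x \<in> hclosure H S"
  proof (rule hclosureI)
    fix e :: real assume e: "0 < e"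
    then have "0 < e / (cmod c + 1)"
      by (intro divide_pos_pos) (auto intro: add_nonneg_pos)
    then obtain s where s: "s \<in> S" "hdist H x s < e / (cmod c + 1)"
      using hclosureD[OF x] by blast
    then have "(cmod c + 1) * hdist H x s < e"
      by (subst (asm) pos_less_divide_eq) (auto simp: mult.commute intro: add_nonneg_pos)
    moreover have "0 \<le> hdist H x s"
      using V s S by auto
    ultimately have "cmod c * hdist H x s < e"
      by (simp add: algebra_simps)
    then have "hdist H (hscale H c x) (hscale H c s) < e"
      using V s S by (subst dist_scale) auto
    then show "\<exists>s\<in>S. hdist H (hscale H c x) s < e"
      using scale s by blast
  qed (use V in auto)
qed

lemma closed_subspaceD:
  assumes "closed_subspace H M"
  shows "M \<subseteq> V" "hzero H \<in> M" "\<And>x y. x \<in> M \<Longrightarrow> y \<in> M \<Longrightarrow> hadd H x y \<in> M"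
    "\<And>x c. x \<in> M \<Longrightarrow> hscale H c x \<in> M" "hclosure H M \<subseteq> M"
  using assms by (auto simp: closed_subspace_def)

section \<open>Completeness: closed subspaces, minimisation and projection\<close>

lemma hilbert_space_subspace:
  assumes "closed_subspace H M"
  shows "hilbert_space (H\<lparr>vectors := M\<rparr>)"
proof -
  note M = closed_subspaceD[OF assms]
  have dist: "hdist (H\<lparr>vectors := M\<rparr>) = hdist H"
    by (simp add: hdist_def hnorm_def fun_eq_iff)
  show ?thesis
  proof
    fix x y assume xy: "x \<in> vectors (H\<lparr>vectors := M\<rparr>)" "y \<in> vectors (H\<lparr>vectors := M\<rparr>)"
      and eq: "\<And>z. z \<in> vectors (H\<lparr>vectors := M\<rparr>) \<Longrightarrow>
        hinner (H\<lparr>vectors := M\<rparr>) x z = hinner (H\<lparr>vectors := M\<rparr>) y z"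
    \<comment> \<open>Equality may be tested only against vectors of \<open>M\<close>; the
      difference is one of them and turns out to be orthogonal to itself.\<close>
    have "x \<ominus> y \<in> M" using xy M by auto
    then have "hdist H x y = 0"
      using arg_cong[OF eq[of "x \<ominus> y"], of Re] xy M(1)
      by (auto simp: hdist_def hnorm_def subset_iff)
    then show "x = y"
      using dist_eq_0D xy M(1) by auto
  next
    fix s :: "nat \<Rightarrow> 'v"
    assume s: "\<And>n. s n \<in> vectors (H\<lparr>vectors := M\<rparr>)"
      and C: "\<And>e. 0 < e \<Longrightarrow> \<exists>N. \<forall>i\<ge>N. \<forall>j\<ge>N. hdist (H\<lparr>vectors := M\<rparr>) (s i) (s j) < e"
    obtain l where l: "l \<in> V" "(\<lambda>n. hdist H (s n) l) \<longlonglongrightarrow> 0"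
      using complete[of s] C s M(1) unfolding dist by fastforce
    then have "l \<in> M"
      using mem_hclosureI_limit[OF l(1) _ l(2)] s M by auto
    then show "\<exists>l\<in>vectors (H\<lparr>vectors := M\<rparr>). (\<lambda>n. hdist (H\<lparr>vectors := M\<rparr>) (s n) l) \<longlonglongrightarrow> 0"
      using l by (auto simp: dist)
  next
    show "hinner (H\<lparr>vectors := M\<rparr>) x y = cnj (hinner (H\<lparr>vectors := M\<rparr>) y x)"
      if "x \<in> vectors (H\<lparr>vectors := M\<rparr>)" "y \<in> vectors (H\<lparr>vectors := M\<rparr>)" for x y
      using that M(1) inner_commute[of x y] by auto
  qed (use M inner_ge_0 in \<open>auto simp: subset_iff\<close>)
qed

text \<open>The infima of the squared norms increase with \<open>k\<close> and are bounded by the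
  square of \<open>R\<close>, so they converge, and the parallelogram law makes almost minimal
  elements a Cauchy sequence. The sets need not be closed, which is why the approximating sequence
  \<open>v\<close> is returned along with its limit. A constant sequence of sets gives the
  projection theorem; with shrinking sets the lemma takes the place of weak compactness in
  \<open>graph_evaluation\<close>.\<close>

lemma nested_midconvex_limit:
  fixes C :: "nat \<Rightarrow> 'v set"
  assumes C: "\<And>k. C k \<subseteq> V" and anti: "\<And>k l. k \<le> l \<Longrightarrow> C l \<subseteq> C k"
    and mid: "\<And>k x y. x \<in> C k \<Longrightarrow> y \<in> C k \<Longrightarrow> hscale H (1/2) (hadd H x y) \<in> C k"
    and ne: "\<And>k. \<exists>x\<in>C k. hnorm H x \<le> R"
  shows "\<exists>z\<in>V. \<exists>v. (\<forall>k. v k \<in> C k) \<and> (\<lambda>k. hdist H (v k) z) \<longlonglongrightarrow> 0 \<and>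
    (\<forall>k. \<forall>w\<in>C k. (hnorm H (v k))\<^sup>2 \<le> (hnorm H w)\<^sup>2 + 1 / real (Suc k))"
proof -
  define d where "d k = (INF x\<in>C k. (hnorm H x)\<^sup>2)" for k
  have bdd: "bdd_below ((\<lambda>x. (hnorm H x)\<^sup>2) ` C k)" for k
    by (rule bdd_belowI[of _ 0]) auto
  have d_le: "d k \<le> (hnorm H x)\<^sup>2" if "x \<in> C k" for k x
    unfolding d_def using that bdd by (intro cINF_lower) auto
  have d_bd: "d k \<le> R\<^sup>2" for k
  proof -
    obtain x where "x \<in> C k" "hnorm H x \<le> R" using ne by blast
    then show ?thesis
      using d_le[of x k] subsetD[OF C[of k], of x] power_mono[of "hnorm H x" R 2] norm_ge_0[of x] by linarith
  qed
  have "incseq d"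
  proof (rule incseq_SucI)
    fix n
    show "d n \<le> d (Suc n)"
      unfolding d_def using ne[of "Suc n"] anti[of n "Suc n"] bdd[of n]
      by (intro cINF_superset_mono) auto
  qed
  then have "convergent d"
    using d_bd by (metis incseq_convergent convergentI)
  then have "Cauchy d" by (rule convergent_Cauchy)
  have "\<exists>v. v \<in> C k \<and> (hnorm H v)\<^sup>2 < d k + 1 / real (Suc k)" for k
  proof -
    have "d k < d k + 1 / real (Suc k)" by simp
    then show ?thesis
      using cInf_lessD[of "(\<lambda>x. (hnorm H x)\<^sup>2) ` C k" "d k + 1 / real (Suc k)"] ne[of k]
      unfolding d_def by (auto simp del: of_nat_Suc)
  qed
  then obtain v where v: "\<And>k. v k \<in> C k" "\<And>k. (hnorm H (v k))\<^sup>2 < d k + 1 / real (Suc k)"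
    by metis
  have vV: "v k \<in> V" for k using v C by auto
  \<comment> \<open>The midpoint of \<open>v i\<close> and \<open>v j\<close> lies in
    \<open>C N\<close>, so its squared norm is at least \<open>d N\<close>; the parallelogram law
    then bounds the distance by the excess of the two squared norms over \<open>d N\<close>.\<close>
  have est: "(hdist H (v i) (v j))\<^sup>2 \<le> 2 * \<bar>d i - d N\<bar> + 2 * \<bar>d j - d N\<bar> + 4 * (1 / real (Suc N))"
    if "N \<le> i" "N \<le> j" for i j N
  proof -
    have "hscale H (1/2) (hadd H (v i) (v j)) \<in> C N"
      using mid[OF subsetD[OF anti v(1)] subsetD[OF anti v(1)]] that by simp
    then have m: "d N \<le> (hnorm H (hscale H (1/2) (hadd H (v i) (v j))))\<^sup>2"
      by (rule d_le)
    have vl: "(hnorm H (v l))\<^sup>2 \<le> d N + \<bar>d l - d N\<bar> + 1 / real (Suc N)" if "N \<le> l" for l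
    proof -
      have "1 / real (Suc l) \<le> 1 / real (Suc N)"
        using that by (auto simp: field_simps)
      then show ?thesis using v(2)[of l] by linarith
    qed
    have "2 * a + 2 * b - 4 * c \<le> 2 * s + 2 * t + 4 * r"
      if "d' \<le> c" "a \<le> d' + s + r" "b \<le> d' + t + r" for a b c d' r s t :: real
      using that by linarith
    from this[OF m vl vl] show ?thesis
      using that unfolding hdist_def parallelogram[OF vV vV, of i j] by blast
  qed
  have Cv: "\<exists>N. \<forall>i\<ge>N. \<forall>j\<ge>N. hdist H (v i) (v j) < e" if e: "0 < e" for e
  proof -
    \<comment> \<open>The weights 2, 2 and 4 in \<open>est\<close> add up to 8, so three errors
      below this bound stay below the square of \<open>e\<close>.\<close>
    have e2: "0 < e\<^sup>2 / 12" using e by simp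
    obtain N1 where N1: "\<And>i j. i \<ge> N1 \<Longrightarrow> j \<ge> N1 \<Longrightarrow> \<bar>d i - d j\<bar> < e\<^sup>2 / 12"
      using \<open>Cauchy d\<close> e2 unfolding Cauchy_def dist_real_def by metis
    obtain N2 where N2: "inverse (real (Suc N2)) < e\<^sup>2 / 12"
      using reals_Archimedean[OF e2] by auto
    have "1 / real (Suc (max N1 N2)) \<le> 1 / real (Suc N2)"
      by (intro divide_left_mono) auto
    with N2 have N2: "1 / real (Suc (max N1 N2)) < e\<^sup>2 / 12"
      by (simp add: inverse_eq_divide)
    have "hdist H (v i) (v j) < e" if "max N1 N2 \<le> i" "max N1 N2 \<le> j" for i j
    proof -
      have "\<bar>d i - d (max N1 N2)\<bar> < e\<^sup>2 / 12" "\<bar>d j - d (max N1 N2)\<bar> < e\<^sup>2 / 12"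
        using that by (intro N1; simp)+
      then have "(hdist H (v i) (v j))\<^sup>2 < e\<^sup>2"
        using est[OF that] N2 e2 by linarith
      then show ?thesis using e by (intro power2_less_imp_less[of _ e]) auto
    qed
    then show ?thesis by blast
  qed
  from complete[of v, OF vV Cv] obtain z where "z \<in> V" "(\<lambda>k. hdist H (v k) z) \<longlonglongrightarrow> 0"
    by blast
  moreover have "(hnorm H (v k))\<^sup>2 \<le> (hnorm H w)\<^sup>2 + 1 / real (Suc k)" if "w \<in> C k" for k w
    using v(2)[of k] d_le[OF that] by simp
  ultimately show ?thesis using v(1) by blast
qed

lemma orthogonal_projection:
  assumes M: "closed_subspace H M" and x: "x \<in> V"
  shows "\<exists>y\<in>M. \<forall>w\<in>M. hinner H (x \<ominus> y) w = 0"
proof -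
  note M = closed_subspaceD[OF M]
  define C where "C = (\<lambda>y. x \<ominus> y) ` M"
  have CV: "C \<subseteq> V" using x M(1) by (auto simp: C_def)
  have mid: "hscale H (1/2) (hadd H a b) \<in> C" if "a \<in> C" "b \<in> C" for a b
  proof -
    obtain s where s: "s \<in> M" "a = x \<ominus> s" using \<open>a \<in> C\<close> unfolding C_def by blast
    obtain t where t: "t \<in> M" "b = x \<ominus> t" using \<open>b \<in> C\<close> unfolding C_def by blast
    note st = s t
    have "hscale H (1/2) (hadd H a b) = x \<ominus> hscale H (1/2) (hadd H s t)"
      using st x M(1) by (intro vec_eqI) (auto simp: subset_iff algebra_simps)
    then show ?thesis unfolding C_def using st M(3,4) by blast
  qed
  have ne: "\<exists>w\<in>C. hnorm H w \<le> hnorm H (x \<ominus> hzero H)"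
    unfolding C_def using M(2) by blast
  have "\<exists>z\<in>V. \<exists>v. (\<forall>k. v k \<in> C) \<and> (\<lambda>k. hdist H (v k) z) \<longlonglongrightarrow> 0 \<and>
      (\<forall>k. \<forall>w\<in>C. (hnorm H (v k))\<^sup>2 \<le> (hnorm H w)\<^sup>2 + 1 / real (Suc k))"
    by (rule nested_midconvex_limit[of "\<lambda>_. C", OF CV subset_refl mid ne])
  then obtain z v where z: "z \<in> V" and v: "\<And>k. v k \<in> C" "(\<lambda>k. hdist H (v k) z) \<longlonglongrightarrow> 0"
    and min: "\<And>k w. w \<in> C \<Longrightarrow> (hnorm H (v k))\<^sup>2 \<le> (hnorm H w)\<^sup>2 + 1 / real (Suc k)"
    by blast
  define y where "y = x \<ominus> z"
  have yV: "y \<in> V" using x z by (simp add: y_def)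
  have xy: "z = x \<ominus> y" using x z by (intro vec_eqI) (auto simp: y_def)
  have "y \<in> hclosure H M"
  proof (rule hclosureI[OF yV])
    fix e :: real assume "0 < e"
    then obtain k where "norm (hdist H (v k) z - 0) < e"
      using LIMSEQ_D[OF v(2), of e] by blast
    then have k: "hdist H (v k) z < e" by simp
    obtain s where s: "s \<in> M" "v k = x \<ominus> s" using v(1)[of k] by (auto simp: C_def)
    have sV: "s \<in> V" using s M(1) by auto
    have "y \<ominus> s = v k \<ominus> z"
      using s(2) x z sV yV by (intro vec_eqI) (auto simp: y_def)
    with k have "hdist H y s < e" by (simp add: hdist_def)
    with s show "\<exists>s\<in>M. hdist H y s < e" by blast
  qed
  then have yM: "y \<in> M" using M(5) by auto
  have zC: "z \<in> C" using yM xy by (auto simp: C_def)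
  have le: "(hnorm H z)\<^sup>2 \<le> (hnorm H w)\<^sup>2" if w: "w \<in> C" for w
  proof (rule LIMSEQ_le)
    have "hnorm H (v k) \<le> hnorm H z + hdist H (v k) z" "hnorm H z \<le> hnorm H (v k) + hdist H (v k) z" for k
      using norm_le_dist[of "v k" z] norm_le_dist[of z "v k"] dist_commute[of "v k" z] v(1)[of k] z CV
      by auto
    then have "(\<lambda>k. hnorm H (v k)) \<longlonglongrightarrow> hnorm H z"
      by (intro LIM_zero_cancel[OF Lim_null_comparison[OF _ v(2)]]) (auto simp: abs_le_iff algebra_simps)
    then show "(\<lambda>k. (hnorm H (v k))\<^sup>2) \<longlonglongrightarrow> (hnorm H z)\<^sup>2"
      by (intro tendsto_intros)
    show "(\<lambda>k. (hnorm H w)\<^sup>2 + 1 / real (Suc k)) \<longlonglongrightarrow> (hnorm H w)\<^sup>2"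
      using LIMSEQ_inverse_real_of_nat_add[of "(hnorm H w)\<^sup>2"]
      by (simp only: inverse_eq_divide)
  qed (use min[OF w] in auto)
  have "hinner H z w = 0" if w: "w \<in> M" for w
  proof -
    have wV: "w \<in> V" using w M(1) by auto
    define b d where "b = (cmod (hinner H z w))\<^sup>2" and "d = (hnorm H w)\<^sup>2"
    have *: "0 \<le> - 2 * t * b + t\<^sup>2 * b * d" for t
    proof -
      have "z \<ominus> hscale H (of_real t * hinner H z w) w = x \<ominus> hadd H y (hscale H (of_real t * hinner H z w) w)"
        using x z wV by (intro vec_eqI) (auto simp: y_def algebra_simps)
      moreover have "hadd H y (hscale H (of_real t * hinner H z w) w) \<in> M"
        using yM w M(3,4) by blast
      ultimately have "z \<ominus> hscale H (of_real t * hinner H z w) w \<in> C"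
        by (auto simp: C_def)
      from le[OF this] show ?thesis
        unfolding norm_sub_scaled[OF z wV] b_def d_def by simp
    qed
    have "d \<ge> 0" by (simp add: d_def)
    \<comment> \<open>The summand 1 guards against \<open>d = 0\<close>. With this choice
      \<open>t * d = 1 - t\<close>, and the polynomial becomes \<open>- (t + t * t) * b\<close>,
      which can be nonnegative only for \<open>b = 0\<close>.\<close>
    define t where "t = 1 / (d + 1)"
    have t: "0 < t" "t * d = 1 - t"
      using \<open>d \<ge> 0\<close> by (auto simp: t_def field_simps)
    have "- 2 * t * b + t\<^sup>2 * b * d = - 2 * t * b + t * b * (t * d)"
      by (simp add: power2_eq_square)
    also have "\<dots> = - (t + t * t) * b"
      unfolding t(2) by (simp add: algebra_simps)
    finally have "(t + t * t) * b \<le> 0"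
      using *[of t] by (simp add: algebra_simps)
    moreover have "0 < t + t * t"
      using t(1) by (simp add: add_pos_pos)
    ultimately have "b \<le> 0"
      by (simp add: mult_le_0_iff)
    then show ?thesis by (simp add: b_def)
  qed
  then show ?thesis using yM by (intro bexI[of _ y]) (simp_all flip: xy)
qed

end

section \<open>Transitive algebras and graph transformations\<close>

text \<open>The orthogonal sum of copies of \<open>H\<close> indexed by \<open>I\<close>. Tuples are
  extensional, so that a tuple is determined by its coordinates in \<open>I\<close> and
  \<open>vec_eqI\<close> can hold as an equality in HOL.\<close>

definition hpow :: "'i set \<Rightarrow> 'v hilbert \<Rightarrow> ('i \<Rightarrow> 'v) hilbert" where
  "hpow I H = \<lparr> vectors = I \<rightarrow>\<^sub>E vectors H,
            hzero = (\<lambda>i\<in>I. hzero H),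
            hadd = (\<lambda>x y. \<lambda>i\<in>I. hadd H (x i) (y i)),
            hscale = (\<lambda>c x. \<lambda>i\<in>I. hscale H c (x i)),
            hinner = (\<lambda>x y. \<Sum>i\<in>I. hinner H (x i) (y i)) \<rparr>"

lemma hpow_simps [simp]:
  "vectors (hpow I H) = I \<rightarrow>\<^sub>E vectors H"
  "hzero (hpow I H) = (\<lambda>i\<in>I. hzero H)"
  "hadd (hpow I H) x y = (\<lambda>i\<in>I. hadd H (x i) (y i))"
  "hscale (hpow I H) c x = (\<lambda>i\<in>I. hscale H c (x i))"
  "hinner (hpow I H) x y = (\<Sum>i\<in>I. hinner H (x i) (y i))"
  by (simp_all add: hpow_def)

definition invariant_subspace_pow :: "'i set \<Rightarrow> 'v hilbert \<Rightarrow> ('v \<Rightarrow> 'v) set \<Rightarrow> ('i \<Rightarrow> 'v) set \<Rightarrow> bool" where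
  "invariant_subspace_pow I H \<A> M \<longleftrightarrow> closed_subspace (hpow I H) M \<and>
     (\<forall>T\<in>\<A>. \<forall>y\<in>M. (\<lambda>i\<in>I. T (y i)) \<in> M)"

text \<open>An invariant subspace on which \<open>y j\<close> determines \<open>y\<close> is the graph of a tuple of transformations
  commuting with the algebra.\<close>

definition graph_transformations_scalar :: "'i set \<Rightarrow> 'v hilbert \<Rightarrow> ('v \<Rightarrow> 'v) set \<Rightarrow> bool" where
  "graph_transformations_scalar I H \<A> \<longleftrightarrow>
     (\<forall>M. \<forall>j\<in>I. invariant_subspace_pow I H \<A> M \<and> (\<forall>y\<in>M. y j = hzero H \<longrightarrow> y = hzero (hpow I H)) \<longrightarrow>
       (\<forall>i\<in>I. \<exists>c. \<forall>y\<in>M. y i = hscale H c (y j)))"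

context hilbert_space
begin

section \<open>Vector arithmetic and bounded operators\<close>

lemma scale_zero [simp]: "hscale H c (hzero H) = hzero H"
  by (intro vec_eqI) auto

lemma scale_one [simp]: "x \<in> V \<Longrightarrow> hscale H 1 x = x"
  by (intro vec_eqI) auto

lemma zero_scale [simp]: "x \<in> V \<Longrightarrow> hscale H 0 x = hzero H"
  by (intro vec_eqI) auto

lemma add_zero [simp]: "x \<in> V \<Longrightarrow> hadd H x (hzero H) = x" "x \<in> V \<Longrightarrow> hadd H (hzero H) x = x"
  by (intro vec_eqI; auto)+

lemma dist_zero [simp]: "x \<in> V \<Longrightarrow> hdist H x (hzero H) = hnorm H x"
  by (simp add: hdist_def)

lemma scale_add_right: "x \<in> V \<Longrightarrow> y \<in> V \<Longrightarrow> hscale H c (hadd H x y) = hadd H (hscale H c x) (hscale H c y)"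
  by (intro vec_eqI) (auto simp: algebra_simps)

lemma scale_scale: "x \<in> V \<Longrightarrow> hscale H c (hscale H d x) = hscale H (c * d) x"
  by (intro vec_eqI) auto

lemma bounded_opsD:
  assumes "T \<in> bounded_ops H"
  shows "x \<in> V \<Longrightarrow> T x \<in> V"
    and "x \<in> V \<Longrightarrow> y \<in> V \<Longrightarrow> T (hadd H x y) = hadd H (T x) (T y)"
    and "x \<in> V \<Longrightarrow> T (hscale H c x) = hscale H c (T x)"
    and "T (hzero H) = hzero H"
proof -
  show *: "x \<in> V \<Longrightarrow> T x \<in> V" for x
    using assms by (auto simp: bounded_ops_def)
  show "x \<in> V \<Longrightarrow> y \<in> V \<Longrightarrow> T (hadd H x y) = hadd H (T x) (T y)"
    using assms by (auto simp: bounded_ops_def)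
  show **: "x \<in> V \<Longrightarrow> T (hscale H c x) = hscale H c (T x)" for c x
    using assms by (auto simp: bounded_ops_def)
  show "T (hzero H) = hzero H"
    using **[of "hzero H" 0] *[of "hzero H"] by simp
qed

lemma bounded_ops_dist:
  assumes "T \<in> bounded_ops H"
  shows "\<exists>C>0. \<forall>x\<in>V. \<forall>y\<in>V. hdist H (T x) (T y) \<le> C * hdist H x y"
proof -
  obtain C where C: "\<And>x. x \<in> V \<Longrightarrow> hnorm H (T x) \<le> C * hnorm H x"
    using assms unfolding bounded_ops_def by blast
  have "hdist H (T x) (T y) \<le> (\<bar>C\<bar> + 1) * hdist H x y" if "x \<in> V" "y \<in> V" for x y
  proof -
    have "T x \<ominus> T y = T (x \<ominus> y)"
      using that by (simp add: bounded_opsD[OF assms])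
    then have "hdist H (T x) (T y) \<le> C * hdist H x y"
      using C[of "x \<ominus> y"] that by (simp add: hdist_def)
    also have "\<dots> \<le> (\<bar>C\<bar> + 1) * hdist H x y"
      using that by (intro mult_right_mono) auto
    finally show ?thesis .
  qed
  then show ?thesis by (intro exI[of _ "\<bar>C\<bar> + 1"]) auto
qed

lemma hclosure_invariant:
  assumes "T \<in> bounded_ops H" "S \<subseteq> V" "T ` S \<subseteq> S"
  shows "T ` hclosure H S \<subseteq> hclosure H S"
proof safe
  fix x assume x: "x \<in> hclosure H S"
  then have xV: "x \<in> V" by (simp add: hclosure_def)
  obtain C where C: "0 < C" "\<And>x y. x \<in> V \<Longrightarrow> y \<in> V \<Longrightarrow> hdist H (T x) (T y) \<le> C * hdist H x y"
    using bounded_ops_dist[OF assms(1)] by blast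
  show "T x \<in> hclosure H S"
  proof (rule hclosureI)
    fix e :: real assume "0 < e"
    then obtain s where s: "s \<in> S" "hdist H x s < e / C"
      using hclosureD[OF x, of "e / C"] C(1) by auto
    then have "C * hdist H x s < e"
      using C(1) by (simp add: field_simps)
    moreover have "hdist H (T x) (T s) \<le> C * hdist H x s"
      using C(2) xV s assms(2) by blast
    ultimately show "\<exists>s\<in>S. hdist H (T x) s < e"
      using s assms(3) by (intro bexI[of _ "T s"]) auto
  qed (use bounded_opsD(1)[OF assms(1)] xV in auto)
qed

section \<open>Finite powers as Hilbert spaces\<close>

lemma hnorm_hpow: "x \<in> I \<rightarrow>\<^sub>E V \<Longrightarrow> hnorm (hpow I H) x = sqrt (\<Sum>i\<in>I. (hnorm H (x i))\<^sup>2)"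
  by (auto simp: hnorm_def[of "hpow I H"] norm_sq dest: PiE_mem intro!: sum.cong)

lemma hdist_hpow:
  assumes "x \<in> I \<rightarrow>\<^sub>E V" "y \<in> I \<rightarrow>\<^sub>E V"
  shows "hdist (hpow I H) x y = sqrt (\<Sum>i\<in>I. (hdist H (x i) (y i))\<^sup>2)"
proof -
  have "x i \<ominus> y i \<in> V" if "i \<in> I" for i
    using PiE_mem[OF assms(1) that] PiE_mem[OF assms(2) that] by auto
  then have "(\<lambda>i\<in>I. x i \<ominus> y i) \<in> I \<rightarrow>\<^sub>E V"
    by auto
  moreover have "hadd (hpow I H) x (hscale (hpow I H) (- 1) y) = (\<lambda>i\<in>I. x i \<ominus> y i)"
    by auto
  ultimately show ?thesis
    unfolding hdist_def by (simp add: hnorm_hpow)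
qed

lemma hdist_coord_le:
  assumes "finite I" "x \<in> I \<rightarrow>\<^sub>E V" "y \<in> I \<rightarrow>\<^sub>E V" "i \<in> I"
  shows "hdist H (x i) (y i) \<le> hdist (hpow I H) x y"
  unfolding hdist_hpow[OF assms(2,3)]
  using assms member_le_sum[of i I "\<lambda>i. (hdist H (x i) (y i))\<^sup>2"] by (intro real_le_rsqrt) auto

lemma hilbert_space_hpow:
  fixes I :: "'i set"
  assumes I: "finite I"
  shows "hilbert_space (hpow I H)"
proof
  fix x y :: "'i \<Rightarrow> 'v"
  assume xy: "x \<in> vectors (hpow I H)" "y \<in> vectors (hpow I H)"
  show "hinner (hpow I H) x y = cnj (hinner (hpow I H) y x)"
    using xy by (auto intro!: sum.cong inner_commute)
  assume eq: "\<And>z. z \<in> vectors (hpow I H) \<Longrightarrow> hinner (hpow I H) x z = hinner (hpow I H) y z"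
  show "x = y"
  proof (rule PiE_ext)
    fix i assume i: "i \<in> I"
    show "x i = y i"
    proof (rule vec_eqI)
      fix z assume z: "z \<in> V"
      define e where "e = (\<lambda>k\<in>I. if k = i then z else hzero H)"
      have "(\<Sum>k\<in>I. hinner H (u k) (e k)) = hinner H (u i) z" if "u \<in> I \<rightarrow>\<^sub>E V" for u
      proof -
        have "(\<Sum>k\<in>I. hinner H (u k) (e k)) = (\<Sum>k\<in>I. if k = i then hinner H (u k) z else 0)"
          using that by (intro sum.cong) (auto simp: e_def dest: PiE_mem)
        then show ?thesis using I i by simp
      qed
      then show "hinner H (x i) z = hinner H (y i) z"
        using eq[of e] xy z by (auto simp: e_def)
    qed (use xy i in auto)
  qed (use xy in auto)
next
  fix x :: "'i \<Rightarrow> 'v" assume "x \<in> vectors (hpow I H)"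
  then show "0 \<le> Re (hinner (hpow I H) x x)"
    by (auto intro!: sum_nonneg inner_ge_0)
next
  fix s :: "nat \<Rightarrow> 'i \<Rightarrow> 'v"
  assume "\<And>n. s n \<in> vectors (hpow I H)"
    and C: "\<And>e. 0 < e \<Longrightarrow> \<exists>N. \<forall>i\<ge>N. \<forall>j\<ge>N. hdist (hpow I H) (s i) (s j) < e"
  then have s: "\<And>n. s n \<in> I \<rightarrow>\<^sub>E V" by simp
  have "\<exists>l\<in>V. (\<lambda>n. hdist H (s n i) l) \<longlonglongrightarrow> 0" if i: "i \<in> I" for i
  proof (rule complete)
    show "s n i \<in> V" for n using s i by (rule PiE_mem)
    fix e :: real assume "0 < e"
    then obtain N where "\<forall>n\<ge>N. \<forall>k\<ge>N. hdist (hpow I H) (s n) (s k) < e"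
      using C by blast
    then show "\<exists>N. \<forall>n\<ge>N. \<forall>k\<ge>N. hdist H (s n i) (s k i) < e"
      using hdist_coord_le[OF I s s i] by (meson le_less_trans)
  qed
  then obtain l where l: "\<And>i. i \<in> I \<Longrightarrow> l i \<in> V" "\<And>i. i \<in> I \<Longrightarrow> (\<lambda>n. hdist H (s n i) (l i)) \<longlonglongrightarrow> 0"
    by metis
  have lV: "restrict l I \<in> I \<rightarrow>\<^sub>E V" using l(1) by auto
  have "(\<lambda>n. sqrt (\<Sum>i\<in>I. (hdist H (s n i) (l i))\<^sup>2)) \<longlonglongrightarrow> sqrt (\<Sum>i\<in>I. 0\<^sup>2)"
    by (intro tendsto_intros l(2))
  then have "(\<lambda>n. hdist (hpow I H) (s n) (restrict l I)) \<longlonglongrightarrow> 0"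
    unfolding hdist_hpow[OF s lV] by simp
  then show "\<exists>l\<in>vectors (hpow I H). (\<lambda>n. hdist (hpow I H) (s n) l) \<longlonglongrightarrow> 0"
    using lV by (intro bexI[of _ "restrict l I"]) simp_all
next
  fix x y z :: "'i \<Rightarrow> 'v" and c
  assume "x \<in> vectors (hpow I H)" "y \<in> vectors (hpow I H)" "z \<in> vectors (hpow I H)"
  then have V: "x i \<in> V" "y i \<in> V" "z i \<in> V" if "i \<in> I" for i
    using that by auto
  show "hinner (hpow I H) (hadd (hpow I H) x y) z = hinner (hpow I H) x z + hinner (hpow I H) y z"
    using V by (simp flip: sum.distrib)
next
  fix x y :: "'i \<Rightarrow> 'v" and c
  assume "x \<in> vectors (hpow I H)" "y \<in> vectors (hpow I H)"
  then have V: "x i \<in> V" "y i \<in> V" if "i \<in> I" for i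
    using that by auto
  show "hinner (hpow I H) (hscale (hpow I H) c x) y = c * hinner (hpow I H) x y"
    using V by (simp add: sum_distrib_left)
  show "hinner (hpow I H) (hzero (hpow I H)) y = 0"
    using V by simp
qed auto

section \<open>Invariant subspaces of finite powers under a transitive algebra\<close>

lemma invariant_subspace_powD:
  assumes "invariant_subspace_pow I H \<A> M"
  shows "closed_subspace (hpow I H) M" "M \<subseteq> I \<rightarrow>\<^sub>E V" "(\<lambda>i\<in>I. hzero H) \<in> M"
    "\<And>x y. x \<in> M \<Longrightarrow> y \<in> M \<Longrightarrow> (\<lambda>i\<in>I. hadd H (x i) (y i)) \<in> M"
    "\<And>x c. x \<in> M \<Longrightarrow> (\<lambda>i\<in>I. hscale H c (x i)) \<in> M"
    "\<And>T x. T \<in> \<A> \<Longrightarrow> x \<in> M \<Longrightarrow> (\<lambda>i\<in>I. T (x i)) \<in> M"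
  using assms by (auto simp: invariant_subspace_pow_def closed_subspace_def)

text \<open>A coordinate is continuous and operators map zero to zero, so the vanishing of a
  coordinate is a closed and invariant condition. Passing to this kernel is what lowers the support
  in the two inductions below.\<close>

lemma invariant_subspace_pow_kernel:
  assumes I: "finite I" and j: "j \<in> I" and A: "\<A> \<subseteq> bounded_ops H"
    and M: "invariant_subspace_pow I H \<A> M"
  shows "invariant_subspace_pow I H \<A> {y\<in>M. y j = hzero H}"
proof -
  note M = invariant_subspace_powD[OF M]
  have "hclosure (hpow I H) {y\<in>M. y j = hzero H} \<subseteq> {y\<in>M. y j = hzero H}"
  proof safe
    fix x assume x: "x \<in> hclosure (hpow I H) {y\<in>M. y j = hzero H}"
    then have "x \<in> hclosure (hpow I H) M"
      by (fastforce simp: hclosure_def)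
    then show xM: "x \<in> M" using M(1) by (auto simp: closed_subspace_def)
    then have xV: "x \<in> I \<rightarrow>\<^sub>E V" using M(2) by auto
    then have xj: "x j \<in> V" using j by auto
    have "hnorm H (x j) < e" if "0 < e" for e
    proof -
      obtain y where y: "y \<in> M" "y j = hzero H" "hdist (hpow I H) x y < e"
        using x \<open>0 < e\<close> by (auto simp: hclosure_def)
      then show ?thesis
        using hdist_coord_le[OF I xV _ j, of y] M(2) xj by force
    qed
    then have "hnorm H (x j) = 0"
      using norm_ge_0[OF xj] by (meson less_irrefl linorder_neqE_linordered_idom not_le)
    then show "x j = hzero H" by (rule norm_eq_0D[OF xj])
  qed
  moreover have "(\<lambda>i\<in>I. T (y i)) \<in> M \<and> T (y j) = hzero H"
    if "T \<in> \<A>" "y \<in> M" "y j = hzero H" for T y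
    using M(6)[OF that(1,2)] bounded_opsD(4)[of T] A that(1,3) by auto
  ultimately show ?thesis
    unfolding invariant_subspace_pow_def closed_subspace_def hpow_simps
    using M(2-5) j by (intro conjI ballI allI) auto
qed

lemma transitive_algebraD:
  assumes "transitive_algebra H \<A>"
  shows "\<A> \<subseteq> bounded_ops H"
    and "closed_subspace H M \<Longrightarrow> (\<And>T. T \<in> \<A> \<Longrightarrow> T ` M \<subseteq> M) \<Longrightarrow> x \<in> M \<Longrightarrow> x \<noteq> hzero H \<Longrightarrow> M = V"
proof -
  show "\<A> \<subseteq> bounded_ops H"
    using assms by (simp add: transitive_algebra_def unital_subalgebra_def)
  show "closed_subspace H M \<Longrightarrow> (\<And>T. T \<in> \<A> \<Longrightarrow> T ` M \<subseteq> M) \<Longrightarrow> x \<in> M \<Longrightarrow> x \<noteq> hzero H \<Longrightarrow> M = V"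
    using assms unfolding transitive_algebra_def by blast
qed

text \<open>This is the preimage of \<open>M\<close> under the bounded linear map that sends
  \<open>w\<close> to the tuple of its multiples by \<open>d i\<close>.\<close>

lemma closed_subspace_diagonal:
  assumes I: "finite I" and M: "closed_subspace (hpow I H) M"
  shows "closed_subspace H {w \<in> V. (\<lambda>i\<in>I. hscale H (d i) w) \<in> M}" (is "closed_subspace H ?D")
proof -
  interpret P: hilbert_space "hpow I H" by (rule hilbert_space_hpow[OF I])
  note M = P.closed_subspaceD[OF M, simplified]
  have tup: "(\<lambda>i\<in>I. hscale H (d i) w) \<in> I \<rightarrow>\<^sub>E V" if "w \<in> V" for w
    using that by auto
  have "hclosure H ?D \<subseteq> ?D"
  proof safe
    fix w assume w: "w \<in> hclosure H ?D"
    then show wV: "w \<in> V" by (simp add: hclosure_def)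
    define C where "C = sqrt (\<Sum>i\<in>I. (cmod (d i))\<^sup>2) + 1"
    have C: "0 < C" by (auto simp: C_def intro!: add_nonneg_pos sum_nonneg)
    have dist: "hdist (hpow I H) (\<lambda>i\<in>I. hscale H (d i) w) (\<lambda>i\<in>I. hscale H (d i) u) \<le> C * hdist H w u"
      if u: "u \<in> V" for u
    proof -
      have "hdist (hpow I H) (\<lambda>i\<in>I. hscale H (d i) w) (\<lambda>i\<in>I. hscale H (d i) u)
          = sqrt (\<Sum>i\<in>I. (cmod (d i))\<^sup>2 * (hdist H w u)\<^sup>2)"
        unfolding hdist_hpow[OF tup[OF wV] tup[OF u]]
        using wV u by (auto simp: dist_scale power_mult_distrib intro!: sum.cong)
      also have "\<dots> = sqrt (\<Sum>i\<in>I. (cmod (d i))\<^sup>2) * hdist H w u"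
        using wV u by (simp add: sum_distrib_right[symmetric] real_sqrt_mult)
      also have "\<dots> \<le> C * hdist H w u"
        using wV u by (intro mult_right_mono) (auto simp: C_def)
      finally show ?thesis .
    qed
    have "(\<lambda>i\<in>I. hscale H (d i) w) \<in> hclosure (hpow I H) M"
    proof (rule P.hclosureI)
      fix e :: real assume "0 < e"
      then obtain u where u: "u \<in> ?D" "hdist H w u < e / C"
        using hclosureD[OF w, of "e / C"] C by auto
      then have "C * hdist H w u < e"
        using C by (simp add: field_simps)
      then have "hdist (hpow I H) (\<lambda>i\<in>I. hscale H (d i) w) (\<lambda>i\<in>I. hscale H (d i) u) < e"
        using dist[of u] u(1) by auto
      then show "\<exists>s\<in>M. hdist (hpow I H) (\<lambda>i\<in>I. hscale H (d i) w) s < e"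
        using u(1) by blast
    qed (use tup[OF wV] in simp)
    then show "(\<lambda>i\<in>I. hscale H (d i) w) \<in> M" using M(5) by auto
  qed
  moreover have "(\<lambda>i\<in>I. hscale H (d i) (hadd H x y)) \<in> M"
    if "(\<lambda>i\<in>I. hscale H (d i) x) \<in> M" "(\<lambda>i\<in>I. hscale H (d i) y) \<in> M" "x \<in> V" "y \<in> V" for x y
  proof -
    have "(\<lambda>i\<in>I. hscale H (d i) (hadd H x y))
        = (\<lambda>i\<in>I. hadd H ((\<lambda>i\<in>I. hscale H (d i) x) i) ((\<lambda>i\<in>I. hscale H (d i) y) i))"
      using that by (auto simp: scale_add_right)
    then show ?thesis using M(3)[OF that(1,2)] by simp
  qed
  moreover have "(\<lambda>i\<in>I. hscale H (d i) (hscale H c x)) \<in> M"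
    if "(\<lambda>i\<in>I. hscale H (d i) x) \<in> M" "x \<in> V" for c x
  proof -
    have "(\<lambda>i\<in>I. hscale H (d i) (hscale H c x)) = (\<lambda>i\<in>I. hscale H c ((\<lambda>i\<in>I. hscale H (d i) x) i))"
      using that by (auto simp: scale_scale mult.commute)
    then show ?thesis using M(4)[OF that(1)] by simp
  qed
  moreover have "(\<lambda>i\<in>I. hscale H (d i) (hzero H)) \<in> M"
    using M(2) by simp
  ultimately show ?thesis
    unfolding closed_subspace_def by auto
qed

text \<open>\<open>J\<close> bounds the support of the elements of \<open>M\<close>. When
  \<open>j\<close> is added, either some nonzero element of \<open>M\<close> vanishes in coordinate
  \<open>j\<close> and the kernel falls under the induction hypothesis, or \<open>y j\<close>
  determines \<open>y\<close>; in the second case the graph hypothesis supplies the scalars, and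
  transitivity replaces \<open>y j\<close> by an arbitrary vector.\<close>

lemma invariant_contains_diagonal:
  assumes I: "finite I" and trans: "transitive_algebra H \<A>"
    and scal: "graph_transformations_scalar I H \<A>"
    and "finite J" "J \<subseteq> I" and "invariant_subspace_pow I H \<A> M"
    and "\<And>y i. y \<in> M \<Longrightarrow> i \<in> I - J \<Longrightarrow> y i = hzero H"
    and "M \<noteq> {\<lambda>i\<in>I. hzero H}"
  shows "\<exists>d. \<exists>j\<in>J. d j = 1 \<and> (\<forall>w\<in>V. (\<lambda>i\<in>I. hscale H (d i) w) \<in> M)"
  using assms(4-)
proof (induction J arbitrary: M rule: finite_induct)
  case empty
  note M = invariant_subspace_powD[OF empty(2)]
  have "y = (\<lambda>i\<in>I. hzero H)" if "y \<in> M" for y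
    using M(2) that empty(3)[OF that] by (auto intro!: PiE_ext[of y I "\<lambda>_. V"])
  then show ?case using empty(4) M(3) by blast
next
  case (insert j J)
  then have j: "j \<in> I" and J: "J \<subseteq> I" by auto
  note M = invariant_subspace_powD[OF insert(5)]
  note A = transitive_algebraD[OF trans]
  let ?M' = "{y\<in>M. y j = hzero H}"
  have M': "invariant_subspace_pow I H \<A> ?M'"
    by (rule invariant_subspace_pow_kernel[OF I j A(1) insert(5)])
  show ?case
  proof (cases "?M' = {\<lambda>i\<in>I. hzero H}")
    case False
    have "\<exists>d. \<exists>j\<in>J. d j = 1 \<and> (\<forall>w\<in>V. (\<lambda>i\<in>I. hscale H (d i) w) \<in> ?M')"
      by (rule insert.IH[OF J M' _ False]) (use insert(6) in auto)
    then show ?thesis by blast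
  next
    case True
    then have "\<forall>y\<in>M. y j = hzero H \<longrightarrow> y = hzero (hpow I H)"
      by auto
    then have "\<forall>i\<in>I. \<exists>c. \<forall>y\<in>M. y i = hscale H c (y j)"
      using scal j insert(5) unfolding graph_transformations_scalar_def by blast
    then obtain c where c: "\<And>i y. i \<in> I \<Longrightarrow> y \<in> M \<Longrightarrow> y i = hscale H (c i) (y j)"
      by metis
    \<comment> \<open>Overwriting the coefficient at \<open>j\<close> by 1 makes \<open>d\<close>
      nonzero and is what later allows a coordinate to be cancelled exactly.\<close>
    define d where "d = c(j := 1)"
    have d: "y = (\<lambda>i\<in>I. hscale H (d i) (y j))" if "y \<in> M" for y
    proof (rule PiE_ext[of y I "\<lambda>_. V"])
      show yV: "y \<in> I \<rightarrow>\<^sub>E V" using M(2) that by auto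
      then have yj: "y j \<in> V" using j by auto
      then show "(\<lambda>i\<in>I. hscale H (d i) (y j)) \<in> I \<rightarrow>\<^sub>E V" by auto
      fix i assume "i \<in> I"
      then show "y i = (\<lambda>i\<in>I. hscale H (d i) (y j)) i"
        using c[OF _ that, of i] yj by (cases "i = j") (simp_all add: d_def)
    qed
    let ?D = "{w \<in> V. (\<lambda>i\<in>I. hscale H (d i) w) \<in> M}"
    obtain y where y: "y \<in> M" "y \<noteq> (\<lambda>i\<in>I. hzero H)"
      using insert(7) M(3) by blast
    \<comment> \<open>Transitivity concerns subspaces of \<open>H\<close> only, so it is applied to
      the preimage of \<open>M\<close> under the diagonal map, which contains the nonzero vector
      \<open>y j\<close>.\<close>
    have "?D = V"
    proof (rule A(2)[OF closed_subspace_diagonal[OF I M(1)]])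
      fix T assume T: "T \<in> \<A>"
      then have Tb: "T \<in> bounded_ops H" using A(1) by auto
      show "T ` ?D \<subseteq> ?D"
      proof safe
        fix w assume w: "w \<in> V" "(\<lambda>i\<in>I. hscale H (d i) w) \<in> M"
        then show "T w \<in> V" using bounded_opsD(1)[OF Tb] by auto
        have "(\<lambda>i\<in>I. hscale H (d i) (T w)) = (\<lambda>i\<in>I. T ((\<lambda>i\<in>I. hscale H (d i) w) i))"
          using w by (auto simp: bounded_opsD[OF Tb])
        then show "(\<lambda>i\<in>I. hscale H (d i) (T w)) \<in> M"
          using M(6)[OF T w(2)] by simp
      qed
    next
      have "y j \<in> V" using y(1) M(2) j by auto
      then show "y j \<in> ?D" using y(1) d[OF y(1)] by simp
      show "y j \<noteq> hzero H" using y True by auto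
    qed
    then have "d j = 1 \<and> (\<forall>w\<in>V. (\<lambda>i\<in>I. hscale H (d i) w) \<in> M)"
      by (auto simp: d_def)
    then show ?thesis by blast
  qed
qed

text \<open>The tuple of multiples of \<open>x j\<close> by \<open>d i\<close> lies in
  \<open>M\<close>, and so does its image under any bounded \<open>T\<close>, since
  \<open>T (x j)\<close> is just another vector of \<open>H\<close>. What remains of
  \<open>x\<close> vanishes in coordinate \<open>j\<close>, because \<open>d j = 1\<close>, and
  belongs to an invariant subspace of smaller support.\<close>

lemma invariant_under_bounded_ops:
  assumes I: "finite I" and trans: "transitive_algebra H \<A>"
    and scal: "graph_transformations_scalar I H \<A>" and T: "T \<in> bounded_ops H"
    and "finite J" "J \<subseteq> I" and "invariant_subspace_pow I H \<A> M"
    and "\<And>y i. y \<in> M \<Longrightarrow> i \<in> I - J \<Longrightarrow> y i = hzero H"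
    and "x \<in> M"
  shows "(\<lambda>i\<in>I. T (x i)) \<in> M"
  using assms(5-)
proof (induction J arbitrary: M x rule: finite_psubset_induct)
  case (psubset J)
  note M = invariant_subspace_powD[OF psubset(4)]
  show ?case
  proof (cases "M = {\<lambda>i\<in>I. hzero H}")
    case True
    then have "(\<lambda>i\<in>I. T (x i)) = (\<lambda>i\<in>I. hzero H)"
      using psubset(6) by (auto simp: bounded_opsD(4)[OF T])
    then show ?thesis unfolding True by blast
  next
    case False
    have "\<exists>d. \<exists>j\<in>J. d j = 1 \<and> (\<forall>w\<in>V. (\<lambda>i\<in>I. hscale H (d i) w) \<in> M)"
      by (rule invariant_contains_diagonal[OF I trans scal \<open>finite J\<close> psubset(3,4) _ False])
        (rule psubset(5))
    then obtain d j where j: "j \<in> J" "d j = 1" and d: "\<And>w. w \<in> V \<Longrightarrow> (\<lambda>i\<in>I. hscale H (d i) w) \<in> M"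
      by blast
    have jI: "j \<in> I" using j psubset by auto
    have x: "x i \<in> V" if "i \<in> I" for i
      using psubset(6) M(2) that by auto
    let ?M' = "{y\<in>M. y j = hzero H}"
    have M': "invariant_subspace_pow I H \<A> ?M'"
      by (rule invariant_subspace_pow_kernel[OF I jI transitive_algebraD(1)[OF trans] psubset(4)])
    define y where "y = (\<lambda>i\<in>I. x i \<ominus> hscale H (d i) (x j))"
    have "(\<lambda>i\<in>I. hadd H (x i) ((\<lambda>i\<in>I. hscale H (-1) ((\<lambda>i\<in>I. hscale H (d i) (x j)) i)) i)) \<in> M"
      by (rule M(4)[OF psubset(6) M(5)[OF d[OF x[OF jI]]]])
    also have "(\<lambda>i\<in>I. hadd H (x i) ((\<lambda>i\<in>I. hscale H (-1) ((\<lambda>i\<in>I. hscale H (d i) (x j)) i)) i)) = y"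
      by (auto simp: y_def)
    finally have "y \<in> M" .
    moreover have "y j = hzero H"
      using x[OF jI] jI j(2) by (auto simp: y_def intro!: vec_eqI)
    ultimately have "y \<in> ?M'" by simp
    moreover have "J - {j} \<subset> J" "J - {j} \<subseteq> I" using j psubset by auto
    ultimately have "(\<lambda>i\<in>I. T (y i)) \<in> ?M'"
    proof (intro psubset.IH[OF _ _ M'])
      fix y i assume "y \<in> ?M'" "i \<in> I - (J - {j})"
      then show "y i = hzero H" using psubset(5)[of y i] by auto
    qed
    then have "(\<lambda>i\<in>I. T (y i)) \<in> M" by simp
    then have "(\<lambda>i\<in>I. hadd H ((\<lambda>i\<in>I. T (y i)) i) ((\<lambda>i\<in>I. hscale H (d i) (T (x j))) i)) \<in> M"
      by (rule M(4)[OF _ d[OF bounded_opsD(1)[OF T x[OF jI]]]])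
    also have "(\<lambda>i\<in>I. hadd H ((\<lambda>i\<in>I. T (y i)) i) ((\<lambda>i\<in>I. hscale H (d i) (T (x j))) i)) = (\<lambda>i\<in>I. T (x i))"
    proof (rule restrict_ext)
      fix i assume i: "i \<in> I"
      have "T (y i) = T (x i) \<ominus> hscale H (d i) (T (x j))"
        using i x[OF i] x[OF jI] by (simp add: y_def bounded_opsD[OF T])
      then show "hadd H ((\<lambda>i\<in>I. T (y i)) i) ((\<lambda>i\<in>I. hscale H (d i) (T (x j))) i) = T (x i)"
        using i bounded_opsD(1)[OF T x[OF i]] bounded_opsD(1)[OF T x[OF jI]]
        by simp (intro vec_eqI; simp)
    qed
    finally show ?thesis .
  qed
qed

text \<open>The finite set \<open>F\<close> of test vectors is itself the index set, and
  \<open>?O\<close> is the orbit of the identity tuple under the algebra. The closure of the orbit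
  is invariant under the algebra, hence under every bounded \<open>T\<close>; that it contains the
  image of the identity tuple under \<open>T\<close> means simultaneous approximation of
  \<open>T\<close> on \<open>F\<close>.\<close>

theorem strongly_dense_if_graph_transformations_scalar:
  assumes trans: "transitive_algebra H \<A>"
    and scal: "\<And>I :: 'v set. finite I \<Longrightarrow> graph_transformations_scalar I H \<A>"
  shows "strongly_dense H \<A>"
  unfolding strongly_dense_def
proof (intro ballI allI impI)
  fix T F and e :: real
  assume T: "T \<in> bounded_ops H" and "finite F \<and> F \<subseteq> V" and e: "0 < e"
  then have F: "finite F" "F \<subseteq> V" by auto
  interpret P: hilbert_space "hpow F H" by (rule hilbert_space_hpow[OF F(1)])
  have A: "unital_subalgebra H \<A>" and Ab: "\<A> \<subseteq> bounded_ops H"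
    using trans by (auto simp: transitive_algebra_def unital_subalgebra_def)
  note U = A[unfolded unital_subalgebra_def]
  let ?O = "(\<lambda>S. restrict S F) ` \<A>"
  let ?M = "hclosure (hpow F H) ?O"
  have O: "?O \<subseteq> F \<rightarrow>\<^sub>E V"
  proof safe
    fix S i assume "S \<in> \<A>" "i \<in> F"
    then show "restrict S F i \<in> V"
      using bounded_opsD(1)[of S i] F(2) Ab by auto
  qed auto
  have one: "restrict (\<lambda>x\<in>V. x) F \<in> ?O" using U by blast
  have add: "(\<lambda>i\<in>F. hadd H (restrict S F i) (restrict S' F i)) \<in> ?O" if "S \<in> \<A>" "S' \<in> \<A>" for S S'
  proof -
    have "(\<lambda>i\<in>F. hadd H (restrict S F i) (restrict S' F i)) = restrict (\<lambda>x\<in>V. hadd H (S x) (S' x)) F"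
      by (rule ext) (use F(2) in \<open>auto simp: restrict_def\<close>)
    then show ?thesis using U that by blast
  qed
  have scale: "(\<lambda>i\<in>F. hscale H c (restrict S F i)) \<in> ?O" if "S \<in> \<A>" for S c
  proof -
    have "(\<lambda>i\<in>F. hscale H c (restrict S F i)) = restrict (\<lambda>x\<in>V. hscale H c (S x)) F"
      by (rule ext) (use F(2) in \<open>auto simp: restrict_def\<close>)
    then show ?thesis using U that by blast
  qed
  have comp: "(\<lambda>i\<in>F. S (restrict S' F i)) \<in> ?O" if "S \<in> \<A>" "S' \<in> \<A>" for S S'
  proof -
    have "(\<lambda>i\<in>F. S (restrict S' F i)) = restrict (compose V S S') F"
      by (rule ext) (use F(2) in \<open>auto simp: compose_def restrict_def\<close>)
    then show ?thesis using U that by blast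
  qed
  have zero: "(\<lambda>i\<in>F. hzero H) \<in> ?O"
  proof -
    obtain S where S: "S \<in> \<A>" using U by blast
    have "(\<lambda>i\<in>F. hscale H 0 (restrict S F i)) = (\<lambda>i\<in>F. hzero H)"
    proof (rule restrict_ext)
      fix i assume "i \<in> F"
      then have "S i \<in> V"
        using bounded_opsD(1)[of S i] F(2) Ab S by auto
      then show "hscale H 0 (restrict S F i) = hzero H"
        using \<open>i \<in> F\<close> by simp
    qed
    then show ?thesis using scale[OF S, of 0] by simp
  qed
  have closed: "closed_subspace (hpow F H) ?M"
  proof (intro P.closed_subspace_hclosure)
    show "?O \<subseteq> vectors (hpow F H)" "hzero (hpow F H) \<in> ?O"
      using O zero by (simp_all only: hpow_simps)
  next
    fix x y assume "x \<in> ?O" "y \<in> ?O"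
    then show "hadd (hpow F H) x y \<in> ?O"
      unfolding hpow_simps by (elim imageE) (simp only: add)
  next
    fix c x assume "x \<in> ?O"
    then show "hscale (hpow F H) c x \<in> ?O"
      unfolding hpow_simps by (elim imageE) (simp only: scale)
  qed
  have inv: "(\<lambda>i\<in>F. S (y i)) \<in> ?M" if S: "S \<in> \<A>" and y: "y \<in> ?M" for S y
  proof -
    \<comment> \<open>The coordinatewise action of \<open>S\<close> is presented as a bounded
      operator on the power, so that the invariance of closures can be applied there.\<close>
    define S' where "S' = (\<lambda>x\<in>F \<rightarrow>\<^sub>E V. \<lambda>i\<in>F. S (x i))"
    have Sb: "S \<in> bounded_ops H" using S Ab by auto
    obtain C where C: "0 < C" "\<And>x y. x \<in> V \<Longrightarrow> y \<in> V \<Longrightarrow> hdist H (S x) (S y) \<le> C * hdist H x y"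
      using bounded_ops_dist[OF Sb] by blast
    have SV: "(\<lambda>i\<in>F. S (x i)) \<in> F \<rightarrow>\<^sub>E V" if "x \<in> F \<rightarrow>\<^sub>E V" for x
      using bounded_opsD(1)[OF Sb PiE_mem[OF that]] by (intro restrict_PiE_iff[THEN iffD2] ballI)
    have "hnorm (hpow F H) (S' x) \<le> C * hnorm (hpow F H) x" if x: "x \<in> F \<rightarrow>\<^sub>E V" for x
    proof -
      have "(\<Sum>i\<in>F. (hnorm H ((\<lambda>i\<in>F. S (x i)) i))\<^sup>2) \<le> (\<Sum>i\<in>F. C\<^sup>2 * (hnorm H (x i))\<^sup>2)"
      proof (rule sum_mono)
        fix i assume i: "i \<in> F"
        then have xi: "x i \<in> V" using x by auto
        have "hnorm H (S (x i)) \<le> C * hnorm H (x i)"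
          using C(2)[OF xi zero_mem] xi bounded_opsD(1)[OF Sb xi] by (simp add: bounded_opsD(4)[OF Sb])
        then have "(hnorm H (S (x i)))\<^sup>2 \<le> (C * hnorm H (x i))\<^sup>2"
          using bounded_opsD(1)[OF Sb xi] by (intro power_mono) auto
        then show "(hnorm H ((\<lambda>i\<in>F. S (x i)) i))\<^sup>2 \<le> C\<^sup>2 * (hnorm H (x i))\<^sup>2"
          using i by (simp add: power_mult_distrib)
      qed
      also have "\<dots> = C\<^sup>2 * (\<Sum>i\<in>F. (hnorm H (x i))\<^sup>2)"
        by (simp add: sum_distrib_left)
      finally have "sqrt (\<Sum>i\<in>F. (hnorm H ((\<lambda>i\<in>F. S (x i)) i))\<^sup>2) \<le> sqrt (C\<^sup>2 * (\<Sum>i\<in>F. (hnorm H (x i))\<^sup>2))"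
        by simp
      then show ?thesis
        using x C(1) by (simp add: S'_def hnorm_hpow[OF x] hnorm_hpow[OF SV[OF x]] real_sqrt_mult)
    qed
    then have "S' \<in> bounded_ops (hpow F H)"
      unfolding bounded_ops_def mem_Collect_eq hpow_simps
    proof (intro conjI ballI allI exI[of _ C])
      show "S' \<in> (F \<rightarrow>\<^sub>E V) \<rightarrow>\<^sub>E F \<rightarrow>\<^sub>E V"
        unfolding S'_def by (rule restrict_PiE_iff[THEN iffD2]) (use SV in blast)
    next
      fix x y assume xy: "x \<in> F \<rightarrow>\<^sub>E V" "y \<in> F \<rightarrow>\<^sub>E V"
      then have "x i \<in> V" "y i \<in> V" if "i \<in> F" for i using that by auto
      then show "S' (\<lambda>i\<in>F. hadd H (x i) (y i)) = (\<lambda>i\<in>F. hadd H (S' x i) (S' y i))"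
        unfolding S'_def using xy by (auto simp: bounded_opsD(2)[OF Sb])
    next
      fix c x assume x: "x \<in> F \<rightarrow>\<^sub>E V"
      then have "x i \<in> V" if "i \<in> F" for i using that by auto
      then show "S' (\<lambda>i\<in>F. hscale H c (x i)) = (\<lambda>i\<in>F. hscale H c (S' x i))"
        unfolding S'_def using x by (auto simp: bounded_opsD(3)[OF Sb])
    qed
    moreover have "S' ` ?O \<subseteq> ?O"
    proof (rule image_subsetI)
      fix x assume x: "x \<in> ?O"
      then obtain S1 where S1: "S1 \<in> \<A>" "x = restrict S1 F" by blast
      have "x \<in> F \<rightarrow>\<^sub>E V" using x O by (rule rev_subsetD)
      then have "S' x = (\<lambda>i\<in>F. S (x i))" by (simp only: S'_def restrict_apply')
      then show "S' x \<in> ?O" using comp[OF S S1(1)] unfolding S1(2) by (simp only:)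
    qed
    ultimately have "S' y \<in> ?M"
      using P.hclosure_invariant[of S' ?O, THEN subsetD, OF _ _ _ imageI[OF y]] O
      by (simp only: hpow_simps)
    moreover have "y \<in> F \<rightarrow>\<^sub>E V" using y by (simp add: hclosure_def)
    ultimately show ?thesis by (simp add: S'_def)
  qed
  have inv': "invariant_subspace_pow F H \<A> ?M"
    unfolding invariant_subspace_pow_def using closed inv by blast
  have one': "restrict (\<lambda>x\<in>V. x) F \<in> ?M"
    by (rule subsetD[OF P.subset_hclosure one]) (use O in \<open>simp only: hpow_simps\<close>)
  have "(\<lambda>i\<in>F. T (restrict (\<lambda>x\<in>V. x) F i)) \<in> ?M"
    by (rule invariant_under_bounded_ops[OF F(1) trans scal[OF F(1)] T F(1) subset_refl inv' _ one']) simp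
  then obtain S where S: "S \<in> \<A>"
    "hdist (hpow F H) (\<lambda>i\<in>F. T (restrict (\<lambda>x\<in>V. x) F i)) (restrict S F) < e"
    using P.hclosureD[OF _ e] by blast
  have "hdist H (S x) (T x) < e" if x: "x \<in> F" for x
  proof -
    have xV: "x \<in> V" using x F(2) by auto
    have "(\<lambda>i\<in>F. T (restrict (\<lambda>x\<in>V. x) F i)) \<in> F \<rightarrow>\<^sub>E V"
    proof (rule restrict_PiE_iff[THEN iffD2], rule ballI)
      fix i assume "i \<in> F"
      then show "T (restrict (\<lambda>x\<in>V. x) F i) \<in> V"
        using F(2) bounded_opsD(1)[OF T, of i] by auto
    qed
    moreover have "restrict S F \<in> F \<rightarrow>\<^sub>E V" using O S(1) by blast
    ultimately have "hdist H ((\<lambda>i\<in>F. T (restrict (\<lambda>x\<in>V. x) F i)) x) (restrict S F x) < e"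
      using hdist_coord_le[OF F(1) _ _ x] S(2) by (meson le_less_trans)
    then have "hdist H (T x) (S x) < e"
      using x xV by simp
    moreover have "T x \<in> V" "S x \<in> V"
      using bounded_opsD(1) T S(1) Ab xV by blast+
    ultimately show ?thesis
      by (simp add: dist_commute)
  qed
  then show "\<exists>S\<in>\<A>. \<forall>x\<in>F. hdist H (S x) (T x) < e" using S(1) by blast
qed

end

section \<open>Square-integrable functions\<close>

definition square_integrable :: "'a measure \<Rightarrow> ('a \<Rightarrow> complex) \<Rightarrow> bool" where
  "square_integrable m f \<longleftrightarrow> f \<in> borel_measurable m \<and> integrable m (\<lambda>x. (cmod (f x))\<^sup>2)"

lemma square_integrable_measurable [measurable_dest]: "square_integrable m f \<Longrightarrow> f \<in> borel_measurable m"
  by (simp add: square_integrable_def)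

lemma borel_measurable_cnj [measurable (raw)]:
  assumes "f \<in> borel_measurable m"
  shows "(\<lambda>x. cnj (f x)) \<in> borel_measurable m"
  using assms by (rule borel_measurable_continuous_on[rotated]) (intro continuous_intros)

lemma square_integrable_bound:
  assumes "g \<in> borel_measurable m" "integrable m h" "AE x in m. (cmod (g x))\<^sup>2 \<le> h x"
  shows "square_integrable m g"
  unfolding square_integrable_def
proof
  show "integrable m (\<lambda>x. (cmod (g x))\<^sup>2)"
  proof (rule Bochner_Integration.integrable_bound[OF assms(2)])
    show "AE x in m. norm ((cmod (g x))\<^sup>2) \<le> norm (h x)"
      using assms(3) by eventually_elim auto
  qed (use assms(1) in measurable)
qed (fact assms)

lemma square_integrable_add:
  assumes "square_integrable m f" "square_integrable m g"
  shows "square_integrable m (\<lambda>x. f x + g x)"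
proof (rule square_integrable_bound)
  show "integrable m (\<lambda>x. 2 * (cmod (f x))\<^sup>2 + 2 * (cmod (g x))\<^sup>2)"
    using assms by (simp add: square_integrable_def)
  have "(cmod (f x + g x))\<^sup>2 \<le> 2 * (cmod (f x))\<^sup>2 + 2 * (cmod (g x))\<^sup>2" for x
  proof -
    have "(cmod (f x + g x))\<^sup>2 \<le> (cmod (f x) + cmod (g x))\<^sup>2"
      by (intro power_mono norm_triangle_ineq) auto
    also have "\<dots> \<le> 2 * (cmod (f x))\<^sup>2 + 2 * (cmod (g x))\<^sup>2"
      using zero_le_power2[of "cmod (f x) - cmod (g x)"] by (simp add: power2_sum power2_diff)
    finally show ?thesis .
  qed
  then show "AE x in m. (cmod (f x + g x))\<^sup>2 \<le> 2 * (cmod (f x))\<^sup>2 + 2 * (cmod (g x))\<^sup>2"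
    by simp
qed (use assms in measurable)

lemma square_integrable_bounded_mult:
  assumes "square_integrable m f" "b \<in> borel_measurable m" "AE x in m. cmod (b x) \<le> C"
  shows "square_integrable m (\<lambda>x. b x * f x)"
    and "(\<integral>x. (cmod (b x * f x))\<^sup>2 \<partial>m) \<le> C\<^sup>2 * (\<integral>x. (cmod (f x))\<^sup>2 \<partial>m)"
proof -
  have *: "AE x in m. (cmod (b x * f x))\<^sup>2 \<le> C\<^sup>2 * (cmod (f x))\<^sup>2"
    using assms(3) by eventually_elim (simp add: norm_mult power_mult_distrib mult_right_mono power_mono)
  have i: "integrable m (\<lambda>x. C\<^sup>2 * (cmod (f x))\<^sup>2)"
    using assms(1) by (simp add: square_integrable_def)
  show s: "square_integrable m (\<lambda>x. b x * f x)"
    by (rule square_integrable_bound[OF _ i *]) (use assms in measurable)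
  have "(\<integral>x. (cmod (b x * f x))\<^sup>2 \<partial>m) \<le> (\<integral>x. C\<^sup>2 * (cmod (f x))\<^sup>2 \<partial>m)"
    using s i * by (intro integral_mono_AE) (auto simp: square_integrable_def)
  then show "(\<integral>x. (cmod (b x * f x))\<^sup>2 \<partial>m) \<le> C\<^sup>2 * (\<integral>x. (cmod (f x))\<^sup>2 \<partial>m)"
    by simp
qed

lemma square_integrable_cmult:
  "square_integrable m f \<Longrightarrow> square_integrable m (\<lambda>x. c * f x)"
  using square_integrable_bounded_mult(1)[of m f "\<lambda>_. c" "cmod c"] by simp

lemma square_integrable_diff:
  "square_integrable m f \<Longrightarrow> square_integrable m g \<Longrightarrow> square_integrable m (\<lambda>x. f x - g x)"
  using square_integrable_add[of m f "\<lambda>x. (-1) * g x"] square_integrable_cmult[of m g "-1"] by simp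

lemma integrable_mult_cnj:
  assumes "square_integrable m f" "square_integrable m g"
  shows "integrable m (\<lambda>x. f x * cnj (g x))"
proof (rule Bochner_Integration.integrable_bound)
  show "integrable m (\<lambda>x. (cmod (f x))\<^sup>2 + (cmod (g x))\<^sup>2)"
    using assms by (simp add: square_integrable_def)
  have "cmod (f x) * cmod (g x) \<le> (cmod (f x))\<^sup>2 + (cmod (g x))\<^sup>2" for x
  proof -
    have "0 \<le> cmod (f x) * cmod (g x)" by simp
    then show ?thesis
      using zero_le_power2[of "cmod (f x) - cmod (g x)"] unfolding power2_diff by linarith
  qed
  then show "AE x in m. norm (f x * cnj (g x)) \<le> norm ((cmod (f x))\<^sup>2 + (cmod (g x))\<^sup>2)"
    by (simp add: norm_mult)
qed (use assms in measurable)

section \<open>The operations of \<open>L2 m\<close> on representatives\<close>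

lemma vectors_L2: "vectors (L2 m) = ae_class m ` {f. square_integrable m f}"
  by (auto simp: L2_def square_integrable_def)

lemma mem_L2I [intro]: "square_integrable m f \<Longrightarrow> ae_class m f \<in> vectors (L2 m)"
  by (auto simp: vectors_L2)

lemma hzero_L2: "hzero (L2 m) = ae_class m (\<lambda>x. 0)"
  by (simp add: L2_def)

lemma hadd_L2_ae_class:
  "f \<in> borel_measurable m \<Longrightarrow> g \<in> borel_measurable m \<Longrightarrow>
    hadd (L2 m) (ae_class m f) (ae_class m g) = ae_class m (\<lambda>x. f x + g x)"
  by (simp add: L2_def ae_lift2_ae_class)

lemma hnorm_L2_ae_class:
  assumes "f \<in> borel_measurable m"
  shows "hnorm (L2 m) (ae_class m f) = sqrt (\<integral>x. (cmod (f x))\<^sup>2 \<partial>m)"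
proof -
  have "hinner (L2 m) (ae_class m f) (ae_class m f) = (\<integral>x. complex_of_real ((cmod (f x))\<^sup>2) \<partial>m)"
    unfolding hinner_L2_ae_class[OF assms assms] by (simp only: complex_norm_square)
  then show ?thesis
    by (simp only: hnorm_def integral_complex_of_real Re_complex_of_real)
qed

lemma hdist_L2_ae_class:
  assumes [measurable]: "f \<in> borel_measurable m" "g \<in> borel_measurable m"
  shows "hdist (L2 m) (ae_class m f) (ae_class m g) = sqrt (\<integral>x. (cmod (f x - g x))\<^sup>2 \<partial>m)"
  by (simp add: hdist_def hscale_L2_ae_class hadd_L2_ae_class hnorm_L2_ae_class)

text \<open>Riesz-Fischer: a subsequence with rapidly decreasing increments converges almost
  everywhere, and Fatou's lemma carries the Cauchy estimate over to its limit.\<close>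

lemma L2_limit:
  fixes f :: "nat \<Rightarrow> 'a \<Rightarrow> complex"
  assumes "finite_measure m" and f: "\<And>n. square_integrable m (f n)"
    and C: "\<And>e. 0 < e \<Longrightarrow> \<exists>N. \<forall>i\<ge>N. \<forall>j\<ge>N. (\<integral>x. (cmod (f i x - f j x))\<^sup>2 \<partial>m) < e"
  shows "\<exists>l. square_integrable m l \<and> (\<forall>e>0. \<exists>N. \<forall>n\<ge>N. (\<integral>x. (cmod (f n x - l x))\<^sup>2 \<partial>m) \<le> e)"
proof -
  interpret finite_measure m by fact
  note [measurable] = square_integrable_measurable[OF f]
  note fd = square_integrable_diff[OF f f]
  have "\<exists>N. \<forall>i\<ge>N. \<forall>j\<ge>N. (\<integral>x. (cmod (f i x - f j x))\<^sup>2 \<partial>m) < (1/4) ^ k" for k :: nat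
    by (rule C) simp
  then obtain N where N: "\<And>k i j. i \<ge> N k \<Longrightarrow> j \<ge> N k \<Longrightarrow> (\<integral>x. (cmod (f i x - f j x))\<^sup>2 \<partial>m) < (1/4) ^ k"
    by metis
  \<comment> \<open>The sum puts both \<open>r k\<close> and \<open>r (Suc k)\<close> above
    \<open>N k\<close>; the summand \<open>k\<close> drives \<open>r k\<close> to infinity, which
    the Fatou argument uses.\<close>
  define r where "r k = k + (\<Sum>i\<le>k. N i)" for k
  have rN: "N k \<le> r k" "N k \<le> r (Suc k)" "k \<le> r k" for k
    using member_le_sum[of k "{..k}" N] by (auto simp: r_def)
  define D where "D k x = cmod (f (r (Suc k)) x - f (r k) x)" for k x
  have [measurable]: "D k \<in> borel_measurable m" for k
    unfolding D_def by measurable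
  have D2: "integrable m (\<lambda>x. (D k x)\<^sup>2)" "(\<integral>x. (D k x)\<^sup>2 \<partial>m) < (1/4) ^ k" for k
    using fd[of "r (Suc k)" "r k"] N[OF rN(2) rN(1), of k] by (auto simp: D_def square_integrable_def)
  have D: "(\<integral>\<^sup>+x. ennreal (D k x) \<partial>m) \<le> ennreal ((1 + measure m (space m)) * (1/2) ^ k)" for k
  proof -
    \<comment> \<open>The inequality of arithmetic and geometric means with weight 2^k: on a finite
      measure space it turns the bound 4^-k for the integral of the square into a summable bound of
      order 2^-k for the integral of \<open>D k\<close>.\<close>
    have pt: "D k x \<le> 2 ^ k * (D k x)\<^sup>2 + (1/2) ^ k" for x
    proof -
      have 1: "(2::real) ^ k * (1/2) ^ k = 1"
        by (simp flip: power_mult_distrib)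
      have "0 \<le> 2 ^ k * (D k x - (1/2) ^ k)\<^sup>2"
        by simp
      also have "\<dots> = 2 ^ k * (D k x)\<^sup>2 - 2 * (2 ^ k * (1/2) ^ k) * D k x + (2 ^ k * (1/2) ^ k) * (1/2) ^ k"
        by (simp add: power2_eq_square algebra_simps)
      finally have "2 * D k x \<le> 2 ^ k * (D k x)\<^sup>2 + (1/2) ^ k"
        unfolding 1 by simp
      moreover have "0 \<le> D k x" by (simp add: D_def)
      ultimately show ?thesis by linarith
    qed
    have "(\<integral>\<^sup>+x. ennreal (D k x) \<partial>m) \<le> (\<integral>\<^sup>+x. ennreal (2 ^ k * (D k x)\<^sup>2 + (1/2) ^ k) \<partial>m)"
      by (intro nn_integral_mono ennreal_leI pt)
    also have "\<dots> = ennreal (\<integral>x. 2 ^ k * (D k x)\<^sup>2 + (1/2) ^ k \<partial>m)"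
      using D2(1) by (intro nn_integral_eq_integral) auto
    also have "(\<integral>x. 2 ^ k * (D k x)\<^sup>2 + (1/2) ^ k \<partial>m) = 2 ^ k * (\<integral>x. (D k x)\<^sup>2 \<partial>m) + (1/2) ^ k * measure m (space m)"
      using D2(1) by simp
    also have "ennreal \<dots> \<le> ennreal (2 ^ k * (1/4) ^ k + (1/2) ^ k * measure m (space m))"
      using D2(2)[of k] by (intro ennreal_leI add_right_mono mult_left_mono) auto
    also have "2 ^ k * (1/4) ^ k + (1/2) ^ k * measure m (space m) = (1 + measure m (space m)) * (1/2::real) ^ k"
      by (simp add: algebra_simps flip: power_mult_distrib)
    finally show ?thesis .
  qed
  have "(\<integral>\<^sup>+x. (\<Sum>k. ennreal (D k x)) \<partial>m) = (\<Sum>k. \<integral>\<^sup>+x. ennreal (D k x) \<partial>m)"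
    by (intro nn_integral_suminf) auto
  also have "\<dots> \<le> (\<Sum>k. ennreal ((1 + measure m (space m)) * (1/2) ^ k))"
    by (intro suminf_le D) auto
  also have "\<dots> = ennreal (\<Sum>k. (1 + measure m (space m)) * (1/2) ^ k)"
    by (intro suminf_ennreal2) (auto intro!: summable_mult)
  also have "\<dots> < \<infinity>" by simp
  finally have "AE x in m. (\<Sum>k. ennreal (D k x)) \<noteq> \<infinity>"
    by (intro nn_integral_PInf_AE) auto
  then have conv: "AE x in m. (\<lambda>k. f (r k) x) \<longlonglongrightarrow> lim (\<lambda>k. f (r k) x)"
  proof eventually_elim
    case (elim x)
    have "summable (\<lambda>k. D k x)"
      by (rule summable_suminf_not_top) (use elim in \<open>auto simp: D_def\<close>)
    then have "summable (\<lambda>k. f (r (Suc k)) x - f (r k) x)"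
      unfolding D_def by (rule summable_norm_cancel)
    then have "convergent (\<lambda>n. f (r 0) x + (\<Sum>k<n. f (r (Suc k)) x - f (r k) x))"
      by (intro convergent_add convergent_const) (simp add: summable_iff_convergent)
    then have "convergent (\<lambda>n. f (r n) x)"
      by (simp add: sum_lessThan_telescope[of "\<lambda>k. f (r k) x"])
    then show ?case by (simp add: convergent_LIMSEQ_iff)
  qed
  define l where "l x = lim (\<lambda>k. f (r k) x)" for x
  have [measurable]: "l \<in> borel_measurable m"
    unfolding l_def by measurable
  \<comment> \<open>Square-integrability of \<open>l\<close> is still open, so the estimate is made
    for the nonnegative integral, which is defined without it.\<close>
  have fatou: "(\<integral>\<^sup>+x. ennreal ((cmod (f n x - l x))\<^sup>2) \<partial>m) \<le> ennreal e"
    if n: "\<And>j. j \<ge> n \<Longrightarrow> (\<integral>x. (cmod (f n x - f j x))\<^sup>2 \<partial>m) \<le> e" for n e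
  proof -
    have "(\<integral>\<^sup>+x. ennreal ((cmod (f n x - l x))\<^sup>2) \<partial>m)
        = (\<integral>\<^sup>+x. liminf (\<lambda>k. ennreal ((cmod (f n x - f (r k) x))\<^sup>2)) \<partial>m)"
    proof (intro nn_integral_cong_AE)
      show "AE x in m. ennreal ((cmod (f n x - l x))\<^sup>2) = liminf (\<lambda>k. ennreal ((cmod (f n x - f (r k) x))\<^sup>2))"
        using conv
      proof eventually_elim
        case (elim x)
        then have "(\<lambda>k. ennreal ((cmod (f n x - f (r k) x))\<^sup>2)) \<longlonglongrightarrow> ennreal ((cmod (f n x - l x))\<^sup>2)"
          unfolding l_def by (intro tendsto_intros)
        then show ?case
          by (intro lim_imp_Liminf[symmetric]) auto
      qed
    qed
    also have "\<dots> \<le> liminf (\<lambda>k. \<integral>\<^sup>+x. ennreal ((cmod (f n x - f (r k) x))\<^sup>2) \<partial>m)"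
      by (intro nn_integral_liminf) auto
    also have "\<dots> \<le> ennreal e"
    proof (intro Liminf_le eventually_sequentiallyI)
      fix k assume "n \<le> k"
      then have "n \<le> r k" using rN(3)[of k] by simp
      have "(\<integral>\<^sup>+x. ennreal ((cmod (f n x - f (r k) x))\<^sup>2) \<partial>m) = ennreal (\<integral>x. (cmod (f n x - f (r k) x))\<^sup>2 \<partial>m)"
        using fd by (intro nn_integral_eq_integral) (auto simp: square_integrable_def)
      also have "\<dots> \<le> ennreal e" by (intro ennreal_leI n) fact
      finally show "(\<integral>\<^sup>+x. ennreal ((cmod (f n x - f (r k) x))\<^sup>2) \<partial>m) \<le> ennreal e" .
    qed auto
    finally show ?thesis .
  qed
  have diff: "square_integrable m (\<lambda>x. f n x - l x) \<and> (\<integral>x. (cmod (f n x - l x))\<^sup>2 \<partial>m) \<le> e"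
    if n: "\<And>j. j \<ge> n \<Longrightarrow> (\<integral>x. (cmod (f n x - f j x))\<^sup>2 \<partial>m) \<le> e" and e: "0 \<le> e" for n e
  proof -
    have "integrable m (\<lambda>x. (cmod (f n x - l x))\<^sup>2)"
      using fatou[OF n] by (intro integrableI_bounded) (auto simp: le_less_trans[OF _ ennreal_less_top])
    moreover from this have "ennreal (\<integral>x. (cmod (f n x - l x))\<^sup>2 \<partial>m) \<le> ennreal e"
      using fatou[OF n] by (subst nn_integral_eq_integral[symmetric]) auto
    ultimately show ?thesis
      using e by (simp add: square_integrable_def)
  qed
  obtain N1 where "\<forall>i\<ge>N1. \<forall>j\<ge>N1. (\<integral>x. (cmod (f i x - f j x))\<^sup>2 \<partial>m) < 1"
    using C[of 1] by auto
  then have "square_integrable m (\<lambda>x. f N1 x - l x)"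
    using diff[of N1 1] by (simp add: less_imp_le)
  from square_integrable_diff[OF f this, of N1] have "square_integrable m l" by simp
  moreover have "\<exists>N. \<forall>n\<ge>N. (\<integral>x. (cmod (f n x - l x))\<^sup>2 \<partial>m) \<le> e" if e: "0 < e" for e
  proof -
    obtain N1 where "\<forall>i\<ge>N1. \<forall>j\<ge>N1. (\<integral>x. (cmod (f i x - f j x))\<^sup>2 \<partial>m) < e"
      using C[OF e] by auto
    then have "\<forall>n\<ge>N1. (\<integral>x. (cmod (f n x - l x))\<^sup>2 \<partial>m) \<le> e"
      using diff e by (meson less_imp_le order_trans)
    then show ?thesis by blast
  qed
  ultimately show ?thesis by blast
qed

theorem hilbert_space_L2:
  assumes fin: "finite_measure m"
  shows "hilbert_space (L2 m)"
proof
  show "hzero (L2 m) \<in> vectors (L2 m)"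
    unfolding hzero_L2 by (rule mem_L2I) (simp add: square_integrable_def)
next
  fix x y assume "x \<in> vectors (L2 m)" "y \<in> vectors (L2 m)"
  then obtain f g where f: "square_integrable m f" "x = ae_class m f"
    and g: "square_integrable m g" "y = ae_class m g"
    by (auto simp: vectors_L2)
  note fg [measurable] = square_integrable_measurable[OF f(1)] square_integrable_measurable[OF g(1)]
  show "hadd (L2 m) x y \<in> vectors (L2 m)"
    unfolding f(2) g(2) hadd_L2_ae_class[OF fg] using f(1) g(1) by (intro mem_L2I square_integrable_add)
  show "hinner (L2 m) x y = cnj (hinner (L2 m) y x)"
    unfolding f(2) g(2) hinner_L2_ae_class[OF fg] hinner_L2_ae_class[OF fg(2,1)] Bochner_Integration.integral_cnj[symmetric]
    by (simp add: mult.commute)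
  show "hinner (L2 m) (hscale (L2 m) c x) y = c * hinner (L2 m) x y" for c
    unfolding f(2) g(2) hscale_L2_ae_class[OF fg(1)] hinner_L2_ae_class[OF fg]
    by (subst hinner_L2_ae_class) (simp_all add: mult.assoc)
  show "hinner (L2 m) (hzero (L2 m)) y = 0"
    unfolding g(2) hzero_L2 by (subst hinner_L2_ae_class) simp_all
  assume eq: "\<And>z. z \<in> vectors (L2 m) \<Longrightarrow> hinner (L2 m) x z = hinner (L2 m) y z"
  let ?d = "\<lambda>x. f x - g x"
  have d: "square_integrable m ?d" by (rule square_integrable_diff[OF f(1) g(1)])
  have "(\<integral>x. f x * cnj (?d x) \<partial>m) = (\<integral>x. g x * cnj (?d x) \<partial>m)"
    using eq[OF mem_L2I[OF d]] unfolding f(2) g(2) by (simp add: hinner_L2_ae_class)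
  then have "(\<integral>x. ?d x * cnj (?d x) \<partial>m) = 0"
    using integrable_mult_cnj[OF f(1) d] integrable_mult_cnj[OF g(1) d]
    by (simp only: left_diff_distrib Bochner_Integration.integral_diff diff_self)
  then have "(\<integral>x. complex_of_real ((cmod (?d x))\<^sup>2) \<partial>m) = 0"
    by (simp only: complex_norm_square)
  then have "(\<integral>x. (cmod (?d x))\<^sup>2 \<partial>m) = 0"
    by (simp only: integral_complex_of_real of_real_eq_0_iff)
  then have "AE x in m. (cmod (?d x))\<^sup>2 = 0"
    using d by (subst integral_nonneg_eq_0_iff_AE[symmetric]) (auto simp: square_integrable_def)
  then show "x = y"
    unfolding f(2) g(2) by (intro ae_class_eqI) (auto elim: AE_mp)
next
  fix x y z assume "x \<in> vectors (L2 m)" "y \<in> vectors (L2 m)" "z \<in> vectors (L2 m)"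
  then obtain f g h where f: "square_integrable m f" "x = ae_class m f"
    and g: "square_integrable m g" "y = ae_class m g"
    and h: "square_integrable m h" "z = ae_class m h"
    by (auto simp: vectors_L2)
  note [measurable] = square_integrable_measurable[OF f(1)] square_integrable_measurable[OF g(1)]
     square_integrable_measurable[OF h(1)]
  show "hinner (L2 m) (hadd (L2 m) x y) z = hinner (L2 m) x z + hinner (L2 m) y z"
    unfolding f(2) g(2) h(2)
    using integrable_mult_cnj[OF f(1) h(1)] integrable_mult_cnj[OF g(1) h(1)]
    by (simp add: hadd_L2_ae_class hinner_L2_ae_class distrib_right)
next
  fix x c assume "x \<in> vectors (L2 m)"
  then obtain f where f: "square_integrable m f" "x = ae_class m f"
    by (auto simp: vectors_L2)
  note [measurable] = square_integrable_measurable[OF f(1)]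
  show "hscale (L2 m) c x \<in> vectors (L2 m)"
    unfolding f(2) using f(1) by (subst hscale_L2_ae_class) (auto intro: square_integrable_cmult)
  have "hinner (L2 m) x x = (\<integral>x. complex_of_real ((cmod (f x))\<^sup>2) \<partial>m)"
    unfolding f(2) by (subst hinner_L2_ae_class) (simp_all only: complex_norm_square square_integrable_measurable[OF f(1)])
  then show "0 \<le> Re (hinner (L2 m) x x)"
    by (simp only: integral_complex_of_real Re_complex_of_real) simp
next
  fix s :: "nat \<Rightarrow> ('a \<Rightarrow> complex) set"
  assume s: "\<And>n. s n \<in> vectors (L2 m)"
    and C: "\<And>e. 0 < e \<Longrightarrow> \<exists>N. \<forall>i\<ge>N. \<forall>j\<ge>N. hdist (L2 m) (s i) (s j) < e"
  have "\<exists>f. square_integrable m f \<and> s n = ae_class m f" for n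
    using s[of n] by (auto simp: vectors_L2)
  then obtain f where f: "\<And>n. square_integrable m (f n)" "\<And>n. s n = ae_class m (f n)"
    by metis
  note meas = square_integrable_measurable[OF f(1)]
  have "\<exists>N. \<forall>i\<ge>N. \<forall>j\<ge>N. (\<integral>x. (cmod (f i x - f j x))\<^sup>2 \<partial>m) < e" if "0 < e" for e
    using C[of "sqrt e"] that unfolding f(2) hdist_L2_ae_class[OF meas meas] by simp
  then obtain l where l: "square_integrable m l"
    "\<And>e. 0 < e \<Longrightarrow> \<exists>N. \<forall>n\<ge>N. (\<integral>x. (cmod (f n x - l x))\<^sup>2 \<partial>m) \<le> e"
    using L2_limit[of m f, OF fin f(1)] by blast
  have "(\<lambda>n. hdist (L2 m) (s n) (ae_class m l)) \<longlonglongrightarrow> 0"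
  proof (rule LIMSEQ_I)
    fix e :: real assume e: "0 < e"
    then have "0 < (e / 2)\<^sup>2" by simp
    from l(2)[OF this] obtain N where N: "\<And>n. n \<ge> N \<Longrightarrow> (\<integral>x. (cmod (f n x - l x))\<^sup>2 \<partial>m) \<le> (e / 2)\<^sup>2"
      by blast
    have "hdist (L2 m) (s n) (ae_class m l) \<le> e / 2" if "n \<ge> N" for n
      unfolding f(2) hdist_L2_ae_class[OF meas square_integrable_measurable[OF l(1)]]
      using N[OF that] e by (intro real_le_lsqrt) auto
    moreover have "0 \<le> hdist (L2 m) (s n) (ae_class m l)" for n
      unfolding f(2) hdist_L2_ae_class[OF meas square_integrable_measurable[OF l(1)]] by simp
    ultimately show "\<exists>N. \<forall>n\<ge>N. norm (hdist (L2 m) (s n) (ae_class m l) - 0) < e"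
      using e by (intro exI[of _ N]) (force intro: le_less_trans)
  qed
  then show "\<exists>l\<in>vectors (L2 m). (\<lambda>n. hdist (L2 m) (s n) l) \<longlonglongrightarrow> 0"
    using l(1) by blast
qed

section \<open>Moduli of invertible elements of a hypo-Dirichlet algebra\<close>

lemma uniform_algebraD:
  assumes "uniform_algebra A"
  shows "f \<in> A \<Longrightarrow> continuous_on UNIV f" "(\<lambda>x. c) \<in> A"
    "f \<in> A \<Longrightarrow> g \<in> A \<Longrightarrow> (\<lambda>x. f x + g x) \<in> A"
    "f \<in> A \<Longrightarrow> g \<in> A \<Longrightarrow> (\<lambda>x. f x * g x) \<in> A"
    "(\<And>e. 0 < e \<Longrightarrow> \<exists>g\<in>A. \<forall>x. cmod (f x - g x) < e) \<Longrightarrow> f \<in> A"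
  using assms unfolding uniform_algebra_def by blast+

lemma uniform_algebra_cmult:
  "uniform_algebra A \<Longrightarrow> f \<in> A \<Longrightarrow> (\<lambda>x. c * f x) \<in> A"
  using uniform_algebraD(4)[of A "\<lambda>_. c" f] uniform_algebraD(2)[of A c] by simp

lemma uniform_algebra_sum:
  assumes "uniform_algebra A" "finite S" "\<And>s. s \<in> S \<Longrightarrow> f s \<in> A"
  shows "(\<lambda>x. \<Sum>s\<in>S. f s x) \<in> A"
  using assms(2,3) by (induction S rule: finite_induct) (auto intro: uniform_algebraD[OF assms(1)])

lemma uniform_algebra_power:
  assumes "uniform_algebra A" "f \<in> A"
  shows "(\<lambda>x. f x ^ n) \<in> A"
  by (induction n) (auto intro: uniform_algebraD[OF assms(1)] assms(2))

lemma bounded_on_compact_space: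
  fixes f :: "'a::topological_space \<Rightarrow> 'b::real_normed_vector"
  assumes "compact (UNIV :: 'a set)" "continuous_on UNIV f"
  obtains B where "0 < B" "\<And>x. norm (f x) \<le> B"
  using compact_imp_bounded[OF compact_continuous_image[OF assms(2,1)]] unfolding bounded_pos by blast

lemma uniform_algebra_exp:
  fixes A :: "('a::t2_space \<Rightarrow> complex) set"
  assumes A: "uniform_algebra A" and "compact (UNIV :: 'a set)" and f: "f \<in> A"
  shows "(\<lambda>x. exp (f x)) \<in> A"
proof (rule uniform_algebraD(5)[OF A])
  fix e :: real assume e: "0 < e"
  obtain B where B: "0 < B" "\<And>x. cmod (f x) \<le> B"
    using bounded_on_compact_space[OF assms(2) uniform_algebraD(1)[OF A f]] by blast
  have "uniform_limit UNIV (\<lambda>n x. \<Sum>i<n. f x ^ i /\<^sub>R fact i) (\<lambda>x. \<Sum>i. f x ^ i /\<^sub>R fact i) sequentially"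
  proof (rule Weierstrass_m_test)
    show "norm (f x ^ n /\<^sub>R fact n) \<le> B ^ n /\<^sub>R fact n" for n x
      using B(2)[of x] by (simp add: norm_power power_mono divide_right_mono field_simps)
    show "summable (\<lambda>n. B ^ n /\<^sub>R fact n)"
      by (rule summable_exp_generic)
  qed
  then have "\<forall>\<^sub>F n in sequentially. \<forall>x. dist (\<Sum>i<n. f x ^ i /\<^sub>R fact i) (exp (f x)) < e"
    using e by (simp add: uniform_limit_iff exp_def)
  then obtain n where n: "\<And>x. dist (\<Sum>i<n. f x ^ i /\<^sub>R fact i) (exp (f x)) < e"
    by (auto simp: eventually_sequentially)
  have "(\<lambda>x. \<Sum>i<n. f x ^ i /\<^sub>R fact i) \<in> A"
    unfolding scaleR_conv_of_real
    by (intro uniform_algebra_sum[OF A] uniform_algebra_cmult[OF A] uniform_algebra_power[OF A f]) auto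
  then show "\<exists>g\<in>A. \<forall>x. cmod (exp (f x) - g x) < e"
    using n by (intro bexI) (auto simp: dist_norm norm_minus_commute)
qed

text \<open>An additive group that contains the real parts of \<open>A\<close> but is in general no
  real vector space: integer multiples come from powers and inverses of \<open>h\<close>, whereas
  roots of \<open>h\<close> may be missing from \<open>A\<close>. This forces the rounding in
  \<open>hypo_Dirichlet_log_moduli\<close>.\<close>

definition log_moduli :: "('a \<Rightarrow> complex) set \<Rightarrow> ('a \<Rightarrow> real) set" where
  "log_moduli A = {w. \<exists>h\<in>A. \<exists>h'\<in>A. (\<forall>x. h x * h' x = 1) \<and> (\<forall>x. cmod (h x) = exp (w x))}"

lemma log_moduliI:
  "h \<in> A \<Longrightarrow> h' \<in> A \<Longrightarrow> (\<And>x. h x * h' x = 1) \<Longrightarrow> (\<And>x. cmod (h x) = exp (w x)) \<Longrightarrow> w \<in> log_moduli A"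
  unfolding log_moduli_def by blast

lemma log_moduli_add:
  assumes A: "uniform_algebra A" and "v \<in> log_moduli A" "w \<in> log_moduli A"
  shows "(\<lambda>x. v x + w x) \<in> log_moduli A"
proof -
  obtain h h' where h: "h \<in> A" "h' \<in> A" "\<And>x. h x * h' x = 1" "\<And>x. cmod (h x) = exp (v x)"
    using assms(2) unfolding log_moduli_def by blast
  obtain k k' where k: "k \<in> A" "k' \<in> A" "\<And>x. k x * k' x = 1" "\<And>x. cmod (k x) = exp (w x)"
    using assms(3) unfolding log_moduli_def by blast
  have "h x * k x * (h' x * k' x) = 1" for x
    using h(3)[of x] k(3)[of x] by (metis mult.assoc mult.left_commute mult_1)
  then show ?thesis
    using h k by (intro log_moduliI[of "\<lambda>x. h x * k x" A "\<lambda>x. h' x * k' x"])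
      (auto intro: uniform_algebraD[OF A] simp: norm_mult exp_add)
qed

lemma log_moduli_uminus:
  assumes "w \<in> log_moduli A"
  shows "(\<lambda>x. - w x) \<in> log_moduli A"
proof -
  obtain h h' where h: "h \<in> A" "h' \<in> A" "\<And>x. h x * h' x = 1" "\<And>x. cmod (h x) = exp (w x)"
    using assms unfolding log_moduli_def by blast
  have "cmod (h' x) = exp (- w x)" for x
    using arg_cong[OF h(3)[of x], of cmod] by (simp add: norm_mult h(4) exp_minus field_simps)
  then show ?thesis
    using h by (intro log_moduliI[of h' A h]) (auto simp: mult.commute)
qed

text \<open>The invertible element is \<open>exp f\<close>. As real multiples of \<open>f\<close>
  stay in \<open>A\<close>, coefficients of real parts never have to be rounded.\<close>

lemma log_moduli_real_parts:
  fixes A :: "('a::t2_space \<Rightarrow> complex) set"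
  assumes A: "uniform_algebra A" "compact (UNIV :: 'a set)" and f: "f \<in> A"
  shows "(\<lambda>x. Re (f x)) \<in> log_moduli A"
proof (rule log_moduliI)
  show "(\<lambda>x. exp (f x)) \<in> A" "(\<lambda>x. exp ((-1) * f x)) \<in> A"
    by (intro uniform_algebra_exp[OF A] uniform_algebra_cmult[OF A(1)] f)+
  show "exp (f x) * exp ((-1) * f x) = 1" for x
    by (simp flip: exp_add)
qed simp

lemma log_moduli_zero:
  "uniform_algebra A \<Longrightarrow> (\<lambda>x. 0) \<in> log_moduli A"
  by (rule log_moduliI[of "\<lambda>_. 1" A "\<lambda>_. 1"]) (auto intro: uniform_algebraD)

lemma log_moduli_of_int_mult:
  assumes A: "uniform_algebra A" and w: "w \<in> log_moduli A"
  shows "(\<lambda>x. of_int n * w x) \<in> log_moduli A"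
proof -
  have nat: "(\<lambda>x. of_nat k * w x) \<in> log_moduli A" for k
    by (induction k) (auto simp: distrib_right log_moduli_zero[OF A] intro: log_moduli_add[OF A] w)
  show ?thesis
    using nat log_moduli_uminus[OF nat] by (cases n rule: int_cases2) auto
qed

lemma log_moduli_sum:
  assumes A: "uniform_algebra A" and "finite S" "\<And>s. s \<in> S \<Longrightarrow> w s \<in> log_moduli A"
  shows "(\<lambda>x. \<Sum>s\<in>S. w s x) \<in> log_moduli A"
  using assms(2,3)
  by (induction S rule: finite_induct) (auto simp: log_moduli_zero[OF A] intro: log_moduli_add[OF A])

text \<open>In the approximation of a continuous function by the span of \<open>Re A\<close> and the finitely many
  \<open>log |f|\<close>, rounding the coefficients of the latter costs a uniformly bounded error and leaves the
  logarithm of the modulus of an invertible element.\<close>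

theorem hypo_Dirichlet_log_moduli:
  fixes A :: "('a::t2_space \<Rightarrow> complex) set"
  assumes cpt: "compact (UNIV :: 'a set)" and "hypo_Dirichlet A"
  shows "\<exists>K. \<forall>u. continuous_on UNIV u \<longrightarrow> (\<exists>w\<in>log_moduli A. \<forall>x. \<bar>u x - w x\<bar> \<le> K)"
proof -
  obtain F where A: "uniform_algebra A" and F: "finite F" "F \<subseteq> invertibles A"
    and dense: "\<And>u e. continuous_on UNIV u \<Longrightarrow> 0 < e \<Longrightarrow>
      \<exists>v\<in>real_linear_span (real_parts A \<union> (\<lambda>f x. ln (cmod (f x))) ` F). \<forall>x. \<bar>u x - v x\<bar> < e"
    using assms(2) unfolding hypo_Dirichlet_def by blast
  define G where "G = (\<lambda>f x. ln (cmod (f x))) ` F"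
  have "finite G" using F by (simp add: G_def)
  have G: "s \<in> log_moduli A \<and> (\<exists>B. 0 < B \<and> (\<forall>x. \<bar>s x\<bar> \<le> B))" if s: "s \<in> G" for s
  proof -
    obtain f where f: "f \<in> F" "s = (\<lambda>x. ln (cmod (f x)))"
      using s by (auto simp: G_def)
    then obtain g where g: "f \<in> A" "g \<in> A" "\<And>x. f x * g x = 1"
      using F(2) by (auto simp: invertibles_def)
    then have nz: "f x \<noteq> 0" for x by (metis mult_zero_left zero_neq_one)
    then have "continuous_on UNIV s"
      unfolding f(2) by (intro continuous_intros uniform_algebraD(1)[OF A g(1)]) auto
    then have "\<exists>B. 0 < B \<and> (\<forall>x. \<bar>s x\<bar> \<le> B)"
      using bounded_on_compact_space[OF cpt, of s] by (metis real_norm_def)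
    moreover have "s \<in> log_moduli A"
      using g nz by (intro log_moduliI[of f A g]) (auto simp: f(2))
    ultimately show ?thesis by blast
  qed
  then obtain B where B: "\<And>s. s \<in> G \<Longrightarrow> 0 < B s" "\<And>s x. s \<in> G \<Longrightarrow> \<bar>s x\<bar> \<le> B s"
    by metis
  \<comment> \<open>The 1 is the accuracy requested from density, and rounding the coefficient of
    \<open>s\<close> costs at most \<open>B s\<close>. Neither depends on \<open>u\<close>.\<close>
  have "\<exists>w\<in>log_moduli A. \<forall>x. \<bar>u x - w x\<bar> \<le> 1 + (\<Sum>s\<in>G. B s)" if u: "continuous_on UNIV u" for u
  proof -
    obtain v where v: "v \<in> real_linear_span (real_parts A \<union> G)" "\<And>x. \<bar>u x - v x\<bar> < 1"
      using dense[OF u, of 1] unfolding G_def by auto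
    then obtain T c where T: "finite T" "T \<subseteq> real_parts A \<union> G" "v = (\<lambda>x. \<Sum>s\<in>T. c s * s x)"
      by (auto simp: real_linear_span_def)
    \<comment> \<open>A function that is both a real part and one of the generators counts as a real
      part and keeps its coefficient.\<close>
    define T1 where "T1 = T \<inter> real_parts A"
    define T2 where "T2 = T - real_parts A"
    have T12: "finite T1" "finite T2" "T2 \<subseteq> G" "T = T1 \<union> T2" "T1 \<inter> T2 = {}" "T1 \<subseteq> real_parts A"
      using T by (auto simp: T1_def T2_def)
    define w where "w x = (\<Sum>s\<in>T1. c s * s x) + (\<Sum>s\<in>T2. of_int (round (c s)) * s x)" for x
    have "(\<lambda>x. c s * s x) \<in> log_moduli A" if s: "s \<in> T1" for s
    proof -
      obtain f where f: "f \<in> A" "s = (\<lambda>x. Re (f x))"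
        using s T12(6) by (auto simp: real_parts_def)
      show ?thesis
        using log_moduli_real_parts[OF A cpt uniform_algebra_cmult[OF A f(1), of "of_real (c s)"]]
        by (simp add: f(2))
    qed
    moreover have "(\<lambda>x. of_int (round (c s)) * s x) \<in> log_moduli A" if "s \<in> T2" for s
      using that T12 G by (intro log_moduli_of_int_mult[OF A]) auto
    ultimately have "w \<in> log_moduli A"
      unfolding w_def using T12 by (intro log_moduli_add[OF A] log_moduli_sum[OF A]) auto
    moreover have "\<bar>u x - w x\<bar> \<le> 1 + (\<Sum>s\<in>G. B s)" for x
    proof -
      have "v x - w x = (\<Sum>s\<in>T2. (c s - of_int (round (c s))) * s x)"
        using T12 by (simp add: T(3) w_def sum.union_disjoint left_diff_distrib sum_subtractf)
      also have "\<bar>\<dots>\<bar> \<le> (\<Sum>s\<in>T2. \<bar>(c s - of_int (round (c s))) * s x\<bar>)"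
        by (rule sum_abs)
      also have "\<dots> \<le> (\<Sum>s\<in>T2. B s)"
      proof (rule sum_mono)
        fix s assume s: "s \<in> T2"
        have "\<bar>c s - of_int (round (c s))\<bar> \<le> 1"
          using of_int_round_abs_le[of "c s"] by (simp add: abs_minus_commute)
        then have "\<bar>c s - of_int (round (c s))\<bar> * \<bar>s x\<bar> \<le> 1 * B s"
          using s T12 B by (intro mult_mono) auto
        then show "\<bar>(c s - of_int (round (c s))) * s x\<bar> \<le> B s"
          by (simp add: abs_mult)
      qed
      also have "\<dots> \<le> (\<Sum>s\<in>G. B s)"
        using T12 \<open>finite G\<close> B(1) by (intro sum_mono2) (auto intro: less_imp_le)
      finally show ?thesis using v(2)[of x] by linarith
    qed
    ultimately show ?thesis by blast
  qed
  then show ?thesis by blast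
qed

section \<open>Multipliers and point evaluations\<close>

locale uniform_algebra_measure =
  fixes A :: "('a::t2_space \<Rightarrow> complex) set" and m :: "'a measure"
  assumes cpt: "compact (UNIV :: 'a set)" and A: "uniform_algebra A"
    and fin: "finite_measure m" and sets: "sets m = sets borel"
begin

sublocale finite_measure m by (rule fin)

sublocale L2: hilbert_space "L2 m" by (rule hilbert_space_L2[OF fin])

abbreviation cls where "cls \<equiv> ae_class m"

abbreviation HH where "HH \<equiv> H2 A m"

section \<open>The algebra inside \<open>L2 m\<close> and its closure H^2\<close>

lemma measurable_A [measurable_dest]: "f \<in> A \<Longrightarrow> f \<in> borel_measurable m"
  using borel_measurable_continuous_onI[OF uniform_algebraD(1)[OF A]] measurable_cong_sets[OF sets refl]
  by blast

lemma bounded_A: "f \<in> A \<Longrightarrow> \<exists>B>0. \<forall>x. cmod (f x) \<le> B"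
  using bounded_on_compact_space[OF cpt uniform_algebraD(1)[OF A]] by metis

lemma square_integrable_A: "f \<in> A \<Longrightarrow> square_integrable m f"
proof -
  assume f: "f \<in> A"
  obtain B where B: "\<And>x. cmod (f x) \<le> B" using bounded_A[OF f] by blast
  show ?thesis
    by (rule square_integrable_bound[of _ _ "\<lambda>_. B\<^sup>2"]) (use f B in \<open>auto intro!: power_mono measurable_A\<close>)
qed

lemma cls_A_subset: "cls ` A \<subseteq> vectors (L2 m)"
  using square_integrable_A by blast

lemma H2_simps [simp]:
  "vectors HH = hclosure (L2 m) (cls ` A)" "hzero HH = hzero (L2 m)" "hadd HH = hadd (L2 m)"
  "hscale HH = hscale (L2 m)" "hinner HH = hinner (L2 m)" "hnorm HH = hnorm (L2 m)" "hdist HH = hdist (L2 m)"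
  by (simp_all add: H2_def hdist_def hnorm_def fun_eq_iff)

lemma closed_subspace_H2: "closed_subspace (L2 m) (vectors HH)"
  unfolding H2_simps
proof (rule L2.closed_subspace_hclosure[OF cls_A_subset])
  show "hzero (L2 m) \<in> cls ` A"
    unfolding hzero_L2 using uniform_algebraD(2)[OF A, of 0] by blast
  show "hadd (L2 m) x y \<in> cls ` A" if xy: "x \<in> cls ` A" "y \<in> cls ` A" for x y
  proof -
    obtain f g where "f \<in> A" "g \<in> A" "x = cls f" "y = cls g" using xy by blast
    then show ?thesis
      using uniform_algebraD(3)[OF A] by (simp add: hadd_L2_ae_class measurable_A)
  qed
  show "hscale (L2 m) c x \<in> cls ` A" if x: "x \<in> cls ` A" for c x
  proof -
    obtain f where "f \<in> A" "x = cls f" using x by blast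
    then show ?thesis
      using uniform_algebra_cmult[OF A] by (simp add: hscale_L2_ae_class measurable_A)
  qed
qed

sublocale H2: hilbert_space HH
  using L2.hilbert_space_subspace[OF closed_subspace_H2] by (simp add: H2_def)

lemma cls_mem_H2: "f \<in> A \<Longrightarrow> cls f \<in> vectors HH"
  using L2.subset_hclosure[OF cls_A_subset] by auto

lemma mem_H2_L2: "F \<in> vectors HH \<Longrightarrow> F \<in> vectors (L2 m)"
  using closed_subspace_H2 by (auto simp: closed_subspace_def)

lemma approx_A:
  assumes "F \<in> vectors HH" "0 < e"
  shows "\<exists>p\<in>A. hdist HH F (cls p) < e"
  using L2.hclosureD[of F "cls ` A" e] assms by auto

text \<open>An unrestricted form of \<open>mult_op\<close>, meaningful on all of
  \<open>L2 m\<close>: products can be estimated before they are known to lie in H^2.\<close>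

definition mult :: "('a \<Rightarrow> complex) \<Rightarrow> ('a \<Rightarrow> complex) set \<Rightarrow> ('a \<Rightarrow> complex) set" where
  "mult h F = ae_lift2 m (*) (cls h) F"

lemma mult_cls:
  "h \<in> borel_measurable m \<Longrightarrow> f \<in> borel_measurable m \<Longrightarrow> mult h (cls f) = cls (\<lambda>x. h x * f x)"
  by (simp add: mult_def ae_lift2_ae_class)

lemma L2_E:
  assumes "F \<in> vectors (L2 m)"
  obtains f where "square_integrable m f" "f \<in> borel_measurable m" "F = cls f"
  using assms by (auto simp: vectors_L2 square_integrable_def)

lemma mult_linear:
  assumes h: "h \<in> borel_measurable m" and "F \<in> vectors (L2 m)" "G \<in> vectors (L2 m)"
  shows "mult h (hadd (L2 m) F G) = hadd (L2 m) (mult h F) (mult h G)"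
    and "mult h (hscale (L2 m) c F) = hscale (L2 m) c (mult h F)"
proof -
  obtain f where f: "f \<in> borel_measurable m" "F = cls f" using L2_E[OF assms(2)] by blast
  obtain g where g: "g \<in> borel_measurable m" "G = cls g" using L2_E[OF assms(3)] by blast
  note [measurable] = f(1) g(1) h
  show "mult h (hadd (L2 m) F G) = hadd (L2 m) (mult h F) (mult h G)"
    by (simp add: f(2) g(2) hadd_L2_ae_class mult_cls distrib_left)
  show "mult h (hscale (L2 m) c F) = hscale (L2 m) c (mult h F)"
    by (simp add: f(2) hscale_L2_ae_class mult_cls mult.left_commute)
qed

lemma mult_bounded:
  assumes h: "h \<in> borel_measurable m" "AE x in m. cmod (h x) \<le> C" "0 \<le> C" and F: "F \<in> vectors (L2 m)"
  shows "mult h F \<in> vectors (L2 m)" "hnorm (L2 m) (mult h F) \<le> C * hnorm (L2 m) F"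
proof -
  obtain f where f: "square_integrable m f" "f \<in> borel_measurable m" "F = cls f" using L2_E[OF F] by blast
  note [measurable] = f(2) h(1)
  note * = square_integrable_bounded_mult[OF f(1) h(1,2)]
  show "mult h F \<in> vectors (L2 m)"
    using *(1) by (auto simp: f(3) mult_cls)
  have "sqrt (\<integral>x. (cmod (h x * f x))\<^sup>2 \<partial>m) \<le> sqrt (C\<^sup>2 * (\<integral>x. (cmod (f x))\<^sup>2 \<partial>m))"
    using *(2) by simp
  then show "hnorm (L2 m) (mult h F) \<le> C * hnorm (L2 m) F"
    using h(3) by (simp add: f(3) mult_cls hnorm_L2_ae_class real_sqrt_mult)
qed

lemma mult_dist_le:
  assumes h: "h \<in> borel_measurable m" "AE x in m. cmod (h x) \<le> C" "0 \<le> C"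
    and F: "F \<in> vectors (L2 m)" "G \<in> vectors (L2 m)"
  shows "hdist (L2 m) (mult h F) (mult h G) \<le> C * hdist (L2 m) F G"
proof -
  have "hadd (L2 m) (mult h F) (hscale (L2 m) (-1) (mult h G)) = mult h (hadd (L2 m) F (hscale (L2 m) (-1) G))"
    using F by (simp add: mult_linear[OF h(1)])
  then show ?thesis
    unfolding hdist_def using mult_bounded(2)[OF h] F by simp
qed

section \<open>Multiplication by functions in the weak-star closure preserves H^2\<close>

definition Hinf_fun :: "('a \<Rightarrow> complex) \<Rightarrow> bool" where
  "Hinf_fun h \<longleftrightarrow> h \<in> borel_measurable m \<and> (\<exists>C. AE x in m. cmod (h x) \<le> C) \<and>
     (\<forall>G. finite G \<and> (\<forall>g\<in>G. integrable m g) \<longrightarrow>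
        (\<forall>e>0. \<exists>a\<in>A. \<forall>g\<in>G. cmod ((\<integral>x. h x * g x \<partial>m) - (\<integral>x. a x * g x \<partial>m)) < e))"

lemma Hinf_eq: "Hinf A m = cls ` {h. Hinf_fun h}"
  by (simp add: Hinf_def Hinf_fun_def)

lemma Hinf_fun_A: "a \<in> A \<Longrightarrow> Hinf_fun a"
  unfolding Hinf_fun_def using measurable_A bounded_A[of a] by (auto intro!: bexI[of _ a] AE_I2)

lemma Hinf_fun_bound:
  assumes "Hinf_fun h"
  obtains C where "h \<in> borel_measurable m" "AE x in m. cmod (h x) \<le> C" "0 \<le> C"
proof -
  obtain C where C: "AE x in m. cmod (h x) \<le> C" using assms by (auto simp: Hinf_fun_def)
  have "AE x in m. cmod (h x) \<le> \<bar>C\<bar>" using C by eventually_elim simp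
  then show thesis using assms that[of "\<bar>C\<bar>"] by (auto simp: Hinf_fun_def)
qed

text \<open>For \<open>g \<in> A\<close> the component \<open>r\<close> of \<open>h g\<close> orthogonal to \<open>H\<^sup>2\<close> vanishes, because
  \<open>g \<cdot> cnj r\<close> is integrable and every \<open>a \<in> A\<close> has \<open>\<integral> a g cnj r = 0\<close>.\<close>

lemma mult_Hinf_A_mem_H2:
  assumes h: "Hinf_fun h" and g: "g \<in> A"
  shows "mult h (cls g) \<in> vectors HH"
proof -
  obtain C where C: "h \<in> borel_measurable m" "AE x in m. cmod (h x) \<le> C" "0 \<le> C"
    using Hinf_fun_bound[OF h] .
  note gm [measurable] = measurable_A[OF g] C(1)
  define u where "u x = h x * g x" for x
  have u: "square_integrable m u"
    unfolding u_def by (rule square_integrable_bounded_mult(1)[OF square_integrable_A[OF g] C(1,2)])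
  note [measurable] = square_integrable_measurable[OF u]
  have uL: "cls u \<in> vectors (L2 m)" using u by blast
  obtain y where y: "y \<in> vectors HH"
    and orth: "\<And>w. w \<in> vectors HH \<Longrightarrow> hinner (L2 m) (hadd (L2 m) (cls u) (hscale (L2 m) (-1) y)) w = 0"
    using L2.orthogonal_projection[OF closed_subspace_H2 uL] by blast
  have yL: "y \<in> vectors (L2 m)" by (rule mem_H2_L2[OF y])
  let ?R = "hadd (L2 m) (cls u) (hscale (L2 m) (-1) y)"
  have RL: "?R \<in> vectors (L2 m)" using uL yL by auto
  obtain r where r: "square_integrable m r" "r \<in> borel_measurable m" "?R = cls r" using L2_E[OF RL] by blast
  note [measurable] = r(2)
  have gr: "integrable m (\<lambda>x. g x * cnj (r x))"
    by (rule integrable_mult_cnj[OF square_integrable_A[OF g] r(1)])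
  have a0: "(\<integral>x. a x * (g x * cnj (r x)) \<partial>m) = 0" if a: "a \<in> A" for a
  proof -
    note [measurable] = measurable_A[OF a]
    have ag: "(\<lambda>x. a x * g x) \<in> A" by (rule uniform_algebraD(4)[OF A a g])
    have "hinner (L2 m) (cls r) (cls (\<lambda>x. a x * g x)) = 0"
      using orth[OF cls_mem_H2[OF ag]] r(3) by simp
    then have "hinner (L2 m) (cls (\<lambda>x. a x * g x)) (cls r) = 0"
      using L2.inner_commute[of "cls (\<lambda>x. a x * g x)" "cls r"] RL r(3) mem_H2_L2[OF cls_mem_H2[OF ag]] by simp
    then show ?thesis
      by (subst (asm) hinner_L2_ae_class) (simp_all add: mult.assoc)
  qed
  have "(\<integral>x. h x * (g x * cnj (r x)) \<partial>m) = 0"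
  proof (rule ccontr)
    assume nz: "(\<integral>x. h x * (g x * cnj (r x)) \<partial>m) \<noteq> 0"
    have approx: "\<exists>a\<in>A. \<forall>g\<in>G. cmod ((\<integral>x. h x * g x \<partial>m) - (\<integral>x. a x * g x \<partial>m)) < e"
      if "finite G" "\<forall>g\<in>G. integrable m g" "0 < e" for G e
      using h that unfolding Hinf_fun_def by blast
    \<comment> \<open>Weak-star approximation is tested on one function, with the modulus of the
      integral itself as radius; by \<open>a0\<close> the approximant contributes 0.\<close>
    obtain a where "a \<in> A"
      "cmod ((\<integral>x. h x * (g x * cnj (r x)) \<partial>m) - (\<integral>x. a x * (g x * cnj (r x)) \<partial>m))
        < cmod (\<integral>x. h x * (g x * cnj (r x)) \<partial>m)"
      using approx[of "{\<lambda>x. g x * cnj (r x)}" "cmod (\<integral>x. h x * (g x * cnj (r x)) \<partial>m)"] gr nz by auto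
    then show False using a0 by simp
  qed
  then have ur: "hinner (L2 m) (cls u) (cls r) = 0"
    by (subst hinner_L2_ae_class) (simp_all add: u_def mult.assoc)
  \<comment> \<open>\<open>cls r\<close> is the difference of \<open>cls u\<close> and
    \<open>y\<close>; being orthogonal to both, it is orthogonal to itself.\<close>
  have "hinner (L2 m) y (cls r) = 0"
    using L2.inner_commute[OF yL RL] orth[OF y] unfolding r(3) by simp
  moreover have "cls r \<in> vectors (L2 m)" using r(1) by blast
  ultimately have "hinner (L2 m) ?R (cls r) = 0"
    using ur uL yL by simp
  then have "hdist (L2 m) (cls u) y = 0"
    unfolding hdist_def hnorm_def r(3) by simp
  then have "cls u = y" by (rule L2.dist_eq_0D[OF uL yL])
  moreover have "mult h (cls g) = cls u"
    unfolding u_def by (rule mult_cls) measurable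
  ultimately show ?thesis using y by (simp only:)
qed

text \<open>Multiplication by a bounded function is Lipschitz on \<open>L2 m\<close>, so the case of
  elements of \<open>A\<close> extends to their closure. The radius is divided by
  \<open>C + 1\<close> since \<open>C\<close> may be 0.\<close>

lemma mult_Hinf_mem_H2:
  assumes h: "Hinf_fun h" and F: "F \<in> vectors HH"
  shows "mult h F \<in> vectors HH"
proof -
  obtain C where C: "h \<in> borel_measurable m" "AE x in m. cmod (h x) \<le> C" "0 \<le> C"
    using Hinf_fun_bound[OF h] .
  have FL: "F \<in> vectors (L2 m)" by (rule mem_H2_L2[OF F])
  have "mult h F \<in> hclosure (L2 m) (vectors HH)"
  proof (rule L2.hclosureI)
    show "mult h F \<in> vectors (L2 m)" by (rule mult_bounded(1)[OF C FL])
    fix e :: real assume e: "0 < e"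
    then obtain p where p: "p \<in> A" "hdist HH F (cls p) < e / (C + 1)"
      using approx_A[OF F, of "e / (C + 1)"] C(3) by auto
    have pL: "cls p \<in> vectors (L2 m)" by (rule mem_H2_L2[OF cls_mem_H2[OF p(1)]])
    have "hdist (L2 m) (mult h F) (mult h (cls p)) \<le> C * hdist (L2 m) F (cls p)"
      by (rule mult_dist_le[OF C FL pL])
    also have "\<dots> \<le> (C + 1) * hdist (L2 m) F (cls p)"
      using FL pL by (intro mult_right_mono) auto
    also have "\<dots> < e"
      using p(2) C(3) by (simp add: field_simps)
    finally show "\<exists>s\<in>vectors HH. hdist (L2 m) (mult h F) s < e"
      using mult_Hinf_A_mem_H2[OF h p(1)] by blast
  qed
  then show ?thesis using closed_subspace_H2 unfolding closed_subspace_def by blast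
qed

lemma mult_op_apply: "F \<in> vectors HH \<Longrightarrow> mult_op A m (cls h) F = mult h F"
  by (simp add: mult_op_def mult_def)

lemma mult_op_bounded:
  assumes h: "Hinf_fun h"
  shows "mult_op A m (cls h) \<in> bounded_ops HH"
proof -
  obtain C where C: "h \<in> borel_measurable m" "AE x in m. cmod (h x) \<le> C" "0 \<le> C"
    using Hinf_fun_bound[OF h] .
  have 1: "mult_op A m (cls h) \<in> vectors HH \<rightarrow>\<^sub>E vectors HH"
    unfolding mult_op_def
    by (rule restrict_PiE_iff[THEN iffD2]) (use mult_Hinf_mem_H2[OF h, unfolded mult_def] in blast)
  have 2: "hnorm HH (mult_op A m (cls h) F) \<le> C * hnorm HH F" if F: "F \<in> vectors HH" for F
    unfolding mult_op_apply[OF F] H2_simps by (rule mult_bounded(2)[OF C mem_H2_L2[OF F]])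
  have 3: "mult_op A m (cls h) (hadd HH F G) = hadd HH (mult_op A m (cls h) F) (mult_op A m (cls h) G)"
    if F: "F \<in> vectors HH" and G: "G \<in> vectors HH" for F G
    unfolding mult_op_apply[OF F] mult_op_apply[OF G] mult_op_apply[OF H2.add_mem[OF F G]]
    unfolding H2_simps by (rule mult_linear(1)[OF C(1) mem_H2_L2[OF F] mem_H2_L2[OF G]])
  have 4: "mult_op A m (cls h) (hscale HH c F) = hscale HH c (mult_op A m (cls h) F)"
    if F: "F \<in> vectors HH" for F c
    unfolding mult_op_apply[OF F] mult_op_apply[OF H2.scale_mem[OF F]]
    unfolding H2_simps by (rule mult_linear(2)[OF C(1) mem_H2_L2[OF F] mem_H2_L2[OF F]])
  show ?thesis
    unfolding bounded_ops_def using 1 2 3 4 by (intro CollectI conjI ballI allI exI[of _ C])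
qed

lemma mult_A_mem_H2: "a \<in> A \<Longrightarrow> F \<in> vectors HH \<Longrightarrow> mult a F \<in> vectors HH"
  by (rule mult_Hinf_mem_H2[OF Hinf_fun_A])

lemma mult_A_norm_le:
  assumes "a \<in> A" "\<And>x. cmod (a x) \<le> C" "0 \<le> C" "F \<in> vectors HH"
  shows "hnorm HH (mult a F) \<le> C * hnorm HH F"
  unfolding H2_simps
  by (rule mult_bounded(2)[OF measurable_A[OF assms(1)] _ assms(3) mem_H2_L2[OF assms(4)]]) (simp add: assms(2))

end

section \<open>Bounded point evaluations\<close>

lemma bounded_functional_bound:
  assumes "bounded_functional H L"
  shows "\<exists>B>0. \<forall>x\<in>vectors H. 0 \<le> hnorm H x \<longrightarrow> cmod (L x) \<le> B * hnorm H x"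
proof -
  obtain C where C: "\<And>x. x \<in> vectors H \<Longrightarrow> cmod (L x) \<le> C * hnorm H x"
    using assms unfolding bounded_functional_def by blast
  \<comment> \<open>\<open>H\<close> is an arbitrary record here, so nonnegativity of
    \<open>hnorm\<close> enters as a side condition; the 1 makes the constant positive.\<close>
  have "cmod (L x) \<le> (\<bar>C\<bar> + 1) * hnorm H x" if "x \<in> vectors H" "0 \<le> hnorm H x" for x
  proof -
    have "C * hnorm H x \<le> (\<bar>C\<bar> + 1) * hnorm H x"
      using that(2) by (intro mult_right_mono) auto
    then show ?thesis using C[OF that(1)] by linarith
  qed
  then show ?thesis by (intro exI[of _ "\<bar>C\<bar> + 1"]) auto
qed

text \<open>One point \<open>\<psi>\<close> of the reproducing kernel structure is kept fixed, with
  \<open>L\<close> as its bounded extension to H^2.\<close>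

locale H2_evaluation = uniform_algebra_measure +
  fixes \<psi> and L
  assumes \<psi>: "mult_functional A \<psi>" and L: "bounded_functional (H2 A m) L"
    and L_cls: "\<And>f. f \<in> A \<Longrightarrow> L (ae_class m f) = \<psi> f"
begin

lemma L_add: "F \<in> vectors HH \<Longrightarrow> G \<in> vectors HH \<Longrightarrow> L (hadd HH F G) = L F + L G"
  using L unfolding bounded_functional_def by blast

lemma L_scale: "F \<in> vectors HH \<Longrightarrow> L (hscale HH c F) = c * L F"
  using L unfolding bounded_functional_def by blast

lemma L_diff: "F \<in> vectors HH \<Longrightarrow> G \<in> vectors HH \<Longrightarrow> L (hadd HH F (hscale HH (-1) G)) = L F - L G"
  using L_add[of F "hscale HH (-1) G"] L_scale[of G "-1"] H2.scale_mem[of G "-1"] by (simp only:) simp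

lemma L_bound:
  "\<exists>B>0. (\<forall>F\<in>vectors HH. cmod (L F) \<le> B * hnorm HH F) \<and>
    (\<forall>F\<in>vectors HH. \<forall>G\<in>vectors HH. cmod (L F - L G) \<le> B * hdist HH F G)"
proof -
  obtain B where "0 < B" and B: "\<forall>F\<in>vectors HH. 0 \<le> hnorm HH F \<longrightarrow> cmod (L F) \<le> B * hnorm HH F"
    using bounded_functional_bound[OF L] by blast
  have 1: "cmod (L F) \<le> B * hnorm HH F" if "F \<in> vectors HH" for F
    using B H2.norm_ge_0[OF that] that by blast
  have "cmod (L F - L G) \<le> B * hdist HH F G" if FG: "F \<in> vectors HH" "G \<in> vectors HH" for F G
  proof -
    have "hadd HH F (hscale HH (-1) G) \<in> vectors HH" using FG by (intro H2.add_mem H2.scale_mem)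
    from 1[OF this] show ?thesis unfolding hdist_def L_diff[OF FG] .
  qed
  with 1 \<open>0 < B\<close> show ?thesis by blast
qed

lemma \<psi>_mult: "f \<in> A \<Longrightarrow> g \<in> A \<Longrightarrow> \<psi> (\<lambda>x. f x * g x) = \<psi> f * \<psi> g"
  using \<psi> unfolding mult_functional_def by blast

lemma \<psi>_cmult: "f \<in> A \<Longrightarrow> \<psi> (\<lambda>x. c * f x) = c * \<psi> f"
  using \<psi> unfolding mult_functional_def by blast

lemma \<psi>_one: "\<psi> (\<lambda>x. 1) = 1"
proof -
  obtain f where "f \<in> A" "\<psi> f \<noteq> 0" using \<psi> unfolding mult_functional_def by blast
  then show ?thesis
    using \<psi>_mult[OF uniform_algebraD(2)[OF A, of 1], of f] by simp
qed

text \<open>For classes of elements of \<open>A\<close> this is multiplicativity of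
  \<open>\<psi>\<close>; both sides are Lipschitz in \<open>F\<close>, and such classes are
  dense.\<close>

lemma L_mult:
  assumes a: "a \<in> A" and F: "F \<in> vectors HH"
  shows "L (mult a F) = \<psi> a * L F"
proof (rule ccontr)
  assume ne: "L (mult a F) \<noteq> \<psi> a * L F"
  obtain B where B: "0 < B" "\<And>F G. F \<in> vectors HH \<Longrightarrow> G \<in> vectors HH \<Longrightarrow> cmod (L F - L G) \<le> B * hdist HH F G"
    using L_bound by blast
  obtain C where C: "0 < C" "\<And>x. cmod (a x) \<le> C" using bounded_A[OF a] by blast
  \<comment> \<open>A Lipschitz constant for the difference of the two sides: \<open>B * C\<close>
    for the left one, \<open>cmod (\<psi> a) * B\<close> for the right one.\<close>
  define K where "K = B * C + cmod (\<psi> a) * B"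
  have K: "0 < K" using B(1) C(1) by (simp add: K_def add_pos_nonneg)
  define e where "e = cmod (L (mult a F) - \<psi> a * L F)"
  have e: "0 < e" using ne by (simp add: e_def)
  obtain p where p: "p \<in> A" "hdist HH F (cls p) < e / K"
    using approx_A[OF F, of "e / K"] e K by auto
  note pH = cls_mem_H2[OF p(1)]
  have "mult a (cls p) = cls (\<lambda>x. a x * p x)"
    by (rule mult_cls[OF measurable_A[OF a] measurable_A[OF p(1)]])
  then have Lp: "L (mult a (cls p)) = \<psi> a * L (cls p)"
    using uniform_algebraD(4)[OF A a p(1)] by (simp add: L_cls \<psi>_mult a p(1))
  have "hdist HH (mult a F) (mult a (cls p)) \<le> C * hdist HH F (cls p)"
    unfolding H2_simps using C
    by (intro mult_dist_le measurable_A a mem_H2_L2[OF F] mem_H2_L2[OF pH]) auto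
  then have "cmod (L (mult a F) - L (mult a (cls p))) \<le> B * (C * hdist HH F (cls p))"
    using B(2)[OF mult_A_mem_H2[OF a F] mult_A_mem_H2[OF a pH]] B(1)
    by (meson mult_left_mono less_imp_le order_trans)
  moreover have "cmod (\<psi> a * L (cls p) - \<psi> a * L F) \<le> cmod (\<psi> a) * (B * hdist HH F (cls p))"
    using B(2)[OF F pH] by (simp add: norm_mult norm_minus_commute mult_left_mono flip: right_diff_distrib)
  moreover have "e \<le> cmod (L (mult a F) - L (mult a (cls p))) + cmod (\<psi> a * L (cls p) - \<psi> a * L F)"
    unfolding e_def Lp
    using norm_triangle_ineq[of "L (mult a F) - \<psi> a * L (cls p)" "\<psi> a * L (cls p) - \<psi> a * L F"] by simp
  ultimately have "e \<le> K * hdist HH F (cls p)"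
    by (simp add: K_def algebra_simps)
  also have "\<dots> < e" using p(2) K by (simp add: field_simps)
  finally show False by simp
qed

end

section \<open>Normalised multipliers and evaluation on a graph\<close>

context uniform_algebra_measure
begin

lemma mult_A_dist_le:
  assumes "a \<in> A" "\<And>x. cmod (a x) \<le> C" "0 \<le> C" "F \<in> vectors HH" "G \<in> vectors HH"
  shows "hdist HH (mult a F) (mult a G) \<le> C * hdist HH F G"
  unfolding H2_simps
  by (rule mult_dist_le[OF measurable_A[OF assms(1)] _ assms(3) mem_H2_L2[OF assms(4)] mem_H2_L2[OF assms(5)]])
    (simp add: assms(2))

text \<open>The bound sees \<open>p\<close> and \<open>q\<close> only through their norms in H^2,
  never through their sup norms; this is the source of the uniformity of the multipliers. The factor
  3 comes from \<open>(1 + a + b)^2 <= 3 * (1 + a^2 + b^2)\<close>.\<close>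

lemma hnorm_cls_le_of_modulus_le:
  assumes "h \<in> A" "p \<in> A" "q \<in> A" and h: "\<And>x. cmod (h x) \<le> E * (1 + cmod (p x) + cmod (q x))"
    and R: "hnorm HH (cls p) \<le> R" "hnorm HH (cls q) \<le> R"
  shows "hnorm HH (cls h) \<le> sqrt (3 * E\<^sup>2 * (measure m (space m) + 2 * R\<^sup>2))"
proof -
  note sq = square_integrable_A[OF assms(1)] square_integrable_A[OF assms(2)] square_integrable_A[OF assms(3)]
  note norm = hnorm_L2_ae_class[OF square_integrable_measurable]
  have R2: "(\<integral>x. (cmod (f x))\<^sup>2 \<partial>m) \<le> R\<^sup>2" if "square_integrable m f" "hnorm HH (cls f) \<le> R" for f
  proof -
    have "(sqrt (\<integral>x. (cmod (f x))\<^sup>2 \<partial>m))\<^sup>2 \<le> R\<^sup>2"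
      using that by (intro power_mono) (auto simp: norm)
    then show ?thesis by simp
  qed
  have "(cmod (h x))\<^sup>2 \<le> 3 * E\<^sup>2 * (1 + (cmod (p x))\<^sup>2 + (cmod (q x))\<^sup>2)" for x
  proof -
    have "(cmod (h x))\<^sup>2 \<le> (E * (1 + cmod (p x) + cmod (q x)))\<^sup>2"
      by (intro power_mono h) simp
    also have "\<dots> = E\<^sup>2 * (1 + cmod (p x) + cmod (q x))\<^sup>2"
      by (simp add: power_mult_distrib)
    also have "\<dots> \<le> E\<^sup>2 * (3 * (1 + (cmod (p x))\<^sup>2 + (cmod (q x))\<^sup>2))"
    proof (rule mult_left_mono)
      show "(1 + cmod (p x) + cmod (q x))\<^sup>2 \<le> 3 * (1 + (cmod (p x))\<^sup>2 + (cmod (q x))\<^sup>2)"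
      proof -
      have "0 \<le> (1 - cmod (p x))\<^sup>2 + (1 - cmod (q x))\<^sup>2 + (cmod (p x) - cmod (q x))\<^sup>2" by simp
      then show ?thesis by (simp add: power2_eq_square algebra_simps)
      qed
    qed simp
    finally show ?thesis by (simp only: mult_ac)
  qed
  then have "(\<integral>x. (cmod (h x))\<^sup>2 \<partial>m) \<le> (\<integral>x. 3 * E\<^sup>2 * (1 + (cmod (p x))\<^sup>2 + (cmod (q x))\<^sup>2) \<partial>m)"
    using sq by (intro integral_mono) (auto simp: square_integrable_def)
  also have "\<dots> = 3 * E\<^sup>2 * (measure m (space m) + (\<integral>x. (cmod (p x))\<^sup>2 \<partial>m) + (\<integral>x. (cmod (q x))\<^sup>2 \<partial>m))"
    using sq by (simp add: square_integrable_def)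
  also have "\<dots> \<le> 3 * E\<^sup>2 * (measure m (space m) + 2 * R\<^sup>2)"
    using R2[OF sq(2) R(1)] R2[OF sq(3) R(2)] by (intro mult_left_mono) auto
  finally show ?thesis
    by (simp add: norm[OF sq(1)])
qed

end

context H2_evaluation
begin

text \<open>The multiplier \<open>k\<close> is \<open>\<psi> h \<cdot> h'\<close>, where \<open>h'\<close> is the inverse of \<open>h\<close> and
  \<open>|h|\<close> is comparable with \<open>1 + |p| + |q|\<close>. Boundedness of \<open>\<psi>\<close> on \<open>H\<^sup>2\<close> controls \<open>\<psi> h\<close>, uniformly in
  \<open>p\<close> and \<open>q\<close>.\<close>

lemma exists_normalized_multiplier:
  assumes K: "\<And>u. continuous_on UNIV u \<Longrightarrow> \<exists>w\<in>log_moduli A. \<forall>x. \<bar>u x - w x\<bar> \<le> K"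
  shows "\<exists>C>0. \<forall>p\<in>A. \<forall>q\<in>A. hnorm HH (cls p) \<le> R \<longrightarrow> hnorm HH (cls q) \<le> R \<longrightarrow>
    (\<exists>k\<in>A. \<psi> k = 1 \<and> (\<forall>x. cmod (k x * p x) \<le> C) \<and> (\<forall>x. cmod (k x * q x) \<le> C))"
proof -
  obtain B where B: "0 < B" "\<And>F. F \<in> vectors HH \<Longrightarrow> cmod (L F) \<le> B * hnorm HH F"
    using L_bound by blast
  define S where "S = sqrt (3 * (exp K)\<^sup>2 * (measure m (space m) + 2 * R\<^sup>2))"
  have "0 \<le> S" by (simp add: S_def)
  \<comment> \<open>\<open>B * S\<close> bounds the value of \<open>\<psi>\<close> at
    \<open>h\<close>, and \<open>exp K\<close> bounds the inverse of \<open>h\<close> times anything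
    dominated by \<open>s\<close>; the 1 makes \<open>C\<close> positive.\<close>
  define C where "C = B * S * exp K + 1"
  have C: "0 < C" using B(1) \<open>0 \<le> S\<close> by (simp add: C_def add_nonneg_pos)
  have "\<exists>k\<in>A. \<psi> k = 1 \<and> (\<forall>x. cmod (k x * p x) \<le> C) \<and> (\<forall>x. cmod (k x * q x) \<le> C)"
    if p: "p \<in> A" and q: "q \<in> A" and R: "hnorm HH (cls p) \<le> R" "hnorm HH (cls q) \<le> R" for p q
  proof -
    \<comment> \<open>The summand 1 keeps \<open>s\<close> away from 0, so that
      \<open>ln (s x)\<close> is continuous even where \<open>p\<close> and \<open>q\<close> vanish
      together.\<close>
    define s where "s x = 1 + cmod (p x) + cmod (q x)" for x
    have s: "1 \<le> s x" "cmod (p x) \<le> s x" "cmod (q x) \<le> s x" for x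
      by (auto simp: s_def)
    have s0: "0 < s x" for x using s(1)[of x] by linarith
    have "s x \<noteq> 0" for x using s0[of x] by simp
    moreover have "continuous_on UNIV s"
      unfolding s_def by (intro continuous_intros uniform_algebraD(1)[OF A] p q)
    ultimately have "continuous_on UNIV (\<lambda>x. ln (s x))"
      by (intro continuous_on_ln) auto
    from K[OF this] obtain w where w: "w \<in> log_moduli A" "\<And>x. \<bar>ln (s x) - w x\<bar> \<le> K" by blast
    obtain h h' where h: "h \<in> A" "h' \<in> A" "\<And>x. h x * h' x = 1" "\<And>x. cmod (h x) = exp (w x)"
      using w(1) unfolding log_moduli_def by blast
    have h_le: "cmod (h x) \<le> exp K * s x" for x
    proof -
      have "exp (w x) \<le> exp (K + ln (s x))" using w(2)[of x] by simp
      then show ?thesis using s0[of x] by (simp add: h(4) exp_add)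
    qed
    have h'_le: "cmod (h' x) * s x \<le> exp K" for x
    proof -
      have "s x = exp (ln (s x))" using s0[of x] by simp
      also have "\<dots> \<le> exp (K + w x)" using w(2)[of x] by simp
      also have "\<dots> = exp K * cmod (h x)" by (simp add: exp_add h(4))
      finally have "cmod (h' x) * s x \<le> cmod (h' x) * (exp K * cmod (h x))"
        by (rule mult_left_mono) simp
      also have "\<dots> = exp K * cmod (h x * h' x)" by (simp add: norm_mult)
      finally show ?thesis by (simp add: h(3))
    qed
    have "cmod (\<psi> h) \<le> B * hnorm HH (cls h)"
      using B(2)[OF cls_mem_H2[OF h(1)]] L_cls[OF h(1)] by simp
    also have "\<dots> \<le> B * S"
      unfolding S_def using B(1) h_le
      by (intro mult_left_mono hnorm_cls_le_of_modulus_le[OF h(1) p q _ R]) (auto simp: s_def)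
    finally have \<psi>h: "cmod (\<psi> h) \<le> B * S" .
    define k where "k x = \<psi> h * h' x" for x
    have kA: "k \<in> A" unfolding k_def by (rule uniform_algebra_cmult[OF A h(2)])
    have "\<psi> k = \<psi> h * \<psi> h'" unfolding k_def by (rule \<psi>_cmult[OF h(2)])
    also have "\<dots> = 1" using \<psi>_mult[OF h(1,2)] \<psi>_one by (simp add: h(3))
    finally have "\<psi> k = 1" .
    moreover have "cmod (k x * f x) \<le> C" if f: "cmod (f x) \<le> s x" for f :: "'a \<Rightarrow> complex" and x
    proof -
      have "cmod (k x * f x) \<le> cmod (\<psi> h) * (cmod (h' x) * s x)"
        using f by (simp add: k_def norm_mult mult.assoc mult_left_mono)
      also have "\<dots> \<le> B * S * exp K"
        using \<psi>h h'_le B(1) \<open>0 \<le> S\<close> s0[of x] by (intro mult_mono) auto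
      finally show ?thesis by (simp add: C_def)
    qed
    ultimately show ?thesis using kA s by blast
  qed
  with C show ?thesis by blast
qed

text \<open>The element is \<open>a g - b f\<close> with \<open>a = k p\<close> and
  \<open>b = k q\<close>. In coordinate \<open>j\<close> the two terms nearly cancel:
  \<open>a\<close> times \<open>g j\<close> is close to \<open>a q\<close>, \<open>b\<close> times
  \<open>f j\<close> is close to \<open>b p\<close>, and both of these equal \<open>k p q\<close>.
  Since \<open>C\<close> bounds \<open>a\<close> and \<open>b\<close> independently of the
  approximants, the error goes to 0 while \<open>R\<close> does not depend on
  \<open>e\<close>.\<close>

lemma graph_approximation:
  assumes K: "\<And>u. continuous_on UNIV u \<Longrightarrow> \<exists>w\<in>log_moduli A. \<forall>x. \<bar>u x - w x\<bar> \<le> K"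
    and I: "finite I" and N: "closed_subspace (hpow I HH) N"
    and N_mult: "\<And>a y. a \<in> A \<Longrightarrow> y \<in> N \<Longrightarrow> (\<lambda>i\<in>I. mult a (y i)) \<in> N"
    and i: "i \<in> I" and j: "j \<in> I" and f: "f \<in> N" and g: "g \<in> N"
  defines "W \<equiv> L (f j) * L (g i) - L (g j) * L (f i)"
  shows "\<exists>R. \<forall>e>0. \<exists>v\<in>N. hnorm (hpow I HH) v \<le> R \<and> hnorm HH (v j) \<le> e \<and> cmod (L (v i) - W) \<le> e"
proof -
  interpret P: hilbert_space "hpow I HH" by (rule H2.hilbert_space_hpow[OF I])
  note N = P.closed_subspaceD[OF N, unfolded hpow_simps]
  have V: "y l \<in> vectors HH" if "y \<in> N" "l \<in> I" for y l
    by (rule PiE_mem[OF subsetD[OF N(1) that(1)] that(2)])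
  obtain B where B: "0 < B" "\<And>F G. F \<in> vectors HH \<Longrightarrow> G \<in> vectors HH \<Longrightarrow> cmod (L F - L G) \<le> B * hdist HH F G"
    using L_bound by blast
  \<comment> \<open>The approximants below are at distance less than 1, so their norms stay below
    \<open>R0\<close> and one \<open>C\<close> serves all of them.\<close>
  define R0 where "R0 = max (hnorm HH (f j)) (hnorm HH (g j)) + 1"
  obtain C where C: "0 < C" and mult: "\<And>p q. p \<in> A \<Longrightarrow> q \<in> A \<Longrightarrow> hnorm HH (cls p) \<le> R0 \<Longrightarrow> hnorm HH (cls q) \<le> R0 \<Longrightarrow>
    \<exists>k\<in>A. \<psi> k = 1 \<and> (\<forall>x. cmod (k x * p x) \<le> C) \<and> (\<forall>x. cmod (k x * q x) \<le> C)"
    using exists_normalized_multiplier[OF K, of R0] by blast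
  define R where "R = sqrt (\<Sum>l\<in>I. (C * hnorm HH (g l) + C * hnorm HH (f l))\<^sup>2)"
  \<comment> \<open>The constants of both error estimates are collected, \<open>2 * C\<close> for
    coordinate \<open>j\<close> and the term with \<open>B\<close> for the value at
    \<open>\<psi>\<close>, so that a single \<open>d\<close> serves for both.\<close>
  define S where "S = 2 * C + B * (cmod (L (g i)) + cmod (L (f i))) + 1"
  have S: "0 < S" using C B(1) by (simp add: S_def add_pos_nonneg)
  have "\<exists>v\<in>N. hnorm (hpow I HH) v \<le> R \<and> hnorm HH (v j) \<le> e \<and> cmod (L (v i) - W) \<le> e" if e: "0 < e" for e
  proof -
    define d where "d = min 1 (e / S)"
    have d: "0 < d" "d \<le> 1" using e S by (auto simp: d_def)
    have "d \<le> e / S" by (simp add: d_def)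
    then have Sd: "S * d \<le> e" using S by (simp add: field_simps)
    obtain p where p: "p \<in> A" "hdist HH (f j) (cls p) < d"
      using approx_A[OF V[OF f j] d(1)] by blast
    obtain q where q: "q \<in> A" "hdist HH (g j) (cls q) < d"
      using approx_A[OF V[OF g j] d(1)] by blast
    note pH = cls_mem_H2[OF p(1)] and qH = cls_mem_H2[OF q(1)]
    have "hnorm HH (cls p) \<le> R0"
      using H2.norm_le_dist[OF pH V[OF f j]] H2.dist_commute[OF pH V[OF f j]] p(2) d(2)
      unfolding R0_def by linarith
    moreover have "hnorm HH (cls q) \<le> R0"
      using H2.norm_le_dist[OF qH V[OF g j]] H2.dist_commute[OF qH V[OF g j]] q(2) d(2)
      unfolding R0_def by linarith
    ultimately obtain k where k: "k \<in> A" "\<psi> k = 1" "\<And>x. cmod (k x * p x) \<le> C" "\<And>x. cmod (k x * q x) \<le> C"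
      using mult[OF p(1) q(1)] by blast
    define a where "a x = k x * p x" for x
    define b where "b x = k x * q x" for x
    have a: "a \<in> A" "\<And>x. cmod (a x) \<le> C" "\<psi> a = L (cls p)"
      unfolding a_def using uniform_algebraD(4)[OF A k(1) p(1)] k(3) \<psi>_mult[OF k(1) p(1)] k(2) L_cls[OF p(1)]
      by simp_all
    have b: "b \<in> A" "\<And>x. cmod (b x) \<le> C" "\<psi> b = L (cls q)"
      unfolding b_def using uniform_algebraD(4)[OF A k(1) q(1)] k(4) \<psi>_mult[OF k(1) q(1)] k(2) L_cls[OF q(1)]
      by simp_all
    \<comment> \<open>The nested restrictions reproduce the operations of \<open>hpow\<close>
      literally, so that the closure properties of \<open>N\<close> apply as they stand.\<close>
    define v where "v = (\<lambda>l\<in>I. hadd HH ((\<lambda>l\<in>I. mult a (g l)) l)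
      ((\<lambda>l\<in>I. hscale HH (-1) ((\<lambda>l\<in>I. mult b (f l)) l)) l))"
    have vN: "v \<in> N"
      unfolding v_def by (rule N(3)[OF N_mult[OF a(1) g] N(4)[OF N_mult[OF b(1) f]]])
    have v: "v l = hadd HH (mult a (g l)) (hscale HH (-1) (mult b (f l)))" if "l \<in> I" for l
      using that by (simp only: v_def restrict_apply')
    have magl: "mult a (g l) \<in> vectors HH" "mult b (f l) \<in> vectors HH" if "l \<in> I" for l
      by (rule mult_A_mem_H2[OF a(1) V[OF g that]], rule mult_A_mem_H2[OF b(1) V[OF f that]])
    have "hnorm (hpow I HH) v \<le> R"
    proof -
      have le: "hnorm HH (v l) \<le> C * hnorm HH (g l) + C * hnorm HH (f l)" if l: "l \<in> I" for l
      proof -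
        have "hnorm HH (v l) \<le> hnorm HH (mult a (g l)) + hnorm HH (mult b (f l))"
          using H2.norm_add_le[OF magl(1)[OF l] H2.scale_mem[OF magl(2)[OF l], of "-1"]] H2.norm_scale[OF magl(2)[OF l], of "-1"]
          unfolding v[OF l] by (simp only: norm_minus_cancel norm_one mult_1)
        also have "\<dots> \<le> C * hnorm HH (g l) + C * hnorm HH (f l)"
          by (intro add_mono mult_A_norm_le a b V f g l less_imp_le[OF C])
        finally show ?thesis .
      qed
      have "hnorm (hpow I HH) v = sqrt (\<Sum>l\<in>I. (hnorm HH (v l))\<^sup>2)"
        by (rule H2.hnorm_hpow[OF subsetD[OF N(1) vN]])
      also have "\<dots> \<le> R"
        unfolding R_def by (intro real_sqrt_le_mono sum_mono power_mono le H2.norm_ge_0[OF V[OF vN]])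
      finally show ?thesis .
    qed
    moreover have "hnorm HH (v j) \<le> e"
    proof -
      let ?Z = "cls (\<lambda>x. a x * q x)"
      have Z: "mult a (cls q) = ?Z"
        by (rule mult_cls[OF measurable_A[OF a(1)] measurable_A[OF q(1)]])
      have Z': "mult b (cls p) = ?Z"
        unfolding mult_cls[OF measurable_A[OF b(1)] measurable_A[OF p(1)]] by (simp add: a_def b_def mult_ac)
      have ZH: "?Z \<in> vectors HH"
        by (rule cls_mem_H2[OF uniform_algebraD(4)[OF A a(1) q(1)]])
      have "hnorm HH (v j) = hdist HH (mult a (g j)) (mult b (f j))"
        unfolding v[OF j] hdist_def ..
      also have "\<dots> \<le> hdist HH (mult a (g j)) ?Z + hdist HH ?Z (mult b (f j))"
        by (rule H2.dist_triangle[OF magl(1)[OF j] ZH magl(2)[OF j]])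
      also have "hdist HH (mult a (g j)) ?Z \<le> C * hdist HH (g j) (cls q)"
        unfolding Z[symmetric] by (rule mult_A_dist_le[OF a(1,2) less_imp_le[OF C] V[OF g j] qH])
      also have "hdist HH ?Z (mult b (f j)) = hdist HH (mult b (f j)) ?Z"
        by (rule H2.dist_commute[OF ZH magl(2)[OF j]])
      also have "\<dots> \<le> C * hdist HH (f j) (cls p)"
        unfolding Z'[symmetric] by (rule mult_A_dist_le[OF b(1,2) less_imp_le[OF C] V[OF f j] pH])
      finally have "hnorm HH (v j) \<le> C * hdist HH (g j) (cls q) + C * hdist HH (f j) (cls p)"
        by simp
      also have "\<dots> \<le> C * d + C * d"
        using p(2) q(2) C by (intro add_mono mult_left_mono) auto
      also have "\<dots> \<le> S * d"
        using d B(1) by (simp add: S_def algebra_simps add_nonneg_nonneg)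
      finally show ?thesis using Sd by simp
    qed
    moreover have "cmod (L (v i) - W) \<le> e"
    proof -
      have "L (v i) = L (cls p) * L (g i) - L (cls q) * L (f i)"
        unfolding v[OF i] L_diff[OF magl[OF i]] L_mult[OF a(1) V[OF g i]] L_mult[OF b(1) V[OF f i]] a(3) b(3) ..
      then have "L (v i) - W = (L (cls p) - L (f j)) * L (g i) - (L (cls q) - L (g j)) * L (f i)"
        by (simp add: W_def algebra_simps)
      also have "cmod \<dots> \<le> cmod ((L (cls p) - L (f j)) * L (g i)) + cmod ((L (cls q) - L (g j)) * L (f i))"
        by (rule norm_triangle_ineq4)
      also have "\<dots> = cmod (L (f j) - L (cls p)) * cmod (L (g i)) + cmod (L (g j) - L (cls q)) * cmod (L (f i))"
        by (simp add: norm_mult norm_minus_commute)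
      also have "\<dots> \<le> B * d * cmod (L (g i)) + B * d * cmod (L (f i))"
      proof (intro add_mono mult_right_mono)
        show "cmod (L (f j) - L (cls p)) \<le> B * d"
          using B(2)[OF V[OF f j] pH] mult_left_mono[OF less_imp_le[OF p(2)] less_imp_le[OF B(1)]] by (rule order_trans)
        show "cmod (L (g j) - L (cls q)) \<le> B * d"
          using B(2)[OF V[OF g j] qH] mult_left_mono[OF less_imp_le[OF q(2)] less_imp_le[OF B(1)]] by (rule order_trans)
      qed auto
      also have "\<dots> \<le> S * d"
        using d C by (simp add: S_def algebra_simps)
      finally show ?thesis using Sd by simp
    qed
    ultimately show ?thesis using vN by blast
  qed
  then show ?thesis by blast
qed

text \<open>If the graph has a nonzero defect \<open>W\<close>, a bounded net of its elements has first coordinate tending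
  to \<open>0\<close> and value \<open>W\<close> at \<open>\<psi>\<close>; a weak limit point contradicts the graph property.\<close>

lemma graph_evaluation:
  assumes K: "\<And>u. continuous_on UNIV u \<Longrightarrow> \<exists>w\<in>log_moduli A. \<forall>x. \<bar>u x - w x\<bar> \<le> K"
    and I: "finite I" and N: "closed_subspace (hpow I HH) N"
    and N_mult: "\<And>a y. a \<in> A \<Longrightarrow> y \<in> N \<Longrightarrow> (\<lambda>i\<in>I. mult a (y i)) \<in> N"
    and i: "i \<in> I" and j: "j \<in> I" and f: "f \<in> N" and g: "g \<in> N"
    and graph: "\<And>y. y \<in> N \<Longrightarrow> y j = hzero HH \<Longrightarrow> y = hzero (hpow I HH)"
  shows "L (f j) * L (g i) = L (g j) * L (f i)"
proof -
  interpret P: hilbert_space "hpow I HH" by (rule H2.hilbert_space_hpow[OF I])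
  note Ns = P.closed_subspaceD[OF N, unfolded hpow_simps]
  have V: "y l \<in> vectors HH" if "y \<in> N" "l \<in> I" for y l
    by (rule PiE_mem[OF subsetD[OF Ns(1) that(1)] that(2)])
  obtain B where B: "0 < B" "\<And>F G. F \<in> vectors HH \<Longrightarrow> G \<in> vectors HH \<Longrightarrow> cmod (L F - L G) \<le> B * hdist HH F G"
    using L_bound by blast
  define W where "W = L (f j) * L (g i) - L (g j) * L (f i)"
  obtain R where R: "\<And>e. 0 < e \<Longrightarrow> \<exists>v\<in>N. hnorm (hpow I HH) v \<le> R \<and> hnorm HH (v j) \<le> e \<and> cmod (L (v i) - W) \<le> e"
    using graph_approximation[OF K I N N_mult i j f g] unfolding W_def by blast
  \<comment> \<open>Both conditions pass to midpoints, since the coordinates and \<open>L\<close>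
    are linear, and \<open>R\<close> supplies bounded elements; almost minimal elements of these
    sets therefore converge in norm, to a vector of \<open>N\<close> with coordinate
    \<open>j\<close> equal to 0.\<close>
  define C where "C n = {v \<in> N. hnorm HH (v j) \<le> 1 / real (Suc n) \<and> cmod (L (v i) - W) \<le> 1 / real (Suc n)}" for n
  have "\<exists>z\<in>vectors (hpow I HH). \<exists>v. (\<forall>n. v n \<in> C n) \<and> (\<lambda>n. hdist (hpow I HH) (v n) z) \<longlonglongrightarrow> 0 \<and>
    (\<forall>n. \<forall>w\<in>C n. (hnorm (hpow I HH) (v n))\<^sup>2 \<le> (hnorm (hpow I HH) w)\<^sup>2 + 1 / real (Suc n))"
  proof (rule P.nested_midconvex_limit)
    show "C n \<subseteq> vectors (hpow I HH)" for n
      unfolding C_def hpow_simps using Ns(1) by blast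
    show "C n \<subseteq> C k" if "k \<le> n" for k n
    proof -
      have "1 / real (Suc n) \<le> 1 / real (Suc k)" using that by (simp add: field_simps)
      then show ?thesis unfolding C_def using order_trans by blast
    qed
    show "\<exists>x\<in>C n. hnorm (hpow I HH) x \<le> R" for n
      using R[of "1 / real (Suc n)"] by (auto simp: C_def)
    fix n x y assume "x \<in> C n" "y \<in> C n"
    then have x: "x \<in> N" "hnorm HH (x j) \<le> 1 / real (Suc n)" "cmod (L (x i) - W) \<le> 1 / real (Suc n)"
      and y: "y \<in> N" "hnorm HH (y j) \<le> 1 / real (Suc n)" "cmod (L (y i) - W) \<le> 1 / real (Suc n)"
      by (simp_all only: C_def mem_Collect_eq)
    let ?z = "hscale (hpow I HH) (1/2) (hadd (hpow I HH) x y)"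
    have zN: "?z \<in> N" unfolding hpow_simps by (rule Ns(4)[OF Ns(3)[OF x(1) y(1)]])
    have z: "?z l = hscale HH (1/2) (hadd HH (x l) (y l))" if "l \<in> I" for l
      using that by (simp only: hpow_simps restrict_apply')
    have "hnorm HH (?z j) = 1/2 * hnorm HH (hadd HH (x j) (y j))"
      unfolding z[OF j] H2.norm_scale[OF H2.add_mem[OF V[OF x(1) j] V[OF y(1) j]]] by simp
    also have "\<dots> \<le> 1 / real (Suc n)"
      using H2.norm_add_le[OF V[OF x(1) j] V[OF y(1) j]] x(2) y(2) by linarith
    finally have "hnorm HH (?z j) \<le> 1 / real (Suc n)" .
    moreover have "cmod (L (?z i) - W) \<le> 1 / real (Suc n)"
    proof -
      have "L (?z i) - W = 1/2 * ((L (x i) - W) + (L (y i) - W))"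
        unfolding z[OF i] L_scale[OF H2.add_mem[OF V[OF x(1) i] V[OF y(1) i]]] L_add[OF V[OF x(1) i] V[OF y(1) i]]
        by (simp add: field_simps)
      also have "cmod \<dots> = 1/2 * cmod ((L (x i) - W) + (L (y i) - W))"
        by (simp only: norm_mult) simp
      also have "\<dots> \<le> 1 / real (Suc n)"
        using norm_triangle_ineq[of "L (x i) - W" "L (y i) - W"] x(3) y(3) by linarith
      finally show ?thesis .
    qed
    ultimately show "?z \<in> C n" unfolding C_def using zN by blast
  qed
  then obtain z v where z: "z \<in> vectors (hpow I HH)" and v: "\<And>n. v n \<in> C n"
    and lim: "(\<lambda>n. hdist (hpow I HH) (v n) z) \<longlonglongrightarrow> 0"
    by blast
  have vN: "v n \<in> N" and vj: "hnorm HH (v n j) \<le> 1 / real (Suc n)" and vi: "cmod (L (v n i) - W) \<le> 1 / real (Suc n)" for n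
    using v[of n] by (simp_all only: C_def mem_Collect_eq)
  have zN: "z \<in> N"
    using P.mem_hclosureI_limit[OF z vN lim] P.closed_subspaceD(1,5)[OF N] by blast
  have dist: "hdist HH (v n l) (z l) \<le> hdist (hpow I HH) (v n) z" if "l \<in> I" for n l
    by (rule H2.hdist_coord_le[OF I subsetD[OF Ns(1) vN] subsetD[OF Ns(1) zN] that])
  have null: "(\<lambda>n. c * hdist (hpow I HH) (v n) z + 1 / real (Suc n)) \<longlonglongrightarrow> 0" for c
    using tendsto_add[OF tendsto_mult_left[OF lim, of c] LIMSEQ_inverse_real_of_nat]
    by (simp add: inverse_eq_divide)
  have "hnorm HH (z j) \<le> 1 * hdist (hpow I HH) (v n) z + 1 / real (Suc n)" for n
    using H2.norm_le_dist[OF V[OF zN j] V[OF vN[of n] j]] H2.dist_commute[OF V[OF zN j] V[OF vN[of n] j]]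
      dist[OF j, of n] vj[of n] by linarith
  then have "hnorm HH (z j) \<le> 0"
    by (intro LIMSEQ_le_const[OF null]) blast
  then have "hnorm HH (z j) = 0" using H2.norm_ge_0[OF V[OF zN j]] by linarith
  then have "z = hzero (hpow I HH)" by (intro graph zN H2.norm_eq_0D V j)
  then have "z i = hzero HH" using i by (simp only: hpow_simps restrict_apply')
  then have Lz: "L (z i) = 0"
    using L_scale[OF H2.zero_mem, of 0] H2.scale_zero[of 0] by (simp only:) simp
  have "cmod W \<le> B * hdist (hpow I HH) (v n) z + 1 / real (Suc n)" for n
  proof -
    have "cmod (L (v n i)) \<le> B * hdist HH (v n i) (z i)"
      using B(2)[OF V[OF vN[of n] i] V[OF zN i]] Lz by simp
    also have "\<dots> \<le> B * hdist (hpow I HH) (v n) z"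
      using dist[OF i, of n] B(1) by (intro mult_left_mono) auto
    finally show ?thesis
      using vi[of n] norm_triangle_ineq2[of W "L (v n i)"] norm_minus_commute[of W "L (v n i)"] by linarith
  qed
  then have "cmod W \<le> 0"
    by (intro LIMSEQ_le_const[OF null]) blast
  then show ?thesis by (simp add: W_def)
qed

end

section \<open>Graph transformations on H^2 are scalar\<close>

context uniform_algebra_measure
begin

theorem graph_transformations_scalar_H2:
  assumes K: "\<And>u. continuous_on UNIV u \<Longrightarrow> \<exists>w\<in>log_moduli A. \<forall>x. \<bar>u x - w x\<bar> \<le> K"
    and rk: "H2_reproducing_kernel A m"
    and trans: "transitive_algebra HH \<A>" and sub: "mult_op A m ` Hinf A m \<subseteq> \<A>"
    and I: "finite I"
  shows "graph_transformations_scalar I HH \<A>"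
  unfolding graph_transformations_scalar_def
proof (intro allI ballI impI)
  fix N j i
  assume j: "j \<in> I" and i: "i \<in> I"
    and "invariant_subspace_pow I HH \<A> N \<and> (\<forall>y\<in>N. y j = hzero HH \<longrightarrow> y = hzero (hpow I HH))"
  then have N: "invariant_subspace_pow I HH \<A> N"
    and graph: "\<And>y. y \<in> N \<Longrightarrow> y j = hzero HH \<Longrightarrow> y = hzero (hpow I HH)"
    by blast+
  note Ns = H2.invariant_subspace_powD[OF N]
  have V: "y l \<in> vectors HH" if "y \<in> N" "l \<in> I" for y l
    by (rule PiE_mem[OF subsetD[OF Ns(2) that(1)] that(2)])
  note trD = H2.transitive_algebraD[OF trans]
  have N_mult: "(\<lambda>i\<in>I. mult a (y i)) \<in> N" if a: "a \<in> A" and y: "y \<in> N" for a y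
  proof -
    have "mult_op A m (cls a) \<in> \<A>"
      using sub Hinf_fun_A[OF a] unfolding Hinf_eq by blast
    from Ns(6)[OF this y] have "(\<lambda>i\<in>I. mult_op A m (cls a) (y i)) \<in> N" .
    also have "(\<lambda>i\<in>I. mult_op A m (cls a) (y i)) = (\<lambda>i\<in>I. mult a (y i))"
      by (intro restrict_ext mult_op_apply V y)
    finally show ?thesis .
  qed
  show "\<exists>c. \<forall>y\<in>N. y i = hscale HH c (y j)"
  proof (cases "\<exists>g\<in>N. g j \<noteq> hzero HH")
    case False
    \<comment> \<open>By the graph property \<open>N\<close> contains only the zero tuple in this
      case, so any scalar would serve.\<close>
    have "y i = hscale HH 0 (y j)" if y: "y \<in> N" for y
    proof -
      have "y = hzero (hpow I HH)" using graph y False by blast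
      then have "y i = hzero HH" using i by (simp only: hpow_simps restrict_apply')
      then show ?thesis using H2.zero_scale[OF V[OF y j]] by (simp only:)
    qed
    then show ?thesis by blast
  next
    case True
    then obtain g where g: "g \<in> N" "g j \<noteq> hzero HH" by blast
    obtain \<Omega> ev where \<Omega>: "\<forall>\<psi>\<in>\<Omega>. mult_functional A \<psi>"
      and ev: "\<forall>\<psi>\<in>\<Omega>. bounded_functional HH (ev \<psi>) \<and> (\<forall>f\<in>A. ev \<psi> (cls f) = \<psi> f)"
      and sep: "\<forall>F\<in>vectors HH. (\<forall>\<psi>\<in>\<Omega>. ev \<psi> F = 0) \<longrightarrow> F = hzero HH"
      using rk unfolding H2_reproducing_kernel_def by (elim exE conjE)
    obtain \<psi> where \<psi>: "\<psi> \<in> \<Omega>" "ev \<psi> (g j) \<noteq> 0"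
      using bspec[OF sep V[OF g(1) j]] g(2) by blast
    interpret E: H2_evaluation A m \<psi> "ev \<psi>"
      using bspec[OF \<Omega> \<psi>(1)] bspec[OF ev \<psi>(1)]
      by (intro H2_evaluation.intro H2_evaluation_axioms.intro uniform_algebra_measure_axioms) blast+
    \<comment> \<open>\<open>c\<close> is read off at the single point \<open>\<psi>\<close>. That
      the relation holds as an identity in H^2, and not just at this point, will come from
      transitivity.\<close>
    define c where "c = ev \<psi> (g i) / ev \<psi> (g j)"
    define D where "D = (\<lambda>y. hadd HH (y i) (hscale HH (- c) (y j))) ` N"
    have D_V: "D \<subseteq> vectors HH"
      unfolding D_def using V i j by (intro image_subsetI H2.add_mem H2.scale_mem)
    have D_ev: "ev \<psi> F = 0" if F: "F \<in> D" for F
    proof -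
      obtain y where y: "y \<in> N" "F = hadd HH (y i) (hscale HH (- c) (y j))"
        using F unfolding D_def by blast
      have "ev \<psi> F = ev \<psi> (y i) - c * ev \<psi> (y j)"
        unfolding y(2) E.L_add[OF V[OF y(1) i] H2.scale_mem[OF V[OF y(1) j]]] E.L_scale[OF V[OF y(1) j]] by simp
      also have "\<dots> = 0"
        using E.graph_evaluation[OF K I Ns(1) N_mult i j y(1) g(1) graph] \<psi>(2)
        by (simp add: c_def field_simps)
      finally show ?thesis .
    qed
    have closed: "closed_subspace HH (hclosure HH D)"
    proof (rule H2.closed_subspace_hclosure[OF D_V])
      have z: "(\<lambda>l\<in>I. hzero HH) i = hzero HH" "(\<lambda>l\<in>I. hzero HH) j = hzero HH"
        using i j by (simp_all only: restrict_apply')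
      have eq: "hadd HH (hzero HH) (hscale HH (- c) (hzero HH)) = hzero HH"
        unfolding H2.scale_zero H2.add_zero(1)[OF H2.zero_mem] ..
      show "hzero HH \<in> D"
        unfolding D_def by (rule image_eqI[OF _ Ns(3)]) (simp only: z eq)
    next
      fix F G assume "F \<in> D" "G \<in> D"
      then obtain x y where xy: "x \<in> N" "y \<in> N" "F = hadd HH (x i) (hscale HH (- c) (x j))"
        "G = hadd HH (y i) (hscale HH (- c) (y j))"
        unfolding D_def by blast
      note Vs = V[OF xy(1) i] V[OF xy(1) j] V[OF xy(2) i] V[OF xy(2) j]
      have "hadd HH F G = hadd HH (hadd HH (x i) (y i)) (hscale HH (- c) (hadd HH (x j) (y j)))"
        unfolding xy(3,4) using Vs by (intro H2.vec_eqI) (simp_all add: algebra_simps del: H2_simps)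
      also have "\<dots> \<in> D"
        unfolding D_def by (rule image_eqI[OF _ Ns(4)[OF xy(1,2)]]) (simp only: restrict_apply'[OF i] restrict_apply'[OF j])
      finally show "hadd HH F G \<in> D" .
    next
      fix b F assume "F \<in> D"
      then obtain x where x: "x \<in> N" "F = hadd HH (x i) (hscale HH (- c) (x j))"
        unfolding D_def by blast
      note Vs = V[OF x(1) i] V[OF x(1) j]
      have "hscale HH b F = hadd HH (hscale HH b (x i)) (hscale HH (- c) (hscale HH b (x j)))"
        unfolding x(2) using Vs by (intro H2.vec_eqI) (simp_all add: algebra_simps del: H2_simps)
      also have "\<dots> \<in> D"
        unfolding D_def by (rule image_eqI[OF _ Ns(5)[OF x(1)]]) (simp only: restrict_apply'[OF i] restrict_apply'[OF j])
      finally show "hscale HH b F \<in> D" .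
    qed
    have inv: "T ` hclosure HH D \<subseteq> hclosure HH D" if T: "T \<in> \<A>" for T
    proof (rule H2.hclosure_invariant[OF _ D_V])
      show Tb: "T \<in> bounded_ops HH" using T trD(1) by blast
      show "T ` D \<subseteq> D"
      proof (rule image_subsetI)
        fix F assume "F \<in> D"
        then obtain x where x: "x \<in> N" "F = hadd HH (x i) (hscale HH (- c) (x j))"
          unfolding D_def by blast
        have "T F = hadd HH (T (x i)) (hscale HH (- c) (T (x j)))"
          unfolding x(2) H2.bounded_opsD(2)[OF Tb V[OF x(1) i] H2.scale_mem[OF V[OF x(1) j]]]
            H2.bounded_opsD(3)[OF Tb V[OF x(1) j]] ..
        also have "\<dots> \<in> D"
          unfolding D_def by (rule image_eqI[OF _ Ns(6)[OF T x(1)]]) (simp only: restrict_apply'[OF i] restrict_apply'[OF j])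
        finally show "T F \<in> D" .
      qed
    qed
    have cl_ev: "ev \<psi> F = 0" if F: "F \<in> hclosure HH D" for F
    proof (rule ccontr)
      assume nz: "ev \<psi> F \<noteq> 0"
      have FV: "F \<in> vectors HH" using F H2.hclosure_subset_V by blast
      obtain B where B: "0 < B" "\<And>F G. F \<in> vectors HH \<Longrightarrow> G \<in> vectors HH \<Longrightarrow> cmod (ev \<psi> F - ev \<psi> G) \<le> B * hdist HH F G"
        using E.L_bound by blast
      obtain G where G: "G \<in> D" "hdist HH F G < cmod (ev \<psi> F) / B"
        using H2.hclosureD[OF F, of "cmod (ev \<psi> F) / B"] nz B(1) by auto
      have "cmod (ev \<psi> F) \<le> B * hdist HH F G"
        using B(2)[OF FV subsetD[OF D_V G(1)]] D_ev[OF G(1)] by simp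
      also have "\<dots> < cmod (ev \<psi> F)" using G(2) B(1) by (simp add: field_simps)
      finally show False by simp
    qed
    have "F = hzero HH" if F: "F \<in> D" for F
    proof (rule ccontr)
      assume "F \<noteq> hzero HH"
      then have "hclosure HH D = vectors HH"
        using trD(2)[OF closed inv] subsetD[OF H2.subset_hclosure[OF D_V] F] by blast
      \<comment> \<open>The closure of \<open>D\<close> cannot be everything, because
        \<open>g j\<close> has a nonzero value at \<open>\<psi>\<close>.\<close>
      then show False using cl_ev V[OF g(1) j] \<psi>(2) by blast
    qed
    then have zero: "hadd HH (y i) (hscale HH (- c) (y j)) = hzero HH" if "y \<in> N" for y
      using that unfolding D_def by blast
    have "y i = hscale HH c (y j)" if y: "y \<in> N" for y
    proof (rule H2.vec_eqI)
      fix w assume w: "w \<in> vectors HH"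
      have "hinner HH (hadd HH (y i) (hscale HH (- c) (y j))) w = 0"
        unfolding zero[OF y] by (rule H2.inner_zero[OF w])
      then show "hinner HH (y i) w = hinner HH (hscale HH c (y j)) w"
        unfolding H2.inner_add[OF V[OF y i] H2.scale_mem[OF V[OF y j]] w]
          H2.inner_scale[OF V[OF y j] w] by simp
    qed (use V[OF y] i j in blast)+
    then show ?thesis by blast
  qed
qed

end

theorem theorem3p5:
  fixes A :: "('a::t2_space \<Rightarrow> complex) set"
    and \<phi> :: "('a \<Rightarrow> complex) \<Rightarrow> complex"
    and m :: "'a measure"
  assumes "compact (UNIV :: 'a set)"
    and "hypo_Dirichlet A"
    and "mult_functional A \<phi>"
    and "representing_measure A \<phi> m"
    and "core_measure A \<phi> m"
    and "H2_reproducing_kernel A m"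
  shows "catalytic (H2 A m) (mult_op A m ` Hinf A m)"
proof -
  interpret uniform_algebra_measure A m
    by (rule uniform_algebra_measure.intro) (use assms in \<open>simp_all add: hypo_Dirichlet_def representing_measure_def regular_borel_measure_def\<close>)
  obtain K where "\<And>u. continuous_on UNIV u \<Longrightarrow> \<exists>w\<in>log_moduli A. \<forall>x. \<bar>u x - w x\<bar> \<le> K"
    using hypo_Dirichlet_log_moduli[OF assms(1,2)] by blast
  then have "strongly_dense (H2 A m) \<A>"
    if "transitive_algebra (H2 A m) \<A>" "mult_op A m ` Hinf A m \<subseteq> \<A>" for \<A>
    using that assms(6)
    by (intro H2.strongly_dense_if_graph_transformations_scalar graph_transformations_scalar_H2)
  moreover have "mult_op A m ` Hinf A m \<subseteq> bounded_ops (H2 A m)"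
    unfolding Hinf_eq using mult_op_bounded by blast
  ultimately show ?thesis
    unfolding catalytic_def by blast
qed

end
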